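(* There exists $\delta>0$ such that, for every (complex-valued) $f\in L^2(\mathbb{S}^1)$ with $\|f-\mathbf{1}\|_{L^2(\mathbb{S}^1)}<\delta$, we have $\Phi(f)\leq \Phi(\mathbf{1})$, where $\mathbf{1}$ denotes the constant function equal to $1$ on $\mathbb{S}^1$.
   Context: $(\mathbb{S}^1,\sigma)$ is the unit circle in $\mathbb{R}^2$ equipped with its arc length measure $\sigma$ (total mass $2\pi$), and $L^2(\mathbb{S}^1)=L^2(\mathbb{S}^1,\sigma)$. For $f\in L^2(\mathbb{S}^1)$, the Fourier transform of the measure $f\sigma$ is $$\widehat{f\sigma}(x)=\int_{\mathbb{S}^1} f(\omega)\,e^{-i x\cdot\omega}\,d\sigma_\omega,\qquad x\in\mathbb{R}^2.$$ For $0\neq f\in L^2(\mathbb{S}^1)$, define $$\Phi(f) := \|\widehat{f\sigma}\|_{L^6(\mathbb{R}^2)}\,\|f\|_{L^2(\mathbb{S}^1)}^{-1}.$$ (By the Tomas–Stein inequality $\Phi$ is bounded on $L^2(\mathbb{S}^1)\setminus\{0\}$.) *)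

theory Defs
  imports "HOL-Analysis.Analysis"
begin

abbreviation unit_circle :: "(real^2) set" where
  "unit_circle \<equiv> sphere 0 1"

text \<open>Arc length measure on the unit circle, as the image of Lebesgue measure on
  \<open>[0, 2\<pi>)\<close> under the unit speed parametrisation.\<close>

definition arc_measure :: "(real^2) measure" where
  "arc_measure = distr (restrict_space lborel {0..<2 * pi}) (restrict_space borel unit_circle)
     (\<lambda>t. vector [cos t, sin t])"

lemma measurable_circle_param:
  "(\<lambda>t. vector [cos t, sin t]) \<in> restrict_space lborel {0..<2 * pi} \<rightarrow>\<^sub>M restrict_space borel unit_circle"
proof -
  have vec: "(vector [cos t, sin t] :: real^2) = (\<chi> i. if i = 1 then cos t else sin t)" for t :: real
    by (simp add: vec_eq_iff forall_2)
  have "continuous_on UNIV (\<lambda>t::real. \<chi> i. if i = 1 then cos t else sin t :: real^2)"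
  proof (rule continuous_on_vec_lambda)
    show "continuous_on UNIV (\<lambda>t::real. if i = 1 then cos t else sin t)" for i :: 2
      by (cases "i = 1") (auto intro!: continuous_intros)
  qed
  then have "(\<lambda>t::real. vector [cos t, sin t] :: real^2) \<in> borel \<rightarrow>\<^sub>M borel"
    unfolding vec by (rule borel_measurable_continuous_onI)
  moreover have "norm (vector [cos t, sin t] :: real^2) = 1" for t :: real
    by (simp add: norm_eq_sqrt_inner inner_vec_def sum_2 flip: power2_eq_square)
  ultimately show ?thesis
    by (auto intro!: measurable_restrict_space2 measurable_restrict_space1)
qed

lemma space_arc_measure [simp]: "space arc_measure = unit_circle"
  by (simp add: arc_measure_def space_restrict_space)

lemma sets_arc_measure [measurable_cong]: "sets arc_measure = sets (restrict_space borel unit_circle)"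
  by (simp add: arc_measure_def)

lemma emeasure_arc_measure: "emeasure arc_measure unit_circle = ennreal (2 * pi)"
proof -
  have "unit_circle \<in> sets (restrict_space borel unit_circle)"
    by (simp add: sets_restrict_space_iff)
  moreover have "(vector [cos t, sin t] :: real^2) \<in> unit_circle" for t :: real
    by (simp add: norm_eq_sqrt_inner inner_vec_def sum_2 flip: power2_eq_square)
  ultimately show ?thesis
    unfolding arc_measure_def
    by (subst emeasure_distr[OF measurable_circle_param])
       (simp_all add: space_restrict_space emeasure_restrict_space vimage_def)
qed

text \<open>The \<open>L\<^sup>p\<close> norm with values in \<open>[0, \<infinity>]\<close>, so that a function outside
  \<open>L\<^sup>p\<close> gets norm \<open>\<infinity>\<close> and not the default value \<open>0\<close> of the Bochner integral.\<close>

definition Lp_norm :: "real \<Rightarrow> 'a measure \<Rightarrow> ('a \<Rightarrow> complex) \<Rightarrow> ennreal" where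
  "Lp_norm p M f =
     (let I = \<integral>\<^sup>+ x. ennreal (norm (f x) powr p) \<partial>M
      in if I = \<infinity> then \<infinity> else ennreal (enn2real I powr (1 / p)))"

text \<open>Elements of \<open>L\<^sup>2\<close> of the circle are represented by functions on the plane;
  their values off the circle are irrelevant.\<close>

definition L2_circle :: "(real^2 \<Rightarrow> complex) set" where
  "L2_circle = {f \<in> borel_measurable arc_measure. Lp_norm 2 arc_measure f < \<infinity>}"

definition fourier_ext :: "(real^2 \<Rightarrow> complex) \<Rightarrow> real^2 \<Rightarrow> complex" where
  "fourier_ext f x = (LINT \<omega>|arc_measure. f \<omega> * exp (- \<i> * complex_of_real (x \<bullet> \<omega>)))"

text \<open>Meaningful only if \<open>f\<close> is nonzero in \<open>L\<^sup>2\<close>; otherwise the quotient is \<open>0 / 0 = 0\<close>.\<close>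

definition Phi :: "(real^2 \<Rightarrow> complex) \<Rightarrow> ennreal" where
  "Phi f = Lp_norm 6 lborel (fourier_ext f) / Lp_norm 2 arc_measure f"

end

theory Submission
  imports Defs "HOL-Probability.Probability"
begin

text \<open>Put \<open>\<mu> = \<close> the extension of the constant 1. Since \<open>|fourier_ext f|\<^sup>2\<close> is the extension of a
  function of two points, replacing \<open>f\<close> by \<open>h = sqrt ((|f(\<omega>)|\<^sup>2 + |f(- \<omega>)|\<^sup>2) / 2)\<close> keeps the \<open>L\<^sup>2\<close> norm and
  does not decrease the \<open>L\<^sup>6\<close> norm, by majorizing Fourier transforms. So one may take
  \<open>h = c (1 + g)\<close> real and antipodally symmetric, with \<open>g\<close> of mean 0 and extension \<open>\<gamma>\<close>. In the
  expansion of \<open>\<integral>(\<mu> + \<gamma>)\<^sup>6\<close> the linear term vanishes by rotation invariance. The quadratic term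
  \<open>15 \<integral>\<mu>\<^sup>4 \<gamma>\<^sup>2\<close> is diagonalized by the Jacobi-Anger expansion with eigenvalues proportional to
  \<open>I\<^sub>n = \<integral>J\<^sub>0\<^sup>4 J\<^sub>n\<^sup>2 r dr\<close>, \<open>n\<close> even, and the maximum is nondegenerate because \<open>5 I\<^sub>n < I\<^sub>0\<close> for \<open>n \<ge> 2\<close>. The
  remainder is cubic in the norm of \<open>g\<close> by the Tomas-Stein inequality. For that inequality with \<open>h \<ge> 0\<close>
  antipodally symmetric, \<open>\<integral>\<gamma>\<^sup>6\<close> is an integral over \<open>\<omega>\<^sub>1 + \<dots> + \<omega>\<^sub>6 = 0\<close>, over which
  \<open>|\<omega>\<^sub>1 + \<omega>\<^sub>2 + \<omega>\<^sub>3|\<^sup>2\<close> has average \<open>9/5\<close>; hence a fixed proportion lives where \<open>|\<omega>\<^sub>1 + \<omega>\<^sub>2 + \<omega>\<^sub>3|\<close> is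
  well above 1, and there the density of the sum of three points is bounded.\<close>

section \<open>Bessel functions\<close>

text \<open>Two obstacles shape the argument. The density of a sum of three points of the circle is
  unbounded near the circle |x| = 1, so the triple convolution has no global pointwise bound; the
  estimate has to stay away from that circle, which is possible because the average 9/5 exceeds 1.
  If m is the mean inner product of two of six points with sum 0, then 0 = 6 + 30 m, so m = -1/5 and
  3 + 6 m = 9/5. Secondly, extensions are not integrable and the finiteness of their sixth power
  integral is itself to be proved. Every identity is therefore established with a weight
  \<open>gauss e\<close>, whose Fourier transform is positive, and bounds uniform in e pass to the
  limit by Fatou's lemma. The numerical margin is thin: in the variable z the bounds are 3/100 for
  the integrals with n even, n \<ge> 2, and 153/1000 for n = 0, so that the comparison reads 150 <
  153. This dictates the care taken with the Bessel integrals.\<close>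

text \<open>\<open>J\<^sub>n(2 \<surd>z) = z\<^bsup>n/2\<^esup> bc n z\<close>; the variable \<open>z = r\<^sup>2 / 4\<close> makes everything entire.\<close>

definition bc :: "nat \<Rightarrow> real \<Rightarrow> real" where
  "bc n z = (\<Sum>j. (-1) ^ j / (fact j * fact (n + j)) * z ^ j)"

lemma bc_summable_abs: "summable (\<lambda>j. \<bar>(-1) ^ j / (fact j * fact (n + j)) * z ^ j\<bar>)" for z :: real
proof (rule summable_comparison_test)
  show "summable (\<lambda>j. inverse (fact j) * \<bar>z\<bar> ^ j)"
    by (rule summable_exp)
  have "\<bar>(-1) ^ j / (fact j * fact (n + j)) * z ^ j\<bar> \<le> inverse (fact j) * \<bar>z\<bar> ^ j" for j
  proof -
    have "\<bar>(-1) ^ j / (fact j * fact (n + j)) * z ^ j\<bar> = inverse (fact (n + j)) * (inverse (fact j) * \<bar>z\<bar> ^ j)"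
      by (simp add: abs_mult power_abs divide_inverse)
    also have "\<dots> \<le> 1 * (inverse (fact j) * \<bar>z\<bar> ^ j)"
      by (intro mult_right_mono) (auto simp: inverse_le_1_iff)
    finally show ?thesis by simp
  qed
  then show "\<exists>N. \<forall>j\<ge>N. norm \<bar>(-1) ^ j / (fact j * fact (n + j)) * z ^ j\<bar> \<le> inverse (fact j) * \<bar>z\<bar> ^ j"
    by simp
qed

lemma bc_summable: "summable (\<lambda>j. (-1) ^ j / (fact j * fact (n + j)) * z ^ j)" for z :: real
  using bc_summable_abs by (rule summable_rabs_cancel)

text \<open>This is the rule (x^(-n) J_n)' = - x^(-n) J_(n+1), from which the change of variable
  removes all powers of x. Differentiating z^(j+1) cancels one factor of (j+1)! and leaves (n+1+j)!
  in place.\<close>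

lemma bc_deriv: "(bc n has_real_derivative - bc (Suc n) z) (at z)"
proof -
  let ?c = "\<lambda>j. (-1) ^ j / (fact j * fact (n + j)) :: real"
  have "diffs ?c j * z ^ j = - ((-1) ^ j / (fact j * fact (Suc n + j)) * z ^ j)" for j
  proof -
    have e: "fact (Suc j) = (real j + 1) * fact j" "n + Suc j = Suc n + j" by (auto simp: algebra_simps)
    have "real j + 1 \<noteq> 0" by linarith
    then show ?thesis
      unfolding diffs_def e by (simp add: divide_simps del: fact_Suc)
  qed
  then have eq: "(\<Sum>j. diffs ?c j * z ^ j) = - bc (Suc n) z"
    unfolding bc_def by (simp add: suminf_minus[OF bc_summable[of "Suc n"], simplified])
  have "((\<lambda>x. \<Sum>j. ?c j * x ^ j) has_field_derivative (\<Sum>j. diffs ?c j * z ^ j)) (at z)"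
    by (rule termdiffs_strong_converges_everywhere) (rule bc_summable)
  then show ?thesis
    unfolding eq bc_def[abs_def] .
qed

lemma bc_has_real_derivative [derivative_intros]:
  assumes "(g has_real_derivative g') (at x)"
  shows "((\<lambda>x. bc n (g x)) has_real_derivative - bc (Suc n) (g x) * g') (at x)"
  using DERIV_chain2[OF bc_deriv assms] .

lemma bc_continuous [continuous_intros]:
  "continuous_on S g \<Longrightarrow> continuous_on S (\<lambda>x. bc n (g x))"
  by (rule continuous_on_compose2[of UNIV "bc n"])
     (auto intro!: DERIV_continuous_on[OF DERIV_subset[OF bc_deriv]])

lemma bc_measurable [measurable]: "bc n \<in> borel_measurable borel"
  by (intro borel_measurable_continuous_onI continuous_intros)

lemma bc_0: "bc n 0 = 1 / fact n"
proof -
  have "(\<lambda>j. (-1) ^ j / (fact j * fact (n + j)) * 0 ^ j) sums ((-1) ^ 0 / (fact 0 * fact (n + 0)) :: real)"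
    by (rule powser_sums_zero)
  then show ?thesis by (simp add: bc_def sums_iff)
qed

text \<open>The three-term recurrence (2k / r) J_k = J_(k-1) + J_(k+1) with k = n + 1, by comparison
  of coefficients; the series of the last term is shifted by one index.\<close>

lemma bc_rec: "real (Suc n) * bc (Suc n) z = bc n z + z * bc (Suc (Suc n)) z"
proof -
  let ?c = "\<lambda>n j. (-1) ^ j / (fact j * fact (n + j)) :: real"
  have s: "(\<lambda>j. ?c m j * z ^ j) sums bc m z" for m
    unfolding bc_def by (rule summable_sums[OF bc_summable])
  have "(\<lambda>j. (case j of 0 \<Rightarrow> 0 | Suc i \<Rightarrow> z * (?c (Suc (Suc n)) i * z ^ i))) sums (z * bc (Suc (Suc n)) z)"
  proof -
    have "(\<lambda>j. case Suc j of 0 \<Rightarrow> 0 | Suc i \<Rightarrow> z * (?c (Suc (Suc n)) i * z ^ i)) sums (z * bc (Suc (Suc n)) z)"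
      using sums_mult[OF s[of "Suc (Suc n)"], of z] by simp
    from sums_Suc[OF this] show ?thesis by simp
  qed
  then have "(\<lambda>j. ?c n j * z ^ j + (case j of 0 \<Rightarrow> 0 | Suc i \<Rightarrow> z * (?c (Suc (Suc n)) i * z ^ i)))
      sums (bc n z + z * bc (Suc (Suc n)) z)"
    by (rule sums_add[OF s])
  moreover have "?c n j * z ^ j + (case j of 0 \<Rightarrow> 0 | Suc i \<Rightarrow> z * (?c (Suc (Suc n)) i * z ^ i)) =
      real (Suc n) * (?c (Suc n) j * z ^ j)" for j
  proof (cases j)
    case (Suc i)
    have e: "fact j = (real i + 1) * fact i" "fact (n + j) = (fact (Suc (n + i)) :: real)"
      "fact (Suc n + j) = (real n + real i + 2) * (fact (Suc (n + i)) :: real)"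
      "fact (Suc (Suc n) + i) = (real n + real i + 2) * (fact (Suc (n + i)) :: real)"
      using Suc by (auto simp: algebra_simps)
    have nz: "fact i \<noteq> (0::real)" "fact (Suc (n+i)) \<noteq> (0::real)" "real i + 1 \<noteq> 0" "real n + real i + 2 \<noteq> 0"
      by (simp_all del: fact_Suc)
    show ?thesis
      unfolding e using nz Suc by (simp add: divide_simps del: fact_Suc) (simp add: algebra_simps)
  qed (simp add: divide_simps)
  ultimately have "(\<lambda>j. real (Suc n) * (?c (Suc n) j * z ^ j)) sums (bc n z + z * bc (Suc (Suc n)) z)"
    by simp
  from sums_unique2[OF this sums_mult[OF s]] show ?thesis by simp
qed

text \<open>Consecutive terms have ratio z / ((j+1)(n+j+1)) in absolute value. The hypothesis keeps
  it at most 1 from j = N on, so by Leibniz' criterion the tail has the sign of its first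
  term.\<close>

lemma bc_alternating:
  assumes "0 \<le> z" "z \<le> real (Suc N * (Suc (n + N)))"
  shows "0 \<le> (-1) ^ N * (bc n z - (\<Sum>j<N. (-1) ^ j / (fact j * fact (n + j)) * z ^ j))"
proof -
  let ?t = "\<lambda>j. (-1) ^ j / (fact j * fact (n + j)) * z ^ j"
  define a where "a j = z ^ (j + N) / (fact (j + N) * fact (n + (j + N)))" for j
  have ta: "?t (j + N) = (-1) ^ N * ((-1) ^ j * a j)" for j
    by (simp add: a_def power_add)
  have sm: "summable (\<lambda>j. ?t (j + N))"
    using bc_summable[of n z] by (rule summable_ignore_initial_segment)
  have "bc n z - (\<Sum>j<N. ?t j) = (\<Sum>j. ?t (j + N))"
    unfolding bc_def by (subst suminf_split_initial_segment[OF bc_summable, of _ _ N]) simp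
  also have "\<dots> = (-1) ^ N * (\<Sum>j. (-1) ^ j * a j)"
  proof -
    have "summable (\<lambda>j. (-1) ^ N * ?t (j + N))" by (rule summable_mult[OF sm])
    then have "summable (\<lambda>j. (-1) ^ j * a j)"
      unfolding ta by (simp flip: mult.assoc power_mult_distrib)
    then show ?thesis unfolding ta by (rule suminf_mult)
  qed
  finally have eq: "(-1) ^ N * (bc n z - (\<Sum>j<N. ?t j)) = (\<Sum>j. (-1) ^ j * a j)"
    by (simp flip: mult.assoc power_add add: mult_2[symmetric])
  have "a \<longlonglongrightarrow> 0"
  proof -
    have "(\<lambda>j. \<bar>?t (j + N)\<bar>) \<longlonglongrightarrow> 0"
      using summable_LIMSEQ_zero[OF sm] by (rule tendsto_rabs_zero)
    moreover have "\<bar>?t (j + N)\<bar> = a j" for j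
      using assms by (simp add: a_def abs_mult)
    ultimately show ?thesis by simp
  qed
  moreover have "0 \<le> a j" for j using assms by (simp add: a_def)
  moreover have "a (Suc j) \<le> a j" for j
  proof -
    define p where "p = real (Suc (j + N)) * real (Suc (n + (j + N)))"
    have "real (Suc N * (Suc (n + N))) \<le> p"
      unfolding p_def of_nat_mult by (intro mult_mono) auto
    then have "z \<le> p" using assms by linarith
    have "p > 0" by (simp add: p_def)
    have "a (Suc j) = a j * (z / p)"
      by (simp add: a_def p_def mult_ac)
    also have "\<dots> \<le> a j * 1"
      using \<open>z \<le> p\<close> \<open>p > 0\<close> \<open>0 \<le> a j\<close> by (intro mult_left_mono) auto
    finally show ?thesis by simp
  qed
  ultimately have "0 \<le> (\<Sum>j. (-1) ^ j * a j)"
    using summable_Leibniz'(2)[of a 0] by simp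
  then show ?thesis using eq by simp
qed

section \<open>Explicit antiderivatives for products of Bessel functions\<close>

text \<open>By the recurrence, z^(n+1) (bc (n+1) z)^2 has derivative z^n bc n bc (n+1) - z^(n+1) bc
  (n+1) bc (n+2), so each term of the sum passes from one product of neighbours to the next.\<close>

lemma bc_telescope:
  "((\<lambda>z. - (bc 0 z)\<^sup>2 / 2 - (\<Sum>j=1..n. z ^ j * (bc j z)\<^sup>2)) has_real_derivative
     z ^ n * bc n z * bc (Suc n) z) (at z)"
proof (induction n)
  case 0
  show ?case by (auto intro!: derivative_eq_intros simp: power2_eq_square)
next
  case (Suc n)
  have "((\<lambda>z. - (bc 0 z)\<^sup>2 / 2 - (\<Sum>j=1..n. z ^ j * (bc j z)\<^sup>2) - z ^ Suc n * (bc (Suc n) z)\<^sup>2) has_real_derivative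
     z ^ n * bc n z * bc (Suc n) z - (real (Suc n) * z ^ n * (bc (Suc n) z)\<^sup>2 +
       z ^ Suc n * (2 * bc (Suc n) z * - bc (Suc (Suc n)) z))) (at z)"
    by (rule DERIV_diff[OF Suc]) (rule derivative_eq_intros refl | simp)+
  moreover have "real (Suc n) * z ^ n * (bc (Suc n) z)\<^sup>2 = z ^ n * bc (Suc n) z * (bc n z + z * bc (Suc (Suc n)) z)"
    unfolding bc_rec[symmetric] by (simp add: power2_eq_square)
  ultimately show ?case
    by (simp add: algebra_simps del: of_nat_Suc)
qed

text \<open>The recurrence writes (n+1) z^n (bc (n+1))^2, that is (n+1) J_(n+1)^2 / z, as a sum of
  two products of neighbours, each integrated by \<open>bc_telescope\<close>.\<close>

lemma bc_square_antideriv: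
  "((\<lambda>z. - (bc 0 z)\<^sup>2 - 2 * (\<Sum>j=1..n. z ^ j * (bc j z)\<^sup>2) - z ^ Suc n * (bc (Suc n) z)\<^sup>2)
     has_real_derivative real (Suc n) * z ^ n * (bc (Suc n) z)\<^sup>2) (at z)"
proof -
  have "real (Suc n) * z ^ n * (bc (Suc n) z)\<^sup>2 = z ^ n * bc (Suc n) z * (real (Suc n) * bc (Suc n) z)"
    by (simp add: power2_eq_square)
  also have "\<dots> = z ^ n * bc n z * bc (Suc n) z + z ^ Suc n * bc (Suc n) z * bc (Suc (Suc n)) z"
    unfolding bc_rec by (simp add: algebra_simps)
  finally show ?thesis
    using DERIV_add[OF bc_telescope[of n z] bc_telescope[of "Suc n" z]]
    by (simp add: algebra_simps del: of_nat_Suc)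
qed

lemma bc_2: "z * bc 2 z = bc 1 z - bc 0 z"
  using bc_rec[of 0 z] by (simp add: numeral_2_eq_2)

text \<open>A Sonin function: \<open>z (sonine z)\<^sup>2\<close> decreases and dominates \<open>4 z (bc 0 z)\<^sup>4\<close>.\<close>

definition sonine :: "real \<Rightarrow> real" where
  "sonine z = 2 * (bc 0 z)\<^sup>2 + 2 * z * (bc 1 z)\<^sup>2 - bc 0 z * bc 1 z + (bc 0 z)\<^sup>2 / (4 * z)"

text \<open>Completing the square in \<open>bc 1 z\<close> uses half of the term (bc 0 z)^2 / (4z);
  the other half is nonnegative.\<close>

lemma sonine_ge:
  assumes "z > 0"
  shows "2 * (bc 0 z)\<^sup>2 \<le> sonine z"
proof -
  have "sonine z = 2 * (bc 0 z)\<^sup>2 + (bc 0 z)\<^sup>2 / (8 * z) + 2 * z * (bc 1 z - bc 0 z / (4 * z))\<^sup>2"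
    using assms by (simp add: sonine_def field_simps power2_eq_square)
  then show ?thesis using assms by simp
qed

text \<open>Bessel's equation is the system A' = -B, B' = (A - B) / z. The coefficients of
  \<open>sonine\<close> are such that all mixed terms cancel and its derivative is -
  \<open>sonine\<close> / (2z) - A^2 / (8 z^2); the factor z in front of the square then cancels the
  first part.\<close>

lemma sonine_deriv:
  assumes "z > 0"
  shows "((\<lambda>z. z * (sonine z)\<^sup>2) has_real_derivative - sonine z * (bc 0 z)\<^sup>2 / (4 * z)) (at z)"
proof -
  define A B where "A = bc 0 z" and "B = bc 1 z"
  have hA: "(bc 0 has_real_derivative - B) (at z)"
    using bc_deriv[of 0 z] by (simp add: B_def)
  have "bc 2 z = (B - A) / z"
    using bc_2[of z] assms by (simp add: A_def B_def field_simps)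
  then have hB: "(bc 1 has_real_derivative (A - B) / z) (at z)"
    using bc_deriv[of 1 z] by (simp add: numeral_2_eq_2 minus_divide_left)
  have z: "4 * z \<noteq> 0" using assms by simp
  note D = DERIV_add[OF DERIV_diff[OF DERIV_add[OF DERIV_cmult[OF DERIV_power[OF hA, of 2], of 2]
    DERIV_mult[OF DERIV_cmult[OF DERIV_ident, of 2] DERIV_power[OF hB, of 2]]] DERIV_mult[OF hA hB]]
    DERIV_divide[OF DERIV_power[OF hA, of 2] DERIV_cmult[OF DERIV_ident, of 4] z]]
  have D': "(sonine has_real_derivative - A\<^sup>2 / (8 * z\<^sup>2) - sonine z / (2 * z)) (at z)"
    unfolding sonine_def[abs_def]
    apply (rule DERIV_cong[OF D])
    unfolding A_def[symmetric] B_def[symmetric]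
    using assms apply (simp add: divide_simps power2_eq_square)
    apply (simp add: algebra_simps)
    done
  from DERIV_mult[OF DERIV_ident DERIV_power[OF D', of 2]] show ?thesis
    by (rule DERIV_cong) (use assms in \<open>simp add: A_def field_simps power2_eq_square\<close>)
qed

lemma sonine_antimono:
  assumes "0 < p" "p \<le> z"
  shows "z * (sonine z)\<^sup>2 \<le> p * (sonine p)\<^sup>2"
proof (rule DERIV_nonpos_imp_nonincreasing[OF assms(2)])
  fix x assume "p \<le> x" "x \<le> z"
  then have "x > 0" using assms by simp
  moreover have "0 \<le> sonine x" using sonine_ge[OF \<open>x > 0\<close>] by (smt (verit) zero_le_power2)
  ultimately show "\<exists>y. ((\<lambda>z. z * (sonine z)\<^sup>2) has_real_derivative y) (at x) \<and> y \<le> 0"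
    using sonine_deriv by (intro exI[of _ "- sonine x * (bc 0 x)\<^sup>2 / (4 * x)"]) (auto simp: divide_simps)
qed

text \<open>Monotonicity of the Sonin function bounds the whole half-line by the values of J_0 and
  J_1 at the single point p.\<close>

lemma bc_0_tail_bound:
  assumes "0 < p" "p \<le> z"
  shows "z * bc 0 z ^ 4 \<le> p * (sonine p)\<^sup>2 / 4"
proof -
  have "z > 0" using assms by simp
  have "(2 * (bc 0 z)\<^sup>2)\<^sup>2 \<le> (sonine z)\<^sup>2"
    using sonine_ge[OF \<open>z > 0\<close>] by (intro power_mono) auto
  then have "4 * (z * bc 0 z ^ 4) \<le> z * (sonine z)\<^sup>2"
    using \<open>z > 0\<close> mult_left_mono[of "(2 * (bc 0 z)\<^sup>2)\<^sup>2" "(sonine z)\<^sup>2" z] by (simp add: power_mult_distrib mult_ac)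
  also have "\<dots> \<le> p * (sonine p)\<^sup>2" by (rule sonine_antimono[OF assms])
  finally show ?thesis by simp
qed

section \<open>Enclosures of J_0 and J_1\<close>

lemma bc_bounds:
  assumes "0 \<le> z" "z \<le> real (Suc N * Suc (n + N))"
  shows "even N \<Longrightarrow> (\<Sum>j<N. (-1) ^ j / (fact j * fact (n + j)) * z ^ j) \<le> bc n z"
    and "odd N \<Longrightarrow> bc n z \<le> (\<Sum>j<N. (-1) ^ j / (fact j * fact (n + j)) * z ^ j)"
  using bc_alternating[OF assms] by auto

text \<open>The truncation 1 - z + z^2/4 is a perfect square, which keeps later polynomial estimates
  explicit.\<close>

lemma bc_0_le: "0 \<le> z \<Longrightarrow> z \<le> 16 \<Longrightarrow> bc 0 z \<le> (1 - z / 2)\<^sup>2"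
proof -
  have "odd (3::nat)" by simp
  from bc_bounds(2)[OF _ _ this, of z 0] show "0 \<le> z \<Longrightarrow> z \<le> 16 \<Longrightarrow> bc 0 z \<le> (1 - z / 2)\<^sup>2"
    by (simp add: lessThan_nat_numeral fact_numeral power2_eq_square field_simps)
qed

lemma bc_0_ge: "0 \<le> z \<Longrightarrow> z \<le> 9 \<Longrightarrow> 1 - z \<le> bc 0 z"
proof -
  have "even (2::nat)" by simp
  from bc_bounds(1)[OF _ _ this, of z 0] show "0 \<le> z \<Longrightarrow> z \<le> 9 \<Longrightarrow> 1 - z \<le> bc 0 z"
    by (simp add: lessThan_nat_numeral)
qed

lemma bc_0_ge': "0 \<le> z \<Longrightarrow> z \<le> 25 \<Longrightarrow> (1 - z / 2)\<^sup>2 - z ^ 3 / 36 \<le> bc 0 z"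
proof -
  have "even (4::nat)" by simp
  from bc_bounds(1)[OF _ _ this, of z 0] show "0 \<le> z \<Longrightarrow> z \<le> 25 \<Longrightarrow> (1 - z / 2)\<^sup>2 - z ^ 3 / 36 \<le> bc 0 z"
    by (simp add: lessThan_nat_numeral fact_numeral power2_eq_square field_simps)
qed

lemma bc_1_pos:
  assumes "0 \<le> z" "z \<le> 3"
  shows "0 < bc 1 z"
proof -
  have "1 - z / 2 + z\<^sup>2 / 12 - z ^ 3 / 144 \<le> bc 1 z"
  proof -
    have "even (4::nat)" by simp
    from bc_bounds(1)[OF _ _ this, of z 1] assms show ?thesis
      by (simp add: lessThan_nat_numeral fact_numeral field_simps)
  qed
  \<comment> \<open>This turns the four-term truncation into 1 - z/2 + z^2/16, again a perfect
    square.\<close>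
  moreover have "z ^ 3 \<le> 3 * z\<^sup>2" using assms mult_right_mono[of z 3 "z\<^sup>2"] by (simp add: power3_eq_cube power2_eq_square mult.assoc)
  moreover have "0 < 1 - z / 2 + z\<^sup>2 / 16"
  proof -
    have "1 - z / 2 + z\<^sup>2 / 16 = (1 - z / 4)\<^sup>2" by (simp add: power2_eq_square field_simps)
    then show ?thesis using assms by simp
  qed
  ultimately show ?thesis by linarith
qed

lemma bc_0_antimono:
  assumes "0 \<le> p" "p \<le> z" "z \<le> 3"
  shows "bc 0 z \<le> bc 0 p"
proof (rule DERIV_nonpos_imp_nonincreasing[OF assms(2)])
  fix x assume "p \<le> x" "x \<le> z"
  then show "\<exists>y. (bc 0 has_real_derivative y) (at x) \<and> y \<le> 0"
    using bc_deriv[of 0 x] bc_1_pos[of x] assms by (intro exI[of _ "- bc 1 x"]) auto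
qed

lemma abs_power4_le: "\<bar>x\<bar> \<le> u \<Longrightarrow> x ^ 4 \<le> (u::real) ^ 4"
  using power_mono[of "\<bar>x\<bar>" u 4] by simp

text \<open>As \<open>bc 0\<close> decreases up to 3, its absolute value on [p, q] is controlled by
  the two end points.\<close>

lemma bc_0_piece_bound:
  assumes "0 \<le> p" "p \<le> z" "z \<le> q" "q \<le> 3" "bc 0 p \<le> u" "- u \<le> bc 0 q"
  shows "z * bc 0 z ^ 4 \<le> q * u ^ 4"
proof -
  have "bc 0 z \<le> bc 0 p" "bc 0 q \<le> bc 0 z"
    using assms by (auto intro!: bc_0_antimono)
  then have "bc 0 z ^ 4 \<le> u ^ 4" using assms by (intro abs_power4_le) auto
  then show ?thesis using assms by (intro mult_mono) auto
qed

text \<open>Here 0 \<le> bc 0 z \<le> y^2 with y = 1 - z/2, so z y^8 has to be bounded. Its maximum,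
  at z = 2/9, is about 0.087, too close to the constant for a crude estimate.\<close>

lemma bc_0_initial_bound:
  assumes "0 \<le> z" "z \<le> 1"
  shows "z * bc 0 z ^ 4 \<le> 9 / 100"
proof -
  define y where "y = 1 - z / 2"
  have y: "0 \<le> y" "y \<le> 1" using assms by (auto simp: y_def)
  \<comment> \<open>The Taylor polynomial of degree 3 of y^(-2); its fourth power is a lower bound
    for y^(-8).\<close>
  define s where "s = 1 + z + 3/4 * z\<^sup>2 + z ^ 3 / 2"
  have s: "1 \<le> s" using assms by (simp add: s_def)
  have "y\<^sup>2 * s = 1 - z ^ 4 * (5/16 - z/8)"
    by (simp add: y_def s_def power2_eq_square power3_eq_cube eval_nat_numeral field_simps)
  also have "\<dots> \<le> 1" using assms by simp
  finally have "(y\<^sup>2 * s) ^ 4 \<le> 1 ^ 4" using s by (intro power_mono) auto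
  then have ys: "y ^ 8 * s ^ 4 \<le> 1" by (simp add: power_mult_distrib flip: power_mult)
  have "s ^ 4 = (s\<^sup>2)\<^sup>2" by simp
  have "s\<^sup>2 = 1 + 2 * z + (5/2) * z\<^sup>2 + (5/2) * z ^ 3 + z ^ 4 * (25/16 + 3/4 * z + z\<^sup>2/4)"
    by (simp add: s_def power2_eq_square eval_nat_numeral field_simps)
  then have "1 + 2 * z + (5/2) * z\<^sup>2 + (5/2) * z ^ 3 \<le> s\<^sup>2" using assms by simp
  then have "(1 + 2 * z + (5/2) * z\<^sup>2 + (5/2) * z ^ 3)\<^sup>2 \<le> (s\<^sup>2)\<^sup>2"
    using assms by (intro power_mono) auto
  moreover have "(1 + 2 * z + (5/2) * z\<^sup>2 + (5/2) * z ^ 3)\<^sup>2 =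
     1 + 4 * z + 9 * z\<^sup>2 + 15 * z ^ 3 + z ^ 4 * (65/4 + 25/2 * z + 25/4 * z\<^sup>2)"
    by (simp add: power2_eq_square eval_nat_numeral field_simps)
  ultimately have s4: "1 + 4 * z + 9 * z\<^sup>2 + 15 * z ^ 3 \<le> s ^ 4"
    using assms \<open>s ^ 4 = (s\<^sup>2)\<^sup>2\<close> by (smt (verit) mult_nonneg_nonneg zero_le_power2 zero_le_power divide_nonneg_nonneg)
  \<comment> \<open>The tangent to z^3 at 49/200, close to the minimum of 9/100 (1 + 4z + 9z^2 +
    15z^3) - z; the tangent to z^2 at the same point follows.\<close>
  have "0 \<le> (z - 49/200)\<^sup>2 * (z + 49/100)"
    using assms by simp
  then have z3: "z ^ 3 \<ge> 3 * (49/200)\<^sup>2 * z - 2 * (49/200) ^ 3"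
    by (simp add: power2_eq_square power3_eq_cube field_simps)
  have "0 \<le> (z - 49/200)\<^sup>2" by simp
  then have z2: "z\<^sup>2 \<ge> 49/100 * z - (49/200)\<^sup>2" by (simp add: power2_eq_square field_simps)
  have "z \<le> 9/100 * (1 + 4 * z + 9 * z\<^sup>2 + 15 * z ^ 3)"
    using z2 z3 assms by (simp add: power2_eq_square power3_eq_cube)
  also have "\<dots> \<le> 9/100 * s ^ 4" using s4 by simp
  finally have "y ^ 8 * z \<le> y ^ 8 * (9/100 * s ^ 4)" using y by (intro mult_left_mono) auto
  also have "\<dots> = 9/100 * (y ^ 8 * s ^ 4)" by simp
  also have "\<dots> \<le> 9/100 * 1" using ys by (intro mult_left_mono) auto
  finally have *: "z * y ^ 8 \<le> 9/100" by (simp only: mult.commute mult_1_right)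
  have "bc 0 z ^ 4 \<le> (y\<^sup>2) ^ 4"
    using bc_0_le[of z] bc_0_ge[of z] assms by (intro power_mono) (auto simp: y_def)
  then have "z * bc 0 z ^ 4 \<le> z * y ^ 8" using assms by (intro mult_left_mono) (simp_all flip: power_mult)
  then show ?thesis using * by simp
qed

lemma bc_0_polynomial_bounds:
  assumes "0 \<le> z" "z \<le> 10"
  shows "1 - z + z^2/4 - z^3/36 + z^4/576 - z^5/14400 + z^6/518400 - z^7/25401600 \<le> bc 0 z"
    "bc 0 z \<le> 1 - z + z^2/4 - z^3/36 + z^4/576 - z^5/14400 + z^6/518400 - z^7/25401600 + z^8/1625702400"
proof -
  have 8: "even (8::nat)" "{..<8} = {0,1,2,3,4,5,6,7::nat}" by auto
  have 9: "odd (9::nat)" "{..<9} = {0,1,2,3,4,5,6,7,8::nat}" by auto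
  show "1 - z + z^2/4 - z^3/36 + z^4/576 - z^5/14400 + z^6/518400 - z^7/25401600 \<le> bc 0 z"
    using bc_bounds(1)[OF _ _ 8(1), of z 0] assms unfolding 8(2) by (simp add: fact_numeral)
  show "bc 0 z \<le> 1 - z + z^2/4 - z^3/36 + z^4/576 - z^5/14400 + z^6/518400 - z^7/25401600 + z^8/1625702400"
    using bc_bounds(2)[OF _ _ 9(1), of z 0] assms unfolding 9(2) by (simp add: fact_numeral)
qed

lemma bc_1_polynomial_bounds:
  assumes "0 \<le> z" "z \<le> 10"
  shows "1 - z/2 + z^2/12 - z^3/144 + z^4/2880 - z^5/86400 + z^6/3628800 - z^7/203212800 \<le> bc 1 z"
    "bc 1 z \<le> 1 - z/2 + z^2/12 - z^3/144 + z^4/2880 - z^5/86400 + z^6/3628800 - z^7/203212800 + z^8/14631321600"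
proof -
  have 8: "even (8::nat)" "{..<8} = {0,1,2,3,4,5,6,7::nat}" by auto
  have 9: "odd (9::nat)" "{..<9} = {0,1,2,3,4,5,6,7,8::nat}" by auto
  show "1 - z/2 + z^2/12 - z^3/144 + z^4/2880 - z^5/86400 + z^6/3628800 - z^7/203212800 \<le> bc 1 z"
    using bc_bounds(1)[OF _ _ 8(1), of z 1] assms unfolding 8(2) by (simp add: fact_numeral)
  show "bc 1 z \<le> 1 - z/2 + z^2/12 - z^3/144 + z^4/2880 - z^5/86400 + z^6/3628800 - z^7/203212800 + z^8/14631321600"
    using bc_bounds(2)[OF _ _ 9(1), of z 1] assms unfolding 9(2) by (simp add: fact_numeral)
qed

text \<open>The arguments are the break points of the subdivision used for n = 2. The sign change
  between 1 and 2 reflects the first zero of J_0.\<close>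

lemma bc_0_values:
  "48421 / 100000 \<le> bc 0 (3/5)" "bc 0 (3/5) \<le> 48423 / 100000"
  "34646 / 100000 \<le> bc 0 (4/5)" "bc 0 (4/5) \<le> 34648 / 100000"
  "22388 / 100000 \<le> bc 0 1" "bc 0 1 \<le> 22390 / 100000"
  "-19656 / 100000 \<le> bc 0 2" "bc 0 2 \<le> -19654 / 100000"
  "-31007 / 100000 \<le> bc 0 (5/2)" "bc 0 (5/2) \<le> -31003 / 100000"
  "-37498 / 100000 \<le> bc 0 3" "bc 0 3 \<le> -37490 / 100000"
  subgoal using bc_0_polynomial_bounds(1)[of "3/5"] by (simp add: power_divide)
  subgoal using bc_0_polynomial_bounds(2)[of "3/5"] by (simp add: power_divide)
  subgoal using bc_0_polynomial_bounds(1)[of "4/5"] by (simp add: power_divide)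
  subgoal using bc_0_polynomial_bounds(2)[of "4/5"] by (simp add: power_divide)
  subgoal using bc_0_polynomial_bounds(1)[of "1"] by (simp add: power_divide)
  subgoal using bc_0_polynomial_bounds(2)[of "1"] by (simp add: power_divide)
  subgoal using bc_0_polynomial_bounds(1)[of "2"] by (simp add: power_divide)
  subgoal using bc_0_polynomial_bounds(2)[of "2"] by (simp add: power_divide)
  subgoal using bc_0_polynomial_bounds(1)[of "5/2"] by (simp add: power_divide)
  subgoal using bc_0_polynomial_bounds(2)[of "5/2"] by (simp add: power_divide)
  subgoal using bc_0_polynomial_bounds(1)[of "3"] by (simp add: power_divide)
  subgoal using bc_0_polynomial_bounds(2)[of "3"] by (simp add: power_divide)
  done

lemma bc_1_values:
  "72853 / 100000 \<le> bc 1 (3/5)" "bc 1 (3/5) \<le> 72855 / 100000"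
  "64990 / 100000 \<le> bc 1 (4/5)" "bc 1 (4/5) \<le> 64992 / 100000"
  "57671 / 100000 \<le> bc 1 1" "bc 1 1 \<le> 57673 / 100000"
  "28297 / 100000 \<le> bc 1 2" "bc 1 2 \<le> 28299 / 100000"
  "17481 / 100000 \<le> bc 1 (5/2)" "bc 1 (5/2) \<le> 17483 / 100000"
  "8799 / 100000 \<le> bc 1 3" "bc 1 3 \<le> 8801 / 100000"
  subgoal using bc_1_polynomial_bounds(1)[of "3/5"] by (simp add: power_divide)
  subgoal using bc_1_polynomial_bounds(2)[of "3/5"] by (simp add: power_divide)
  subgoal using bc_1_polynomial_bounds(1)[of "4/5"] by (simp add: power_divide)
  subgoal using bc_1_polynomial_bounds(2)[of "4/5"] by (simp add: power_divide)
  subgoal using bc_1_polynomial_bounds(1)[of "1"] by (simp add: power_divide)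
  subgoal using bc_1_polynomial_bounds(2)[of "1"] by (simp add: power_divide)
  subgoal using bc_1_polynomial_bounds(1)[of "2"] by (simp add: power_divide)
  subgoal using bc_1_polynomial_bounds(2)[of "2"] by (simp add: power_divide)
  subgoal using bc_1_polynomial_bounds(1)[of "5/2"] by (simp add: power_divide)
  subgoal using bc_1_polynomial_bounds(2)[of "5/2"] by (simp add: power_divide)
  subgoal using bc_1_polynomial_bounds(1)[of "3"] by (simp add: power_divide)
  subgoal using bc_1_polynomial_bounds(2)[of "3"] by (simp add: power_divide)
  done

section \<open>The integrals of J_0^4 J_n^2 and of J_0^6\<close>

text \<open>Minus an antiderivative of \<open>z\<^sup>n (bc (n + 1) z)\<^sup>2\<close> that vanishes at infinity.\<close>

definition bc_mass :: "nat \<Rightarrow> real \<Rightarrow> real" where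
  "bc_mass n z = ((bc 0 z)\<^sup>2 + 2 * (\<Sum>j=1..n. z ^ j * (bc j z)\<^sup>2) + z ^ Suc n * (bc (Suc n) z)\<^sup>2) / real (Suc n)"

lemma bc_mass_deriv:
  "((\<lambda>z. - bc_mass n z) has_real_derivative z ^ n * (bc (Suc n) z)\<^sup>2) (at z)"
proof -
  have "((\<lambda>z. (- (bc 0 z)\<^sup>2 - 2 * (\<Sum>j=1..n. z ^ j * (bc j z)\<^sup>2) - z ^ Suc n * (bc (Suc n) z)\<^sup>2) / real (Suc n))
     has_real_derivative real (Suc n) * z ^ n * (bc (Suc n) z)\<^sup>2 / real (Suc n)) (at z)"
    by (rule DERIV_cdivide[OF bc_square_antideriv])
  moreover have "(- (bc 0 z)\<^sup>2 - 2 * (\<Sum>j=1..n. z ^ j * (bc j z)\<^sup>2) - z ^ Suc n * (bc (Suc n) z)\<^sup>2) / real (Suc n) = - bc_mass n z" for z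
    unfolding bc_mass_def minus_divide_left by (simp add: algebra_simps)
  ultimately show ?thesis by simp
qed

lemma bc_mass_nonneg: "0 \<le> z \<Longrightarrow> 0 \<le> bc_mass n z"
  unfolding bc_mass_def by (intro divide_nonneg_nonneg add_nonneg_nonneg mult_nonneg_nonneg sum_nonneg) auto

lemma bc_mass_0: "bc_mass n 0 = 1 / real (Suc n)"
  by (simp add: bc_mass_def bc_0 power_0_left sum.neutral)

text \<open>The integrand \<open>J\<^sub>0\<^sup>4 J\<^sub>n\<^sup>2\<close> in the variable \<open>z\<close>.\<close>

definition sixth_kernel :: "nat \<Rightarrow> real \<Rightarrow> real" where
  "sixth_kernel n z = bc 0 z ^ 4 * (z ^ n * (bc n z)\<^sup>2)"

lemma sixth_kernel_measurable [measurable]: "sixth_kernel n \<in> borel_measurable borel"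
  unfolding sixth_kernel_def[abs_def] by measurable

text \<open>One factor z goes to bc 0 z ^ 4 and the product is replaced by its bound c; what
  remains, z^n (bc (n+1) z)^2, is integrated exactly by \<open>bc_mass\<close>.\<close>

lemma sixth_kernel_integral_Icc:
  assumes "0 \<le> p" "p \<le> q" and c: "\<And>z. p \<le> z \<Longrightarrow> z \<le> q \<Longrightarrow> z * bc 0 z ^ 4 \<le> c"
  shows "(\<integral>\<^sup>+z. ennreal (sixth_kernel (Suc n) z) * indicator {p..q} z \<partial>lborel) \<le> ennreal (c * (bc_mass n p - bc_mass n q))"
proof -
  have "0 \<le> q * bc 0 q ^ 4" using assms by simp
  then have "0 \<le> c" using c[of q] assms by linarith
  have "(\<integral>\<^sup>+z. ennreal (sixth_kernel (Suc n) z) * indicator {p..q} z \<partial>lborel)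
      \<le> (\<integral>\<^sup>+z. ennreal (c * (z ^ n * (bc (Suc n) z)\<^sup>2)) * indicator {p..q} z \<partial>lborel)"
  proof (intro nn_integral_mono)
    fix z
    have "sixth_kernel (Suc n) z = (z * bc 0 z ^ 4) * (z ^ n * (bc (Suc n) z)\<^sup>2)"
      by (simp add: sixth_kernel_def mult_ac)
    then show "ennreal (sixth_kernel (Suc n) z) * indicator {p..q} z \<le> ennreal (c * (z ^ n * (bc (Suc n) z)\<^sup>2)) * indicator {p..q} z"
      using c[of z] assms by (auto simp: indicator_def intro!: ennreal_leI mult_right_mono)
  qed
  also have "\<dots> = ennreal (c * - bc_mass n q - c * - bc_mass n p)"
  proof (rule nn_integral_FTC_Icc)
    show "((\<lambda>z. c * - bc_mass n z) has_real_derivative c * (z ^ n * (bc (Suc n) z)\<^sup>2)) (at z)" for z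
      by (rule DERIV_cmult[OF bc_mass_deriv])
  qed (use assms \<open>0 \<le> c\<close> in auto)
  finally show ?thesis by (simp add: algebra_simps)
qed

text \<open>Monotone convergence over [p, p + k]. The mass at the upper end point is nonnegative and
  enters with a minus sign, so no decay at infinity is used.\<close>

lemma sixth_kernel_integral_atLeast:
  assumes "0 \<le> p" and c: "\<And>z. p \<le> z \<Longrightarrow> z * bc 0 z ^ 4 \<le> c"
  shows "(\<integral>\<^sup>+z. ennreal (sixth_kernel (Suc n) z) * indicator {p..} z \<partial>lborel) \<le> ennreal (c * bc_mass n p)"
proof -
  have "0 \<le> p * bc 0 p ^ 4" using assms by simp
  then have "0 \<le> c" using c[of p] by linarith
  have "(\<integral>\<^sup>+z. ennreal (sixth_kernel (Suc n) z) * indicator {p..} z \<partial>lborel) =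
      (\<integral>\<^sup>+z. (SUP k. ennreal (sixth_kernel (Suc n) z) * indicator {p..p + real k} z) \<partial>lborel)"
  proof (intro nn_integral_cong)
    fix z
    show "ennreal (sixth_kernel (Suc n) z) * indicator {p..} z = (SUP k. ennreal (sixth_kernel (Suc n) z) * indicator {p..p + real k} z)"
    proof (cases "p \<le> z")
      case True
      obtain k where "z - p \<le> real k" using real_arch_simple by blast
      then have "ennreal (sixth_kernel (Suc n) z) * indicator {p..} z \<le> ennreal (sixth_kernel (Suc n) z) * indicator {p..p + real k} z"
        using True by (simp add: indicator_def)
      also have "\<dots> \<le> (SUP k. ennreal (sixth_kernel (Suc n) z) * indicator {p..p + real k} z)"
        by (rule SUP_upper) simp
      finally show ?thesis
        by (rule antisym) (rule SUP_least, simp add: indicator_def)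
    next
      case False
      then show ?thesis by (simp add: indicator_def)
    qed
  qed
  also have "\<dots> = (SUP k. \<integral>\<^sup>+z. ennreal (sixth_kernel (Suc n) z) * indicator {p..p + real k} z \<partial>lborel)"
  proof (rule nn_integral_monotone_convergence_SUP)
    show "incseq (\<lambda>k z. ennreal (sixth_kernel (Suc n) z) * indicator {p..p + real k} z)"
      by (intro incseq_SucI le_funI mult_left_mono) (simp_all add: indicator_def)
  qed measurable
  also have "\<dots> \<le> ennreal (c * bc_mass n p)"
  proof (intro SUP_least)
    fix k :: nat
    have "(\<integral>\<^sup>+z. ennreal (sixth_kernel (Suc n) z) * indicator {p..p + real k} z \<partial>lborel) \<le> ennreal (c * (bc_mass n p - bc_mass n (p + real k)))"
      using assms by (intro sixth_kernel_integral_Icc) auto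
    also have "\<dots> \<le> ennreal (c * bc_mass n p)"
      using \<open>0 \<le> c\<close> bc_mass_nonneg[of "p + real k" n] assms by (intro ennreal_leI mult_left_mono) auto
    finally show "(\<integral>\<^sup>+z. ennreal (sixth_kernel (Suc n) z) * indicator {p..p + real k} z \<partial>lborel) \<le> ennreal (c * bc_mass n p)" .
  qed
  finally show ?thesis .
qed

lemma sixth_kernel_nonneg: "0 \<le> z \<Longrightarrow> 0 \<le> sixth_kernel n z"
  by (simp add: sixth_kernel_def)

lemma square_bounds: "0 \<le> l \<Longrightarrow> l \<le> x \<Longrightarrow> x \<le> u \<Longrightarrow> l\<^sup>2 \<le> x\<^sup>2 \<and> x\<^sup>2 \<le> (u::real)\<^sup>2"
  by (intro conjI power_mono) auto

text \<open>The relation z bc 2 z = bc 1 z - bc 0 z eliminates \<open>bc 2\<close>, so that values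
  of J_0 and J_1 suffice.\<close>

lemma bc_mass_1: "bc_mass 1 z = ((bc 0 z)\<^sup>2 + 2 * (z * (bc 1 z)\<^sup>2) + (bc 1 z - bc 0 z)\<^sup>2) / 2"
  unfolding bc_2[symmetric] by (simp add: bc_mass_def power_mult_distrib numeral_2_eq_2)

lemma bc_mass_1_value_3_5:
  "4655 / 10000 \<le> bc_mass 1 (3/5)" "bc_mass 1 (3/5) \<le> 4656 / 10000"
  using square_bounds[of "48421 / 100000" "bc 0 (3/5)" "48423 / 100000"] square_bounds[of "72853 / 100000" "bc 1 (3/5)" "72855 / 100000"]
    square_bounds[of "24430 / 100000" "bc 1 (3/5) - bc 0 (3/5)" "24434 / 100000"] bc_0_values bc_1_values
  unfolding bc_mass_1 by (simp_all add: power_divide)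

lemma bc_mass_1_value_4_5:
  "4439 / 10000 \<le> bc_mass 1 (4/5)" "bc_mass 1 (4/5) \<le> 4440 / 10000"
  using square_bounds[of "34646 / 100000" "bc 0 (4/5)" "34648 / 100000"] square_bounds[of "64990 / 100000" "bc 1 (4/5)" "64992 / 100000"]
    square_bounds[of "30342 / 100000" "bc 1 (4/5) - bc 0 (4/5)" "30346 / 100000"] bc_0_values bc_1_values
  unfolding bc_mass_1 by (simp_all add: power_divide)

lemma bc_mass_1_value_1:
  "4198 / 10000 \<le> bc_mass 1 1" "bc_mass 1 1 \<le> 4200 / 10000"
  using square_bounds[of "22388 / 100000" "bc 0 1" "22390 / 100000"] square_bounds[of "57671 / 100000" "bc 1 1" "57673 / 100000"]
    square_bounds[of "35281 / 100000" "bc 1 1 - bc 0 1" "35285 / 100000"] bc_0_values bc_1_values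
  unfolding bc_mass_1 by (simp_all add: power_divide)

lemma bc_mass_1_value_2:
  "2944 / 10000 \<le> bc_mass 1 2" "bc_mass 1 2 \<le> 2945 / 10000"
  using square_bounds[of "19654 / 100000" "- bc 0 2" "19656 / 100000"] square_bounds[of "28297 / 100000" "bc 1 2" "28299 / 100000"]
    square_bounds[of "47951 / 100000" "bc 1 2 - bc 0 2" "47955 / 100000"] bc_0_values bc_1_values
  unfolding bc_mass_1 by (simp_all add: power_divide)

lemma bc_mass_1_value_5_2:
  "2419 / 10000 \<le> bc_mass 1 (5/2)" "bc_mass 1 (5/2) \<le> 2421 / 10000"
  using square_bounds[of "31003 / 100000" "- bc 0 (5/2)" "31007 / 100000"] square_bounds[of "17481 / 100000" "bc 1 (5/2)" "17483 / 100000"]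
    square_bounds[of "48484 / 100000" "bc 1 (5/2) - bc 0 (5/2)" "48490 / 100000"] bc_0_values bc_1_values
  unfolding bc_mass_1 by (simp_all add: power_divide)

lemma bc_mass_1_value_3:
  "2006 / 10000 \<le> bc_mass 1 3" "bc_mass 1 3 \<le> 2008 / 10000"
  using square_bounds[of "37490 / 100000" "- bc 0 3" "37498 / 100000"] square_bounds[of "8799 / 100000" "bc 1 3" "8801 / 100000"]
    square_bounds[of "46289 / 100000" "bc 1 3 - bc 0 3" "46299 / 100000"] bc_0_values bc_1_values
  unfolding bc_mass_1 by (simp_all add: power_divide)

text \<open>The Sonin bound with p = 3. The constant is nearly optimal: by the asymptotics of J_0
  the limit superior at infinity is 1 / pi^2, about 0.1013.\<close>

lemma bc_0_far_bound:
  assumes "3 \<le> z"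
  shows "z * bc 0 z ^ 4 \<le> 1041 / 10000"
proof -
  have A: "(bc 0 3)\<^sup>2 \<le> (37498 / 100000)\<^sup>2"
    using square_bounds[of "37490 / 100000" "- bc 0 3" "37498 / 100000"] bc_0_values by simp
  have B: "(bc 1 3)\<^sup>2 \<le> (8801 / 100000)\<^sup>2"
    using square_bounds[of "8799 / 100000" "bc 1 3" "8801 / 100000"] bc_1_values by simp
  have "- bc 0 3 * bc 1 3 \<le> 37498 / 100000 * (8801 / 100000)"
    using bc_0_values bc_1_values by (intro mult_mono) auto
  then have "sonine 3 \<le> 37242 / 100000"
    using A B unfolding sonine_def by (simp add: power_divide)
  then have "(sonine 3)\<^sup>2 \<le> (37242 / 100000)\<^sup>2"
    using sonine_ge[of 3] by (intro power_mono) (auto intro: order_trans[rotated])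
  then show ?thesis
    using bc_0_tail_bound[of 3 z] assms by (simp add: power_divide)
qed

text \<open>On each piece the larger of the two end point values of |\<open>bc 0\<close>| is used.
  The smallness around the zero of J_0 is what the estimate for n = 2 lives on.\<close>

lemma bc_0_mid_bounds:
  "3/5 \<le> z \<Longrightarrow> z \<le> 4/5 \<Longrightarrow> z * bc 0 z ^ 4 \<le> 441 / 10000"
  "4/5 \<le> z \<Longrightarrow> z \<le> 1 \<Longrightarrow> z * bc 0 z ^ 4 \<le> 145 / 10000"
  "1 \<le> z \<Longrightarrow> z \<le> 2 \<Longrightarrow> z * bc 0 z ^ 4 \<le> 51 / 10000"
  "2 \<le> z \<Longrightarrow> z \<le> 5/2 \<Longrightarrow> z * bc 0 z ^ 4 \<le> 232 / 10000"
  "5/2 \<le> z \<Longrightarrow> z \<le> 3 \<Longrightarrow> z * bc 0 z ^ 4 \<le> 594 / 10000"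
proof -
  show "3/5 \<le> z \<Longrightarrow> z \<le> 4/5 \<Longrightarrow> z * bc 0 z ^ 4 \<le> 441 / 10000"
    using bc_0_piece_bound[of "3/5" z "4/5" "48423 / 100000"] bc_0_values by (simp add: power_divide)
  show "4/5 \<le> z \<Longrightarrow> z \<le> 1 \<Longrightarrow> z * bc 0 z ^ 4 \<le> 145 / 10000"
    using bc_0_piece_bound[of "4/5" z 1 "34648 / 100000"] bc_0_values by (simp add: power_divide)
  show "1 \<le> z \<Longrightarrow> z \<le> 2 \<Longrightarrow> z * bc 0 z ^ 4 \<le> 51 / 10000"
    using bc_0_piece_bound[of 1 z 2 "22390 / 100000"] bc_0_values by (simp add: power_divide)
  show "2 \<le> z \<Longrightarrow> z \<le> 5/2 \<Longrightarrow> z * bc 0 z ^ 4 \<le> 232 / 10000"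
    using bc_0_piece_bound[of 2 z "5/2" "31007 / 100000"] bc_0_values by (simp add: power_divide)
  show "5/2 \<le> z \<Longrightarrow> z \<le> 3 \<Longrightarrow> z * bc 0 z ^ 4 \<le> 594 / 10000"
    using bc_0_piece_bound[of "5/2" z 3 "37498 / 100000"] bc_0_values by (simp add: power_divide)
qed

lemma bc_0_global_bound:
  assumes "0 \<le> z"
  shows "z * bc 0 z ^ 4 \<le> 1041 / 10000"
proof -
  consider "z \<le> 1" | "1 \<le> z" "z \<le> 2" | "2 \<le> z" "z \<le> 5/2" | "5/2 \<le> z" "z \<le> 3" | "3 \<le> z" by linarith
  then show ?thesis
  proof cases
    case 1
    then show ?thesis using bc_0_initial_bound[of z] assms by linarith
  next
    case 2
    then show ?thesis using bc_0_mid_bounds(3)[of z] by linarith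
  next
    case 3
    then show ?thesis using bc_0_mid_bounds(4)[of z] by linarith
  next
    case 4
    then show ?thesis using bc_0_mid_bounds(5)[of z] by linarith
  qed (rule bc_0_far_bound)
qed

lemma nn_integral_atLeast_split:
  fixes f :: "real \<Rightarrow> ennreal"
  assumes [measurable]: "f \<in> borel_measurable borel" and "p \<le> q"
  shows "(\<integral>\<^sup>+z. f z * indicator {p..} z \<partial>lborel) \<le> (\<integral>\<^sup>+z. f z * indicator {p..q} z \<partial>lborel) + (\<integral>\<^sup>+z. f z * indicator {q..} z \<partial>lborel)"
proof -
  have "(\<integral>\<^sup>+z. f z * indicator {p..} z \<partial>lborel) \<le> (\<integral>\<^sup>+z. f z * indicator {p..q} z + f z * indicator {q..} z \<partial>lborel)"
    by (intro nn_integral_mono) (auto simp: indicator_def)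
  also have "\<dots> = (\<integral>\<^sup>+z. f z * indicator {p..q} z \<partial>lborel) + (\<integral>\<^sup>+z. f z * indicator {q..} z \<partial>lborel)"
    by (rule nn_integral_add) auto
  finally show ?thesis .
qed

text \<open>Made for chaining pieces from right to left: I bounds the part beyond q, and J the part
  beyond p.\<close>

lemma sixth_kernel_split:
  assumes "0 \<le> p" "p \<le> q" and c: "\<And>z. p \<le> z \<Longrightarrow> z \<le> q \<Longrightarrow> z * bc 0 z ^ 4 \<le> c"
    and I: "(\<integral>\<^sup>+z. ennreal (sixth_kernel (Suc n) z) * indicator {q..} z \<partial>lborel) \<le> ennreal I" "0 \<le> I"
    and J: "c * (bc_mass n p - bc_mass n q) + I \<le> J"
  shows "(\<integral>\<^sup>+z. ennreal (sixth_kernel (Suc n) z) * indicator {p..} z \<partial>lborel) \<le> ennreal J"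
proof -
  have "0 \<le> q * bc 0 q ^ 4" using assms by simp
  then have "0 \<le> c" using c[of q] assms by linarith
  moreover have "bc_mass n q \<le> bc_mass n p"
  proof -
    have "- bc_mass n p \<le> - bc_mass n q"
      by (rule DERIV_nonneg_imp_nondecreasing[OF assms(2)])
         (use assms in \<open>auto intro!: exI bc_mass_deriv\<close>)
    then show ?thesis by simp
  qed
  ultimately have "0 \<le> c * (bc_mass n p - bc_mass n q)" by simp
  have "(\<integral>\<^sup>+z. ennreal (sixth_kernel (Suc n) z) * indicator {p..} z \<partial>lborel)
     \<le> (\<integral>\<^sup>+z. ennreal (sixth_kernel (Suc n) z) * indicator {p..q} z \<partial>lborel) + (\<integral>\<^sup>+z. ennreal (sixth_kernel (Suc n) z) * indicator {q..} z \<partial>lborel)"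
    by (rule nn_integral_atLeast_split) (use assms in auto)
  also have "\<dots> \<le> ennreal (c * (bc_mass n p - bc_mass n q)) + ennreal I"
    by (intro add_mono I sixth_kernel_integral_Icc assms)
  also have "\<dots> \<le> ennreal J"
    using \<open>0 \<le> c * (bc_mass n p - bc_mass n q)\<close> I(2) J by (simp flip: ennreal_plus add: ennreal_leI)
  finally show ?thesis .
qed

text \<open>The global constant 1041/10000 times \<open>bc_mass 1 0\<close> = 1/2 is about 0.052,
  too large. Taking the supremum of z bc 0 z ^ 4 separately on seven pieces brings the total below
  0.03.\<close>

lemma sixth_kernel_2_integral:
  "(\<integral>\<^sup>+z. ennreal (sixth_kernel (Suc 1) z) * indicator {0..} z \<partial>lborel) \<le> ennreal (3 / 100)"
proof -
  note vals = bc_mass_1_value_3_5 bc_mass_1_value_4_5 bc_mass_1_value_1 bc_mass_1_value_2 bc_mass_1_value_5_2 bc_mass_1_value_3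
  define I where "I = 1041 / 10000 * bc_mass 1 3"
  define I5 where "I5 = 594 / 10000 * (bc_mass 1 (5/2) - bc_mass 1 3) + I"
  define I4 where "I4 = 232 / 10000 * (bc_mass 1 2 - bc_mass 1 (5/2)) + I5"
  define I3 where "I3 = 51 / 10000 * (bc_mass 1 1 - bc_mass 1 2) + I4"
  define I2 where "I2 = 145 / 10000 * (bc_mass 1 (4/5) - bc_mass 1 1) + I3"
  define I1 where "I1 = 441 / 10000 * (bc_mass 1 (3/5) - bc_mass 1 (4/5)) + I2"
  have nonneg: "0 \<le> I" "0 \<le> I5" "0 \<le> I4" "0 \<le> I3" "0 \<le> I2" "0 \<le> I1"
    unfolding I1_def I2_def I3_def I4_def I5_def I_def using vals by simp_all
  have i0: "(\<integral>\<^sup>+z. ennreal (sixth_kernel (Suc 1) z) * indicator {3..} z \<partial>lborel) \<le> ennreal I"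
    unfolding I_def by (rule sixth_kernel_integral_atLeast[OF _ bc_0_far_bound]) auto
  have i5: "(\<integral>\<^sup>+z. ennreal (sixth_kernel (Suc 1) z) * indicator {5/2..} z \<partial>lborel) \<le> ennreal I5"
    by (rule sixth_kernel_split[OF _ _ bc_0_mid_bounds(5) i0 nonneg(1)]) (auto simp: I5_def)
  have i4: "(\<integral>\<^sup>+z. ennreal (sixth_kernel (Suc 1) z) * indicator {2..} z \<partial>lborel) \<le> ennreal I4"
    by (rule sixth_kernel_split[OF _ _ bc_0_mid_bounds(4) i5 nonneg(2)]) (auto simp: I4_def)
  have i3: "(\<integral>\<^sup>+z. ennreal (sixth_kernel (Suc 1) z) * indicator {1..} z \<partial>lborel) \<le> ennreal I3"
    by (rule sixth_kernel_split[OF _ _ bc_0_mid_bounds(3) i4 nonneg(3)]) (auto simp: I3_def)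
  have i2: "(\<integral>\<^sup>+z. ennreal (sixth_kernel (Suc 1) z) * indicator {4/5..} z \<partial>lborel) \<le> ennreal I2"
    by (rule sixth_kernel_split[OF _ _ bc_0_mid_bounds(2) i3 nonneg(4)]) (auto simp: I2_def)
  have i1: "(\<integral>\<^sup>+z. ennreal (sixth_kernel (Suc 1) z) * indicator {3/5..} z \<partial>lborel) \<le> ennreal I1"
    by (rule sixth_kernel_split[OF _ _ bc_0_mid_bounds(1) i2 nonneg(5)]) (auto simp: I1_def)
  show ?thesis
  proof (rule sixth_kernel_split[OF _ _ bc_0_initial_bound i1 nonneg(6)])
    have "bc_mass 1 0 = 1 / 2" by (simp add: bc_mass_0)
    then show "9 / 100 * (bc_mass 1 0 - bc_mass 1 (3 / 5)) + I1 \<le> 3 / 100"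
      unfolding I1_def I2_def I3_def I4_def I5_def I_def using vals by (simp add: field_simps)
  qed auto
qed

text \<open>For 2m \<ge> 4 the mass at 0 is at most 1/4 and the global constant suffices: 0.1041 / 4
  < 0.03. Only 2m = 2 needs the subdivision.\<close>

lemma sixth_kernel_even_integral:
  assumes "1 \<le> m"
  shows "(\<integral>\<^sup>+z. ennreal (sixth_kernel (2 * m) z) * indicator {0..} z \<partial>lborel) \<le> ennreal (3 / 100)"
proof (cases "m = 1")
  case True
  then show ?thesis using sixth_kernel_2_integral by (simp add: numeral_2_eq_2)
next
  case False
  define n where "n = 2 * m - 1"
  have n: "2 * m = Suc n" "3 \<le> n" using False assms by (auto simp: n_def)
  have "(\<integral>\<^sup>+z. ennreal (sixth_kernel (Suc n) z) * indicator {0..} z \<partial>lborel) \<le> ennreal (1041 / 10000 * bc_mass n 0)"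
    by (rule sixth_kernel_integral_atLeast[OF _ bc_0_global_bound]) auto
  also have "\<dots> \<le> ennreal (3 / 100)"
    unfolding bc_mass_0 using n by (intro ennreal_leI) (simp add: divide_simps)
  finally show ?thesis using n by simp
qed

text \<open>On [0, 1] the power x^6 lies above its tangent at p = (1 - z/2)^2, and p - bc 0 z \<le>
  z^3/36. This gives the polynomial minorant \<open>g\<close>, integrated exactly; the contribution
  of z > 1 is discarded.\<close>

lemma sixth_kernel_0_integral_lower:
  "ennreal (153 / 1000) \<le> (\<integral>\<^sup>+z. ennreal (bc 0 z ^ 6) * indicator {0..} z \<partial>lborel)"
proof -
  \<comment> \<open>An antiderivative of \<open>g\<close> in powers of y = 1 - z/2, from z^3 = 8 (1
    - y)^3 and dz = -2 dy.\<close>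
  define G :: "real \<Rightarrow> real" where "G z = - (2/13) * (1 - z/2) ^ 13 + (8/3) * ((1 - z/2) ^ 11 / 11 - (1 - z/2) ^ 12 / 4
     + 3 * (1 - z/2) ^ 13 / 13 - (1 - z/2) ^ 14 / 14)" for z
  define g :: "real \<Rightarrow> real" where "g z = (1 - z/2) ^ 10 * ((1 - z/2)\<^sup>2 - z ^ 3 / 6)" for z
  have g_le: "g z \<le> bc 0 z ^ 6" if "0 \<le> z" "z \<le> 1" for z
  proof -
    define p x where "p = (1 - z/2)\<^sup>2" and "x = bc 0 z"
    have px: "0 \<le> p" "0 \<le> x" "p - x \<le> z ^ 3 / 36"
      using that bc_0_ge[of z] bc_0_ge'[of z] by (auto simp: p_def x_def)
    \<comment> \<open>The remainder of the tangent is a square times a form with nonnegative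
      coefficients, hence nonnegative for x, p \<ge> 0.\<close>
    have "x ^ 6 = p ^ 6 - 6 * p ^ 5 * (p - x) + (x - p)\<^sup>2 * (x ^ 4 + 2 * x ^ 3 * p + 3 * x\<^sup>2 * p\<^sup>2 + 4 * x * p ^ 3 + 5 * p ^ 4)"
      by (simp add: eval_nat_numeral algebra_simps)
    moreover have "0 \<le> (x - p)\<^sup>2 * (x ^ 4 + 2 * x ^ 3 * p + 3 * x\<^sup>2 * p\<^sup>2 + 4 * x * p ^ 3 + 5 * p ^ 4)"
      using px by (intro mult_nonneg_nonneg add_nonneg_nonneg) auto
    moreover have "6 * p ^ 5 * (p - x) \<le> 6 * p ^ 5 * (z ^ 3 / 36)"
      using px by (intro mult_left_mono) auto
    moreover have "g z = p ^ 6 - 6 * p ^ 5 * (z ^ 3 / 36)"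
      by (simp add: g_def p_def right_diff_distrib flip: power_mult power_add)
    ultimately show ?thesis by (simp add: x_def)
  qed
  have g_nonneg: "0 \<le> g z" if "0 \<le> z" "z \<le> 1" for z
  proof -
    have "(1/2)\<^sup>2 \<le> (1 - z/2)\<^sup>2" using that by (intro power_mono) auto
    moreover have "z ^ 3 \<le> 1" using that by (intro power_le_one) auto
    ultimately show ?thesis by (auto simp: g_def power_divide intro!: mult_nonneg_nonneg)
  qed
  have G: "(G has_real_derivative g z) (at z)" for z
  proof -
    define y where "y = 1 - z/2"
    have z: "z = 2 * (1 - y)" by (simp add: y_def)
    have y': "((\<lambda>z. 1 - z/2) has_real_derivative -1/2) (at z)"
      by (auto intro!: derivative_eq_intros)
    have "(G has_real_derivative - (2/13) * (13 * y ^ 12 * (-1/2)) + (8/3) * (11 * y ^ 10 * (-1/2) / 11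
       - 12 * y ^ 11 * (-1/2) / 4 + 3 * (13 * y ^ 12 * (-1/2)) / 13 - 14 * y ^ 13 * (-1/2) / 14)) (at z)"
      unfolding G_def[abs_def] y_def
      by (auto intro!: derivative_eq_intros)
    then show ?thesis
    proof (rule DERIV_cong)
      show "- (2/13) * (13 * y ^ 12 * (-1/2)) + (8/3) * (11 * y ^ 10 * (-1/2) / 11
       - 12 * y ^ 11 * (-1/2) / 4 + 3 * (13 * y ^ 12 * (-1/2)) / 13 - 14 * y ^ 13 * (-1/2) / 14) = g z"
        unfolding g_def y_def[symmetric] unfolding z
        by (simp add: eval_nat_numeral field_simps)
    qed
  qed
  have "ennreal (153 / 1000) \<le> ennreal (G 1 - G 0)"
    by (intro ennreal_leI) (simp add: G_def power_divide)
  also have "\<dots> = (\<integral>\<^sup>+z. ennreal (g z) * indicator {0..1} z \<partial>lborel)"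
    by (rule nn_integral_FTC_Icc[symmetric]) (use G g_nonneg in \<open>auto simp: g_def[abs_def]\<close>)
  also have "\<dots> \<le> (\<integral>\<^sup>+z. ennreal (bc 0 z ^ 6) * indicator {0..} z \<partial>lborel)"
    by (intro nn_integral_mono) (auto simp: indicator_def intro!: ennreal_leI g_le)
  finally show ?thesis .
qed

section \<open>The circle and polar coordinates\<close>

text \<open>Functions on the circle become 2 pi periodic functions of the angle, integrated over one
  period; rotations become translations.\<close>

abbreviation T :: "real measure" where
  "T \<equiv> restrict_space lborel {0..<2 * pi}"

definition circ :: "real \<Rightarrow> real^2" where
  "circ t = vector [cos t, sin t]"

lemma circ_nth [simp]: "circ t $ 1 = cos t" "circ t $ 2 = sin t"
  by (simp_all add: circ_def)

lemma inner_vec2: "x \<bullet> y = x $ 1 * y $ 1 + x $ 2 * y $ 2" for x y :: "real^2"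
  by (simp add: inner_vec_def sum_2)

lemma vec2_eq_iff: "x = y \<longleftrightarrow> x $ 1 = y $ 1 \<and> x $ 2 = y $ 2" for x y :: "real^2"
  by (simp add: vec_eq_iff forall_2)

lemma norm_vec2_sq: "(norm x)\<^sup>2 = (x $ 1)\<^sup>2 + (x $ 2)\<^sup>2" for x :: "real^2"
  by (simp only: power2_norm_eq_inner inner_vec2) (simp add: power2_eq_square)

lemma circ_add_pi: "circ (t + pi) = - circ t"
  by (simp add: vec2_eq_iff)

lemma circ_periodic [simp]: "circ (t + 2 * pi) = circ t"
  by (simp add: vec2_eq_iff)

lemma norm_circ [simp]: "norm (circ t) = 1"
proof -
  have "(norm (circ t))\<^sup>2 = 1" by (simp add: norm_vec2_sq)
  then show ?thesis by (simp add: power2_eq_1_iff) (smt (verit) norm_ge_zero)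
qed

lemma inner_circ_circ: "circ s \<bullet> circ t = cos (t - s)"
  by (simp add: inner_vec2 cos_diff)

lemma circ_polar: obtains a where "x = norm x *\<^sub>R circ a"
proof (cases "x = 0")
  case False
  have "(x $ 1 / norm x)\<^sup>2 + (x $ 2 / norm x)\<^sup>2 = 1"
    using False by (simp add: power_divide flip: add_divide_distrib norm_vec2_sq)
  then obtain a where a: "x $ 1 / norm x = cos a" "x $ 2 / norm x = sin a"
    using sincos_total_2pi by metis
  have "x = norm x *\<^sub>R circ a"
    using False by (simp add: vec2_eq_iff flip: a)
  then show ?thesis by (rule that)
qed (auto intro: that[of 0])

lemma continuous_on_circ [continuous_intros]:
  fixes g :: "'a::t2_space \<Rightarrow> real"
  shows "continuous_on S g \<Longrightarrow> continuous_on S (\<lambda>x. circ (g x))"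
proof -
  have "circ t = cos t *\<^sub>R axis 1 1 + sin t *\<^sub>R axis 2 1" for t
    by (simp add: vec2_eq_iff axis_def)
  then show "continuous_on S g \<Longrightarrow> continuous_on S (\<lambda>x. circ (g x))"
    by (auto intro!: continuous_intros)
qed

lemma circ_measurable [measurable]: "circ \<in> borel_measurable borel"
  by (intro borel_measurable_continuous_onI continuous_intros)

lemma space_T [simp]: "space T = {0..<2 * pi}"
  by (simp add: space_restrict_space)

lemma measurable_T [measurable (raw)]: "f \<in> borel \<rightarrow>\<^sub>M N \<Longrightarrow> f \<in> T \<rightarrow>\<^sub>M N"
  by (rule measurable_restrict_space1) simp

lemma emeasure_T: "emeasure T (space T) = ennreal (2 * pi)"
  by (subst emeasure_restrict_space) auto

interpretation T: finite_measure T
  by standard (subst emeasure_T, simp)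

lemma measure_T: "measure T (space T) = 2 * pi"
  unfolding measure_def emeasure_T by simp

lemma integral_T_const [simp]: "(\<integral>t. c \<partial>T) = 2 * pi * c" for c :: real
  using measure_T by simp

lemma nn_integral_T:
  "(\<integral>\<^sup>+t. f t \<partial>T) = (\<integral>\<^sup>+t. f t * indicator {0..<2 * pi} t \<partial>lborel)"
  by (rule nn_integral_restrict_space) simp

section \<open>Translation invariance for periodic functions\<close>

definition periodic :: "(real \<Rightarrow> 'a) \<Rightarrow> bool" where
  "periodic f \<longleftrightarrow> (\<forall>t. f (t + 2 * pi) = f t)"

lemma periodicD: "periodic f \<Longrightarrow> f (t + 2 * pi) = f t"
  by (simp add: periodic_def)

lemma periodic_int:
  assumes "periodic f" shows "f (t + 2 * pi * of_int k) = f t"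
proof -
  have nat: "f (t + 2 * pi * real n) = f t" for t n
  proof (induction n)
    case (Suc n)
    have "f (t + 2 * pi * real (Suc n)) = f ((t + 2 * pi * real n) + 2 * pi)" by (simp add: algebra_simps)
    then show ?case using Suc periodicD[OF assms] by simp
  qed simp
  show ?thesis
  proof (cases "k \<ge> 0")
    case True
    then show ?thesis using nat[of t "nat k"] by simp
  next
    case False
    then show ?thesis using nat[of "t + 2 * pi * of_int k" "nat (- k)"] by simp
  qed
qed

text \<open>Modulo the period the shift is some b in [0, 2 pi]. The window [b, 2 pi + b) is cut at 2
  pi and its right part is moved back by one period.\<close>

lemma nn_integral_T_shift:
  fixes f :: "real \<Rightarrow> ennreal"
  assumes [measurable]: "f \<in> borel_measurable borel" and per: "periodic f"
  shows "(\<integral>\<^sup>+t. f (t + a) \<partial>T) = (\<integral>\<^sup>+t. f t \<partial>T)"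
proof -
  define I where "I p q = (\<integral>\<^sup>+t. f t * indicator {p..<q} t \<partial>lborel)" for p q :: real
  have shift: "(\<integral>\<^sup>+t. f (t + a) * indicator {p..<q} t \<partial>lborel) = I (p + a) (q + a)" for p q a
  proof -
    have "I (p + a) (q + a) = ennreal \<bar>1\<bar> * (\<integral>\<^sup>+t. f (a + 1 * t) * indicator {p + a..<q + a} (a + 1 * t) \<partial>lborel)"
      unfolding I_def by (rule nn_integral_real_affine) auto
    also have "\<dots> = (\<integral>\<^sup>+t. f (t + a) * indicator {p..<q} t \<partial>lborel)"
      by (simp add: indicator_def add.commute)
    finally show ?thesis ..
  qed
  have per_I: "I (p + 2 * pi * of_int k) (q + 2 * pi * of_int k) = I p q" for p q k
    unfolding shift[symmetric] periodic_int[OF per] by (simp add: I_def)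
  have split: "I p q + I q r = I p r" if "p \<le> q" "q \<le> r" for p q r
  proof -
    have "I p q + I q r = (\<integral>\<^sup>+t. f t * indicator {p..<q} t + f t * indicator {q..<r} t \<partial>lborel)"
      unfolding I_def by (rule nn_integral_add[symmetric]) auto
    also have "\<dots> = I p r"
      unfolding I_def using that by (intro nn_integral_cong) (auto simp: indicator_def)
    finally show ?thesis .
  qed
  define k where "k = \<lfloor>a / (2 * pi)\<rfloor>"
  define b where "b = a - 2 * pi * of_int k"
  have b: "0 \<le> b" "b \<le> 2 * pi"
    using floor_divide_lower[of "2 * pi" a] floor_divide_upper[of "2 * pi" a]
    by (auto simp: b_def k_def field_simps)
  have "(\<integral>\<^sup>+t. f (t + a) \<partial>T) = I (0 + a) (2 * pi + a)"
    unfolding nn_integral_T by (rule shift)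
  also have "\<dots> = I (b + 2 * pi * of_int k) (2 * pi + b + 2 * pi * of_int k)"
    by (simp add: b_def algebra_simps)
  also have "\<dots> = I b (2 * pi + b)" by (rule per_I)
  also have "\<dots> = I b (2 * pi) + I (2 * pi) (2 * pi + b)" using b by (intro split[symmetric]) auto
  also have "I (2 * pi) (2 * pi + b) = I 0 b"
    using per_I[of 0 1 b] by (simp add: add.commute)
  also have "I b (2 * pi) + I 0 b = I 0 (2 * pi)"
    using split[of 0 b "2 * pi"] b by (simp add: add.commute)
  finally show ?thesis by (simp add: I_def nn_integral_T)
qed

text \<open>A translation leaves the interval that carries \<open>T\<close>. Reducing the angle
  makes it a measurable self-map of \<open>T\<close>, so that invariance becomes a statement about
  \<open>distr\<close>, from which integrability and Bochner integrals are transferred.\<close>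

definition wrap :: "real \<Rightarrow> real" where
  "wrap t = t - 2 * pi * of_int \<lfloor>t / (2 * pi)\<rfloor>"

lemma wrap_range: "0 \<le> wrap t" "wrap t < 2 * pi"
  using floor_divide_lower[of "2 * pi" t] floor_divide_upper[of "2 * pi" t]
  by (auto simp: wrap_def field_simps)

lemma wrap_id: "0 \<le> t \<Longrightarrow> t < 2 * pi \<Longrightarrow> wrap t = t"
proof -
  assume "0 \<le> t" "t < 2 * pi"
  then have "\<lfloor>t / (2 * pi)\<rfloor> = 0" by (simp add: floor_eq_iff)
  then show ?thesis by (simp add: wrap_def)
qed

lemma periodic_wrap: "periodic wrap"
proof -
  have "\<lfloor>(t + 2 * pi) / (2 * pi)\<rfloor> = \<lfloor>t / (2 * pi)\<rfloor> + 1" for t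
    by (simp add: add_divide_distrib)
  then show ?thesis by (simp add: periodic_def wrap_def algebra_simps)
qed

lemma periodic_wrap_eq: "periodic f \<Longrightarrow> f (wrap t) = f t"
  using periodic_int[of f "wrap t" "\<lfloor>t / (2 * pi)\<rfloor>"] by (simp add: wrap_def)

lemma wrap_measurable [measurable]: "wrap \<in> borel_measurable borel"
  unfolding wrap_def[abs_def] by measurable

lemma wrap_measurable_T [measurable]: "(\<lambda>t. wrap (t + a)) \<in> T \<rightarrow>\<^sub>M T"
  by (intro measurable_restrict_space2) (auto simp: wrap_range)

lemma distr_T_shift: "distr T T (\<lambda>t. wrap (t + a)) = T"
proof (rule measure_eqI)
  fix A assume "A \<in> sets (distr T T (\<lambda>t. wrap (t + a)))"
  then have A: "A \<in> sets T" by simp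
  then have A': "A \<in> sets borel" "A \<subseteq> {0..<2 * pi}"
    by (auto simp: sets_restrict_space_iff dest: sets.sets_into_space)
  then have [measurable]: "A \<in> sets borel" by simp
  let ?f = "\<lambda>t. indicator A (wrap t) :: ennreal"
  have per: "periodic ?f" using periodic_wrap by (simp add: periodic_def)
  have "emeasure (distr T T (\<lambda>t. wrap (t + a))) A = (\<integral>\<^sup>+t. ?f (t + a) \<partial>T)"
  proof -
    have "emeasure (distr T T (\<lambda>t. wrap (t + a))) A = (\<integral>\<^sup>+t. indicator A t \<partial>distr T T (\<lambda>t. wrap (t + a)))"
      using A by simp
    also have "\<dots> = (\<integral>\<^sup>+t. ?f (t + a) \<partial>T)"
      by (rule nn_integral_distr) (use A in auto)
    finally show ?thesis .
  qed
  also have "\<dots> = (\<integral>\<^sup>+t. ?f t \<partial>T)"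
    by (rule nn_integral_T_shift[OF _ per]) measurable
  also have "\<dots> = (\<integral>\<^sup>+t. indicator A t \<partial>T)"
    by (intro nn_integral_cong) (simp add: wrap_id)
  also have "\<dots> = emeasure T A" using A by simp
  finally show "emeasure (distr T T (\<lambda>t. wrap (t + a))) A = emeasure T A" .
qed simp

lemma integral_T_shift:
  fixes f :: "real \<Rightarrow> 'b::{banach, second_countable_topology}"
  assumes [measurable]: "f \<in> borel_measurable borel" and per: "periodic f"
  shows "(\<integral>t. f (t + a) \<partial>T) = (\<integral>t. f t \<partial>T)"
proof -
  have "(\<integral>t. f t \<partial>T) = (\<integral>t. f t \<partial>distr T T (\<lambda>t. wrap (t + a)))"
    by (simp add: distr_T_shift)
  also have "\<dots> = (\<integral>t. f (wrap (t + a)) \<partial>T)"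
    by (rule integral_distr) measurable
  finally show ?thesis by (simp add: periodic_wrap_eq[OF per])
qed

lemma integrable_T_shift:
  fixes f :: "real \<Rightarrow> 'b::{banach, second_countable_topology}"
  assumes [measurable]: "f \<in> borel_measurable borel" and per: "periodic f" and "integrable T f"
  shows "integrable T (\<lambda>t. f (t + a))"
proof -
  have "integrable (distr T T (\<lambda>t. wrap (t + a))) f"
    using assms by (simp add: distr_T_shift)
  then have "integrable T (\<lambda>t. f (wrap (t + a)))"
    by (subst (asm) integrable_distr_eq) measurable
  then show ?thesis by (simp add: periodic_wrap_eq[OF per])
qed

section \<open>Rotations of the plane\<close>

definition rot :: "real \<Rightarrow> real^2 \<Rightarrow> real^2" where
  "rot a x = vector [cos a * x $ 1 - sin a * x $ 2, sin a * x $ 1 + cos a * x $ 2]"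

lemma rot_nth [simp]: "rot a x $ 1 = cos a * x $ 1 - sin a * x $ 2" "rot a x $ 2 = sin a * x $ 1 + cos a * x $ 2"
  by (simp_all add: rot_def)

lemma rot_circ: "rot a (r *\<^sub>R circ b) = r *\<^sub>R circ (a + b)"
  by (simp add: vec2_eq_iff cos_add sin_add algebra_simps)

lemma rot_rot: "rot a (rot b x) = rot (a + b) x"
  by (simp add: vec2_eq_iff cos_add sin_add algebra_simps)

lemma rot_0: "rot 0 x = x"
  by (simp add: vec2_eq_iff)

lemma linear_rot: "linear (rot a)"
  by (rule linearI) (simp_all add: vec2_eq_iff algebra_simps)

lemma rot_measurable2 [measurable]: "(\<lambda>p. rot (fst p) (snd p)) \<in> borel_measurable borel"
proof -
  have "rot a x = (cos a * x $ 1 - sin a * x $ 2) *\<^sub>R axis 1 1 + (sin a * x $ 1 + cos a * x $ 2) *\<^sub>R axis 2 1" for a x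
    by (simp add: vec2_eq_iff axis_def)
  then show ?thesis
    by (intro borel_measurable_continuous_onI) (auto intro!: continuous_intros)
qed

lemma rot_measurable [measurable]: "rot a \<in> borel_measurable borel"
  by (intro borel_measurable_continuous_onI linear_continuous_on linear_conv_bounded_linear[THEN iffD1] linear_rot)

lemma det_rot: "det (matrix (rot a)) = 1"
  by (simp add: det_2 matrix_def axis_def flip: power2_eq_square)

text \<open>A linear map of determinant 1 preserves the volume of boxes, and boxes determine
  Lebesgue measure.\<close>

lemma distr_lborel_rot: "distr lborel borel (rot a) = lborel"
proof (rule lborel_eqI[symmetric])
  fix l u :: "real^2" assume lu: "\<And>b. b \<in> Basis \<Longrightarrow> l \<bullet> b \<le> u \<bullet> b"
  have im: "rot a -` box l u = rot (- a) ` box l u"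
  proof -
    have "x \<in> rot (- a) ` box l u" if "rot a x \<in> box l u" for x
      using imageI[OF that, of "rot (- a)"] by (simp add: rot_rot rot_0)
    then show ?thesis by (auto simp: rot_rot rot_0)
  qed
  have lm: "box l u \<in> lmeasurable" by simp
  have "rot (- a) ` box l u \<in> lmeasurable"
    by (rule measurable_linear_image[OF linear_rot lm])
  then have "emeasure lebesgue (rot (- a) ` box l u) = ennreal (measure lebesgue (rot (- a) ` box l u))"
    by (simp add: emeasure_eq_measure2 fmeasurableD2)
  also have "measure lebesgue (rot (- a) ` box l u) = measure lebesgue (box l u)"
    by (simp add: measure_linear_image[OF linear_rot lm] det_rot)
  also have "ennreal \<dots> = emeasure lborel (box l u)"
    using emeasure_eq_ennreal_measure[of lborel "box l u"] emeasure_lborel_box_finite[of l u] by (simp add: less_top)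
  also have "\<dots> = (\<Prod>b\<in>Basis. (u - l) \<bullet> b)"
    using lu by (rule emeasure_lborel_box)
  finally have "emeasure lebesgue (rot (- a) ` box l u) = ennreal (\<Prod>b\<in>Basis. (u - l) \<bullet> b)" .
  moreover have "rot (- a) ` box l u \<in> sets borel"
    unfolding im[symmetric] using measurable_sets[OF rot_measurable[of a], of "box l u"] by simp
  ultimately show "emeasure (distr lborel borel (rot a)) (box l u) = (\<Prod>b\<in>Basis. (u - l) \<bullet> b)"
    by (simp add: emeasure_distr im)
qed simp

section \<open>Polar coordinates\<close>

text \<open>The disc (norm x)^2 / 4 \<le> w has area 4 pi w. As this is linear in w, the image
  measure has constant density: in the variable z polar integration carries no weight.\<close>

lemma distr_lborel_norm_sq:
  "distr lborel borel (\<lambda>x::real^2. (norm x)\<^sup>2 / 4) = density lborel (\<lambda>z. ennreal (4 * pi) * indicator {0..} z)"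
proof (rule measure_eqI_generator_eq[where E = "range (\<lambda>w::real. {..w})" and \<Omega> = UNIV and A = "\<lambda>n. {..real n}"])
  show "Int_stable (range (\<lambda>w::real. {..w}))"
    by (auto simp: Int_stable_def)
  have em: "emeasure (distr lborel borel (\<lambda>x::real^2. (norm x)\<^sup>2 / 4)) {..w} = ennreal (4 * pi * max 0 w)" for w
  proof (cases "0 \<le> w")
    case True
    have "(\<lambda>x::real^2. (norm x)\<^sup>2 / 4) -` {..w} = cball 0 (2 * sqrt w)"
    proof -
      have "(norm x)\<^sup>2 / 4 \<le> w \<longleftrightarrow> norm x \<le> 2 * sqrt w" for x :: "real^2"
        using abs_le_square_iff[of "norm x" "2 * sqrt w"] True by (simp add: power_mult_distrib mult.commute)
      then show ?thesis by auto
    qed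
    then show ?thesis
      using True by (simp add: emeasure_distr emeasure_cball unit_ball_vol_2 power_mult_distrib mult_ac)
  next
    case False
    then have "\<not> (norm x)\<^sup>2 / 4 \<le> w" for x :: "real^2"
      using zero_le_power2[of "norm x"] by linarith
    then have "(\<lambda>x::real^2. (norm x)\<^sup>2 / 4) -` {..w} = {}"
      by auto
    then show ?thesis using False by (simp add: emeasure_distr)
  qed
  have em': "emeasure (density lborel (\<lambda>z. ennreal (4 * pi) * indicator {0..} z)) {..w} = ennreal (4 * pi * max 0 w)" for w
  proof -
    have "emeasure (density lborel (\<lambda>z. ennreal (4 * pi) * indicator {0..} z)) {..w} = (\<integral>\<^sup>+z. ennreal (4 * pi) * indicator {0..w} z \<partial>lborel)"
      by (subst emeasure_density) (auto intro!: nn_integral_cong simp: indicator_def)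
    also have "\<dots> = ennreal (4 * pi * max 0 w)"
      by (simp add: nn_integral_cmult_indicator ennreal_mult max_def ennreal_mult'')
    finally show ?thesis .
  qed
  show "emeasure (distr lborel borel (\<lambda>x::real^2. (norm x)\<^sup>2 / 4)) X = emeasure (density lborel (\<lambda>z. ennreal (4 * pi) * indicator {0..} z)) X"
    if "X \<in> range (\<lambda>w::real. {..w})" for X
    using that em em' by auto
  show "emeasure (distr lborel borel (\<lambda>x::real^2. (norm x)\<^sup>2 / 4)) {..real n} \<noteq> \<infinity>" for n :: nat
    by (simp add: em)
  show "(\<Union>i. {..real i}) = UNIV" by (auto intro: real_arch_simple)
qed (auto simp: borel_eq_atMost)

lemma nn_integral_radial:
  assumes [measurable]: "p \<in> borel_measurable borel"
  shows "(\<integral>\<^sup>+x. p ((norm (x::real^2))\<^sup>2 / 4) \<partial>lborel) = 4 * pi * (\<integral>\<^sup>+z. p z * indicator {0..} z \<partial>lborel)"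
proof -
  have "(\<integral>\<^sup>+x. p ((norm (x::real^2))\<^sup>2 / 4) \<partial>lborel) = (\<integral>\<^sup>+z. p z \<partial>distr lborel borel (\<lambda>x::real^2. (norm x)\<^sup>2 / 4))"
    by (simp add: nn_integral_distr)
  also have "\<dots> = (\<integral>\<^sup>+z. ennreal (4 * pi) * (p z * indicator {0..} z) \<partial>lborel)"
    unfolding distr_lborel_norm_sq by (subst nn_integral_density) (auto simp: mult_ac)
  also have "\<dots> = 4 * pi * (\<integral>\<^sup>+z. p z * indicator {0..} z \<partial>lborel)"
    by (rule nn_integral_cmult) measurable
  finally show ?thesis .
qed

interpretation T: sigma_finite_measure T
  by (rule T.sigma_finite_measure_axioms)

lemma nn_integral_rot_orbit:
  assumes [measurable]: "F \<in> borel_measurable borel"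
  shows "(\<integral>\<^sup>+a. F (rot a x) \<partial>T) = (\<integral>\<^sup>+a. F (norm x *\<^sub>R circ a) \<partial>T)"
proof -
  obtain b where b: "x = norm x *\<^sub>R circ b" by (rule circ_polar)
  have "(\<integral>\<^sup>+a. F (rot a x) \<partial>T) = (\<integral>\<^sup>+a. F (norm x *\<^sub>R circ (a + b)) \<partial>T)"
    by (subst b) (simp only: rot_circ)
  also have "\<dots> = (\<integral>\<^sup>+a. F (norm x *\<^sub>R circ a) \<partial>T)"
    by (rule nn_integral_T_shift) (simp_all add: periodic_def)
  finally show ?thesis .
qed

text \<open>Averaging over all rotations does not change the integral and makes the integrand
  radial; no Jacobian is computed. The factor 2 is the radial density 4 pi divided by the length 2
  pi of the group of angles.\<close>

lemma nn_integral_polar: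
  assumes F [measurable]: "F \<in> borel_measurable borel"
  shows "(\<integral>\<^sup>+x. F x \<partial>lborel) = 2 * (\<integral>\<^sup>+z. (\<integral>\<^sup>+a. F ((2 * sqrt z) *\<^sub>R circ a) \<partial>T) * indicator {0..} z \<partial>lborel)"
proof -
  define P where "P z = (\<integral>\<^sup>+a. F ((2 * sqrt z) *\<^sub>R circ a) \<partial>T)" for z
  have [measurable]: "P \<in> borel_measurable borel"
    unfolding P_def[abs_def] nn_integral_T by measurable
  have rad: "(\<integral>\<^sup>+a. F (rot a x) \<partial>T) = P ((norm x)\<^sup>2 / 4)" for x
    unfolding nn_integral_rot_orbit[OF F] by (simp add: P_def real_sqrt_divide)
  have "ennreal (2 * pi) * (\<integral>\<^sup>+x. F x \<partial>lborel) = (\<integral>\<^sup>+a. (\<integral>\<^sup>+x. F x \<partial>lborel) \<partial>T)"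
    using emeasure_T by (simp add: mult.commute)
  also have "\<dots> = (\<integral>\<^sup>+a. (\<integral>\<^sup>+x. F (rot a x) \<partial>lborel) \<partial>T)"
  proof (rule nn_integral_cong)
    fix a
    have "(\<integral>\<^sup>+x. F x \<partial>lborel) = (\<integral>\<^sup>+x. F x \<partial>distr lborel borel (rot a))"
      by (simp add: distr_lborel_rot)
    then show "(\<integral>\<^sup>+x. F x \<partial>lborel) = (\<integral>\<^sup>+x. F (rot a x) \<partial>lborel)"
      by (simp add: nn_integral_distr)
  qed
  also have "\<dots> = (\<integral>\<^sup>+x. (\<integral>\<^sup>+a. F (rot a x) \<partial>T) \<partial>lborel)"
  proof -
    interpret pair_sigma_finite T "lborel :: (real^2) measure" ..
    have "fst \<in> T \<Otimes>\<^sub>M (lborel :: (real^2) measure) \<rightarrow>\<^sub>M borel"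
      by (rule measurable_compose[OF measurable_fst measurable_T[OF measurable_ident_sets[OF refl]]])
    moreover have "snd \<in> T \<Otimes>\<^sub>M (lborel :: (real^2) measure) \<rightarrow>\<^sub>M borel"
      using measurable_snd[of T "lborel :: (real^2) measure"] by simp
    ultimately have "(\<lambda>p. (fst p, snd p)) \<in> T \<Otimes>\<^sub>M (lborel :: (real^2) measure) \<rightarrow>\<^sub>M borel \<Otimes>\<^sub>M borel"
      by (rule measurable_Pair)
    from measurable_compose[OF this, of "\<lambda>p. rot (fst p) (snd p)" borel]
    have "(\<lambda>p. rot (fst p) (snd p)) \<in> T \<Otimes>\<^sub>M (lborel :: (real^2) measure) \<rightarrow>\<^sub>M borel"
      using rot_measurable2 by (simp add: borel_prod)
    from measurable_compose[OF this F] show ?thesis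
      using Fubini'[of "\<lambda>a x. F (rot a x)"] by (simp add: split_beta')
  qed
  also have "\<dots> = 4 * pi * (\<integral>\<^sup>+z. P z * indicator {0..} z \<partial>lborel)"
    unfolding rad by (rule nn_integral_radial) measurable
  also have "\<dots> = ennreal (2 * pi) * (2 * (\<integral>\<^sup>+z. P z * indicator {0..} z \<partial>lborel))"
  proof -
    have "ennreal (4 * pi) = ennreal (2 * pi) * ennreal 2"
      by (subst ennreal_mult[symmetric]) auto
    then show ?thesis by (simp only: mult.assoc ennreal_numeral)
  qed
  finally show ?thesis
    unfolding P_def by (subst (asm) ennreal_mult_cancel_left) auto
qed

section \<open>Fourier transforms and majorants\<close>

definition ft :: "(real^2 \<Rightarrow> complex) \<Rightarrow> real^2 \<Rightarrow> complex" where
  "ft W \<xi> = (\<integral>x. W x * exp (- \<i> * complex_of_real (x \<bullet> \<xi>)) \<partial>lborel)"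

text \<open>The measure space and the map s into the plane are left general so that a product of
  extensions is again an extension, over the product space with the sum of the points.\<close>

definition ext :: "'a measure \<Rightarrow> ('a \<Rightarrow> real^2) \<Rightarrow> ('a \<Rightarrow> complex) \<Rightarrow> real^2 \<Rightarrow> complex" where
  "ext N s a x = (\<integral>y. a y * exp (- \<i> * complex_of_real (x \<bullet> s y)) \<partial>N)"

lemma norm_exp_i [simp]: "norm (exp (- \<i> * complex_of_real r)) = 1"
  "norm (exp (- (\<i> * complex_of_real r))) = 1"
  by (simp_all add: norm_exp_eq_Re)

lemma integrable_mult_exp_i:
  assumes "integrable N a" "s \<in> borel_measurable N"
  shows "integrable N (\<lambda>y. a y * exp (- \<i> * complex_of_real (s y)))"
proof (rule Bochner_Integration.integrable_bound[OF assms(1)])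
  have [measurable]: "a \<in> borel_measurable N" "s \<in> borel_measurable N" using assms by auto
  show "(\<lambda>y. a y * exp (- \<i> * complex_of_real (s y))) \<in> borel_measurable N" by measurable
qed (simp add: norm_mult)

lemma (in pair_sigma_finite) integrable_pair_mult:
  fixes f g :: "_ \<Rightarrow> 'c::{real_normed_field, banach, second_countable_topology}"
  assumes f: "integrable M1 f" and g: "integrable M2 g"
  shows "integrable (M1 \<Otimes>\<^sub>M M2) (\<lambda>p. f (fst p) * g (snd p))"
    and "(\<integral>p. f (fst p) * g (snd p) \<partial>(M1 \<Otimes>\<^sub>M M2)) = (\<integral>x. f x \<partial>M1) * (\<integral>y. g y \<partial>M2)"
proof -
  have [measurable]: "f \<in> borel_measurable M1" "g \<in> borel_measurable M2" using f g by auto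
  show int: "integrable (M1 \<Otimes>\<^sub>M M2) (\<lambda>p. f (fst p) * g (snd p))"
  proof (rule Fubini_integrable)
    show "integrable M1 (\<lambda>x. \<integral>y. norm (f (fst (x, y)) * g (snd (x, y))) \<partial>M2)"
      using f by (simp add: norm_mult)
    show "AE x in M1. integrable M2 (\<lambda>y. f (fst (x, y)) * g (snd (x, y)))"
      using g by simp
  qed measurable
  show "(\<integral>p. f (fst p) * g (snd p) \<partial>(M1 \<Otimes>\<^sub>M M2)) = (\<integral>x. f x \<partial>M1) * (\<integral>y. g y \<partial>M2)"
    using integral_fst'[OF int] by simp
qed

lemma ext_add:
  assumes "integrable N a" "integrable N b" and [measurable]: "s \<in> borel_measurable N"
  shows "ext N s (\<lambda>y. a y + b y) x = ext N s a x + ext N s b x"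
proof -
  have "integrable N (\<lambda>y. a y * exp (- \<i> * complex_of_real (x \<bullet> s y)))"
    by (rule integrable_mult_exp_i[OF assms(1)]) measurable
  moreover have "integrable N (\<lambda>y. b y * exp (- \<i> * complex_of_real (x \<bullet> s y)))"
    by (rule integrable_mult_exp_i[OF assms(2)]) measurable
  ultimately show ?thesis
    unfolding ext_def distrib_right by (rule Bochner_Integration.integral_add)
qed

lemma ext_cmult: "ext N s (\<lambda>y. c * a y) x = c * ext N s a x"
  unfolding ext_def mult.assoc by (rule integral_mult_right_zero)

lemma norm_ext_le:
  assumes "integrable N a" "s \<in> borel_measurable N"
  shows "norm (ext N s a x) \<le> (\<integral>y. norm (a y) \<partial>N)"
proof -
  have [measurable]: "s \<in> borel_measurable N" by fact
  have "norm (ext N s a x) \<le> (\<integral>y. norm (a y * exp (- \<i> * complex_of_real (x \<bullet> s y))) \<partial>N)"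
    unfolding ext_def by (rule integral_norm_bound)
  then show ?thesis by (simp add: norm_mult)
qed

lemma ext_measurable [measurable]:
  assumes "sigma_finite_measure N" and [measurable]: "a \<in> borel_measurable N" "s \<in> borel_measurable N"
  shows "ext N s a \<in> borel_measurable borel"
proof -
  interpret sigma_finite_measure N by fact
  have "(\<lambda>x. \<integral>y. a y * exp (- \<i> * complex_of_real (x \<bullet> s y)) \<partial>N) \<in> borel_measurable borel"
    by measurable
  then show ?thesis by (simp add: ext_def[abs_def])
qed

lemma ext_mult_integrable:
  assumes "sigma_finite_measure N" "integrable N a" "s \<in> borel_measurable N" "integrable lborel W"
  shows "integrable lborel (\<lambda>x. ext N s a x * W x)"
proof (rule Bochner_Integration.integrable_bound)
  have [measurable]: "a \<in> borel_measurable N" "s \<in> borel_measurable N" "W \<in> borel_measurable borel"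
    "ext N s a \<in> borel_measurable borel"
    using assms by (auto intro!: ext_measurable)
  show "(\<lambda>x. ext N s a x * W x) \<in> borel_measurable lborel" by measurable
  show "integrable lborel (\<lambda>x. (\<integral>y. norm (a y) \<partial>N) *\<^sub>R W x)" using assms by simp
  have "0 \<le> (\<integral>y. norm (a y) \<partial>N)" by simp
  then show "AE x in lborel. norm (ext N s a x * W x) \<le> norm ((\<integral>y. norm (a y) \<partial>N) *\<^sub>R W x)"
    using norm_ext_le[OF assms(2,3)] by (auto simp: norm_mult intro!: mult_right_mono)
qed

text \<open>By Fubini, multiplication by an extension becomes an average, with weight a, of
  translates of the transform.\<close>

lemma ft_ext_mult:
  assumes N: "sigma_finite_measure N" "integrable N a" "s \<in> borel_measurable N" and W: "integrable lborel W"
  shows "ft (\<lambda>x. ext N s a x * W x) \<xi> = (\<integral>y. a y * ft W (s y + \<xi>) \<partial>N)"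
    and "integrable N (\<lambda>y. a y * ft W (s y + \<xi>))"
proof -
  interpret N: sigma_finite_measure N by fact
  interpret L: sigma_finite_measure "lborel :: (real^2) measure" by (rule lborel.sigma_finite_measure_axioms)
  interpret pair_sigma_finite N "lborel :: (real^2) measure" ..
  have [measurable]: "a \<in> borel_measurable N" "s \<in> borel_measurable N" "W \<in> borel_measurable borel"
    using assms by auto
  let ?g = "\<lambda>y x. a y * (W x * exp (- \<i> * complex_of_real (x \<bullet> (s y + \<xi>))))"
  have int: "integrable (N \<Otimes>\<^sub>M lborel) (case_prod ?g)"
  proof (rule Bochner_Integration.integrable_bound)
    show "integrable (N \<Otimes>\<^sub>M lborel) (\<lambda>p. a (fst p) * W (snd p))"
      using N(2) W by (rule integrable_pair_mult)
    show "case_prod ?g \<in> borel_measurable (N \<Otimes>\<^sub>M lborel)" by measurable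
  qed (simp add: norm_mult split_beta')
  have "ft (\<lambda>x. ext N s a x * W x) \<xi> = (\<integral>x. (\<integral>y. ?g y x \<partial>N) \<partial>lborel)"
    unfolding ft_def
  proof (rule Bochner_Integration.integral_cong[OF refl])
    fix x
    have g: "?g y x = a y * exp (- \<i> * complex_of_real (x \<bullet> s y)) * (W x * exp (- \<i> * complex_of_real (x \<bullet> \<xi>)))" for y
    proof -
      have "exp (- \<i> * complex_of_real (x \<bullet> (s y + \<xi>))) = exp (- \<i> * complex_of_real (x \<bullet> s y)) * exp (- \<i> * complex_of_real (x \<bullet> \<xi>))"
        by (simp only: exp_add[symmetric]) (simp add: inner_add_right ring_distribs)
      then show ?thesis by simp
    qed
    show "ext N s a x * W x * exp (- \<i> * complex_of_real (x \<bullet> \<xi>)) = (\<integral>y. ?g y x \<partial>N)"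
      unfolding g integral_mult_left_zero ext_def by (simp only: mult.assoc)
  qed
  also have "\<dots> = (\<integral>y. (\<integral>x. ?g y x \<partial>lborel) \<partial>N)"
    by (rule Fubini_integral[OF int])
  also have "\<dots> = (\<integral>y. a y * ft W (s y + \<xi>) \<partial>N)"
    by (simp add: ft_def)
  finally show "ft (\<lambda>x. ext N s a x * W x) \<xi> = (\<integral>y. a y * ft W (s y + \<xi>) \<partial>N)" .
  have "integrable N (\<lambda>y. \<integral>x. ?g y x \<partial>lborel)"
    using integrable_fst[OF int] .
  then show "integrable N (\<lambda>y. a y * ft W (s y + \<xi>))"
    by (simp add: ft_def)
qed

lemma (in pair_sigma_finite) ext_pair_mult:
  assumes a: "integrable M1 a" and b: "integrable M2 b"
    and [measurable]: "s \<in> borel_measurable M1" "r \<in> borel_measurable M2"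
  shows "ext (M1 \<Otimes>\<^sub>M M2) (\<lambda>p. s (fst p) + r (snd p)) (\<lambda>p. a (fst p) * b (snd p)) x = ext M1 s a x * ext M2 r b x"
proof -
  have "integrable M1 (\<lambda>t. a t * exp (- \<i> * complex_of_real (x \<bullet> s t)))"
    by (rule integrable_mult_exp_i[OF a]) measurable
  moreover have "integrable M2 (\<lambda>t. b t * exp (- \<i> * complex_of_real (x \<bullet> r t)))"
    by (rule integrable_mult_exp_i[OF b]) measurable
  ultimately have *: "(\<integral>p. a (fst p) * exp (- \<i> * complex_of_real (x \<bullet> s (fst p))) *
      (b (snd p) * exp (- \<i> * complex_of_real (x \<bullet> r (snd p)))) \<partial>(M1 \<Otimes>\<^sub>M M2)) = ext M1 s a x * ext M2 r b x"
    unfolding ext_def by (rule integrable_pair_mult(2))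
  have "exp (- \<i> * complex_of_real (x \<bullet> (s (fst p) + r (snd p)))) =
      exp (- \<i> * complex_of_real (x \<bullet> s (fst p))) * exp (- \<i> * complex_of_real (x \<bullet> r (snd p)))" for p
    by (simp only: exp_add[symmetric]) (simp add: inner_add_right ring_distribs)
  then have eq: "a (fst p) * b (snd p) * exp (- \<i> * complex_of_real (x \<bullet> (s (fst p) + r (snd p)))) =
    a (fst p) * exp (- \<i> * complex_of_real (x \<bullet> s (fst p))) * (b (snd p) * exp (- \<i> * complex_of_real (x \<bullet> r (snd p))))" for p
    by (simp only: mult_ac)
  show ?thesis unfolding ext_def[of "M1 \<Otimes>\<^sub>M M2"] eq by (rule *)
qed

section \<open>Majorization\<close>

text \<open>The number r is automatically nonnegative, so the majorant is a function whose transform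
  is real and nonnegative. Domination is demanded at every frequency, because later products
  translate the frequency.\<close>

definition majorized :: "(real^2 \<Rightarrow> complex) \<Rightarrow> (real^2 \<Rightarrow> complex) \<Rightarrow> bool" where
  "majorized V W \<longleftrightarrow> integrable lborel V \<and> integrable lborel W \<and>
     (\<forall>\<xi>. \<exists>r. ft W \<xi> = complex_of_real r \<and> norm (ft V \<xi>) \<le> r)"

text \<open>On the frequency side both products are averages of translates, and the weight b \<ge>
  |a| preserves domination.\<close>

lemma majorized_mult:
  assumes "majorized V W" "sigma_finite_measure N" "integrable N a" "integrable N b" "s \<in> borel_measurable N"
    and ab: "\<And>y. norm (a y) \<le> b y"
  shows "majorized (\<lambda>x. ext N s a x * V x) (\<lambda>x. ext N s (\<lambda>y. complex_of_real (b y)) x * W x)"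
  unfolding majorized_def
proof (intro conjI allI)
  have VW: "integrable lborel V" "integrable lborel W" using assms by (auto simp: majorized_def)
  have b: "integrable N (\<lambda>y. complex_of_real (b y))" using assms by simp
  show "integrable lborel (\<lambda>x. ext N s a x * V x)"
    by (intro ext_mult_integrable assms VW)
  show "integrable lborel (\<lambda>x. ext N s (\<lambda>y. complex_of_real (b y)) x * W x)"
    by (intro ext_mult_integrable assms VW b)
  fix \<xi>
  define r where "r \<xi> = Re (ft W \<xi>)" for \<xi>
  have r: "ft W \<xi> = complex_of_real (r \<xi>)" "norm (ft V \<xi>) \<le> r \<xi>" for \<xi>
    using assms(1) unfolding majorized_def r_def by (metis Re_complex_of_real)+
  have bint: "integrable N (\<lambda>y. b y * r (s y + \<xi>))"
    using integrable_Re[OF ft_ext_mult(2)[OF assms(2) b assms(5) VW(2), of \<xi>]] unfolding r(1) by simp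
  have "ft (\<lambda>x. ext N s (\<lambda>y. complex_of_real (b y)) x * W x) \<xi> = complex_of_real (\<integral>y. b y * r (s y + \<xi>) \<partial>N)"
    unfolding ft_ext_mult(1)[OF assms(2) b assms(5) VW(2)] r(1) by (simp flip: of_real_mult)
  moreover have "norm (ft (\<lambda>x. ext N s a x * V x) \<xi>) \<le> (\<integral>y. b y * r (s y + \<xi>) \<partial>N)"
  proof -
    have "norm (ft (\<lambda>x. ext N s a x * V x) \<xi>) \<le> (\<integral>y. norm (a y * ft V (s y + \<xi>)) \<partial>N)"
      unfolding ft_ext_mult(1)[OF assms(2,3,5) VW(1)] by (rule integral_norm_bound)
    also have "\<dots> \<le> (\<integral>y. b y * r (s y + \<xi>) \<partial>N)"
    proof (rule integral_mono[OF integrable_norm[OF ft_ext_mult(2)[OF assms(2,3,5) VW(1)]] bint])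
      fix y
      show "norm (a y * ft V (s y + \<xi>)) \<le> b y * r (s y + \<xi>)"
        unfolding norm_mult using ab[of y] r(2)[of "s y + \<xi>"] by (intro mult_mono) (auto intro: order_trans[OF norm_ge_zero])
    qed
    finally show ?thesis .
  qed
  ultimately show "\<exists>r. ft (\<lambda>x. ext N s (\<lambda>y. complex_of_real (b y)) x * W x) \<xi> = complex_of_real r \<and>
      norm (ft (\<lambda>x. ext N s a x * V x) \<xi>) \<le> r" by blast
qed

text \<open>An integral is the value of the transform at frequency 0.\<close>

lemma majorized_integral:
  assumes "majorized V W"
  shows "norm (\<integral>x. V x \<partial>lborel) \<le> Re (\<integral>x. W x \<partial>lborel)"
proof -
  obtain r where "ft W 0 = complex_of_real r" "norm (ft V 0) \<le> r"
    using assms unfolding majorized_def by blast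
  then show ?thesis by (simp add: ft_def)
qed

section \<open>Gaussian regularization\<close>

definition gauss :: "real \<Rightarrow> real^2 \<Rightarrow> real" where
  "gauss e x = exp (- (e\<^sup>2 * (norm x)\<^sup>2 / 2))"

text \<open>The transform of \<open>gauss e\<close>: positive, of total mass 4 pi^2 for every e, and
  concentrating at the origin as e tends to 0.\<close>

definition gauss_hat :: "real \<Rightarrow> real^2 \<Rightarrow> real" where
  "gauss_hat e \<xi> = 2 * pi / e\<^sup>2 * exp (- ((norm \<xi>)\<^sup>2 / (2 * e\<^sup>2)))"

lemma gauss_measurable [measurable]: "gauss e \<in> borel_measurable borel"
  unfolding gauss_def[abs_def] by measurable

lemma gauss_hat_measurable [measurable]: "gauss_hat e \<in> borel_measurable borel"
  unfolding gauss_hat_def[abs_def] by measurable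

lemma gauss_pos: "0 < gauss e x" "gauss e x \<le> 1"
  by (auto simp: gauss_def)

lemma gauss_hat_nonneg: "0 \<le> gauss_hat e \<xi>"
  by (simp add: gauss_hat_def)

text \<open>A rescaling by e of the characteristic function of the standard normal
  distribution.\<close>

lemma gauss_fourier_1d:
  assumes "e > 0"
  shows "integrable lborel (\<lambda>x::real. complex_of_real (exp (- (e\<^sup>2 * x\<^sup>2 / 2))) * exp (- \<i> * complex_of_real (x * t)))"
    "(\<integral>x. complex_of_real (exp (- (e\<^sup>2 * x\<^sup>2 / 2))) * exp (- \<i> * complex_of_real (x * t)) \<partial>lborel)
       = complex_of_real (sqrt (2 * pi) / e * exp (- (t\<^sup>2 / (2 * e\<^sup>2))))"
proof -
  let ?f = "\<lambda>y. std_normal_density y *\<^sub>R iexp (- (t / e) * y)"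
  have int: "integrable lborel ?f"
    by (rule Bochner_Integration.integrable_bound[OF integrable_normal_density[of 1 0]]) auto
  have "(\<integral>y. ?f y \<partial>lborel) = char std_normal_distribution (- (t / e))"
    unfolding char_def by (subst integral_density) auto
  then have val: "(\<integral>y. ?f y \<partial>lborel) = complex_of_real (exp (- (t\<^sup>2 / (2 * e\<^sup>2))))"
    unfolding char_std_normal_distribution by (simp add: power_divide mult.commute)
  have eq: "?f (0 + e * x) = (1 / sqrt (2 * pi)) *\<^sub>R
      (complex_of_real (exp (- (e\<^sup>2 * x\<^sup>2 / 2))) * exp (- \<i> * complex_of_real (x * t)))" for x
    using assms by (simp add: std_normal_density_def power_mult_distrib scaleR_conv_of_real field_simps)
  have "integrable lborel (\<lambda>x. ?f (0 + e * x))"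
    using int assms by (intro lborel_integrable_real_affine) auto
  then have "integrable lborel (\<lambda>x. sqrt (2 * pi) *\<^sub>R (1 / sqrt (2 * pi)) *\<^sub>R
      (complex_of_real (exp (- (e\<^sup>2 * x\<^sup>2 / 2))) * exp (- \<i> * complex_of_real (x * t))))"
    unfolding eq by (rule integrable_scaleR_right)
  then show "integrable lborel (\<lambda>x. complex_of_real (exp (- (e\<^sup>2 * x\<^sup>2 / 2))) * exp (- \<i> * complex_of_real (x * t)))"
    unfolding scaleR_scaleR by simp
  have "(\<integral>y. ?f y \<partial>lborel) = \<bar>e\<bar> *\<^sub>R (\<integral>x. ?f (0 + e * x) \<partial>lborel)"
    using assms by (intro lborel_integral_real_affine) auto
  then have "(\<integral>y. ?f y \<partial>lborel) = complex_of_real (e / sqrt (2 * pi)) *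
      (\<integral>x. complex_of_real (exp (- (e\<^sup>2 * x\<^sup>2 / 2))) * exp (- \<i> * complex_of_real (x * t)) \<partial>lborel)"
    unfolding eq using assms by (simp add: scaleR_conv_of_real)
  then have "complex_of_real (sqrt (2 * pi) / e) * complex_of_real (exp (- (t\<^sup>2 / (2 * e\<^sup>2)))) =
      complex_of_real (sqrt (2 * pi) / e) * complex_of_real (e / sqrt (2 * pi)) *
      (\<integral>x. complex_of_real (exp (- (e\<^sup>2 * x\<^sup>2 / 2))) * exp (- \<i> * complex_of_real (x * t)) \<partial>lborel)"
    unfolding val by (simp add: mult.assoc)
  also have "complex_of_real (sqrt (2 * pi) / e) * complex_of_real (e / sqrt (2 * pi)) = 1"
    using assms by (simp flip: of_real_mult)
  finally show "(\<integral>x. complex_of_real (exp (- (e\<^sup>2 * x\<^sup>2 / 2))) * exp (- \<i> * complex_of_real (x * t)) \<partial>lborel)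
       = complex_of_real (sqrt (2 * pi) / e * exp (- (t\<^sup>2 / (2 * e\<^sup>2))))" by simp
qed

lemma integral_lborel_prod:
  fixes f :: "'a::euclidean_space \<Rightarrow> real \<Rightarrow> complex"
  assumes f: "\<And>b. b \<in> Basis \<Longrightarrow> integrable lborel (f b)"
  shows "integrable lborel (\<lambda>x. \<Prod>b\<in>Basis. f b (x \<bullet> b))"
    "(\<integral>x. (\<Prod>b\<in>Basis. f b (x \<bullet> b)) \<partial>lborel) = (\<Prod>b\<in>Basis. (\<integral>t. f b t \<partial>lborel))"
proof -
  interpret product_sigma_finite "\<lambda>_::'a. lborel :: real measure" ..
  have [measurable]: "b \<in> Basis \<Longrightarrow> f b \<in> borel_measurable borel" for b
    using f[of b] by auto
  have eq: "(\<Prod>b\<in>Basis. f b ((\<Sum>b\<in>Basis. g b *\<^sub>R b) \<bullet> b)) = (\<Prod>b\<in>Basis. f b (g b))" for g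
    by (intro prod.cong) (auto simp: inner_sum_left inner_Basis if_distrib cong: if_cong)
  have m1: "(\<lambda>x. \<Prod>b\<in>Basis. f b (x \<bullet> b)) \<in> borel_measurable borel" by measurable
  have m2: "(\<lambda>g. \<Sum>b\<in>Basis. g b *\<^sub>R b) \<in> (\<Pi>\<^sub>M b\<in>(Basis::'a set). lborel) \<rightarrow>\<^sub>M borel" by measurable
  show "integrable lborel (\<lambda>x. \<Prod>b\<in>Basis. f b (x \<bullet> b))"
    unfolding lborel_eq[where 'a='a] integrable_distr_eq[OF m2 m1] eq
    by (rule product_integrable_prod) (use f in auto)
  have "(\<integral>x. (\<Prod>b\<in>Basis. f b (x \<bullet> b)) \<partial>lborel) = (\<integral>g. (\<Prod>b\<in>Basis. f b (g b)) \<partial>(\<Pi>\<^sub>M b\<in>(Basis::'a set). lborel))"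
    unfolding lborel_eq[where 'a='a] integral_distr[OF m2 m1] eq ..
  also have "\<dots> = (\<Prod>b\<in>Basis. (\<integral>t. f b t \<partial>lborel))"
    by (rule product_integral_prod) (use f in auto)
  finally show "(\<integral>x. (\<Prod>b\<in>Basis. f b (x \<bullet> b)) \<partial>lborel) = (\<Prod>b\<in>Basis. (\<integral>t. f b t \<partial>lborel))" .
qed

lemma gauss_ft:
  assumes "e > 0"
  shows "integrable lborel (\<lambda>x. complex_of_real (gauss e x))"
    "ft (\<lambda>x. complex_of_real (gauss e x)) \<xi> = complex_of_real (gauss_hat e \<xi>)"
proof -
  define f where "f \<xi> b t = complex_of_real (exp (- (e\<^sup>2 * t\<^sup>2 / 2))) * exp (- \<i> * complex_of_real (t * (\<xi> \<bullet> b)))"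
    for \<xi> b :: "real^2" and t
  have n: "(norm x)\<^sup>2 = (\<Sum>b\<in>Basis. (x \<bullet> b)\<^sup>2)" for x :: "real^2"
    unfolding power2_norm_eq_inner by (subst euclidean_inner) (simp add: power2_eq_square)
  have eq: "complex_of_real (gauss e x) * exp (- \<i> * complex_of_real (x \<bullet> \<xi>)) = (\<Prod>b\<in>Basis. f \<xi> b (x \<bullet> b))" for x \<xi>
  proof -
    have "gauss e x = (\<Prod>b\<in>Basis. exp (- (e\<^sup>2 * (x \<bullet> b)\<^sup>2 / 2)))"
      unfolding gauss_def n by (simp add: exp_sum[symmetric] sum_negf sum_distrib_left sum_divide_distrib)
    moreover have "exp (- \<i> * complex_of_real (x \<bullet> \<xi>)) = (\<Prod>b\<in>Basis. exp (- \<i> * complex_of_real ((x \<bullet> b) * (\<xi> \<bullet> b))))"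
      by (subst euclidean_inner) (simp add: exp_sum[symmetric] sum_negf sum_distrib_left)
    ultimately show ?thesis by (simp add: f_def prod.distrib)
  qed
  have int: "integrable lborel (f \<xi> b)" for \<xi> b
    unfolding f_def[abs_def] by (rule gauss_fourier_1d(1)[OF assms])
  show "integrable lborel (\<lambda>x. complex_of_real (gauss e x))"
    using integral_lborel_prod(1)[of "f 0", OF int] unfolding eq[symmetric] by simp
  have "ft (\<lambda>x. complex_of_real (gauss e x)) \<xi> = (\<Prod>b\<in>Basis. (\<integral>t. f \<xi> b t \<partial>lborel))"
    unfolding ft_def eq by (rule integral_lborel_prod(2)[OF int])
  also have "\<dots> = (\<Prod>b\<in>Basis. complex_of_real (sqrt (2 * pi) / e * exp (- ((\<xi> \<bullet> b)\<^sup>2 / (2 * e\<^sup>2)))))"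
    unfolding f_def gauss_fourier_1d(2)[OF assms] ..
  also have "\<dots> = complex_of_real ((sqrt (2 * pi) / e) ^ 2 * exp (- (\<Sum>b\<in>Basis. (\<xi> \<bullet> b)\<^sup>2 / (2 * e\<^sup>2))))"
    unfolding of_real_prod[symmetric] prod.distrib prod_constant exp_sum[OF finite_Basis, symmetric] sum_negf by simp
  also have "\<dots> = complex_of_real (gauss_hat e \<xi>)"
    by (simp add: gauss_hat_def n power_divide sum_divide_distrib)
  finally show "ft (\<lambda>x. complex_of_real (gauss e x)) \<xi> = complex_of_real (gauss_hat e \<xi>)" .
qed

lemma gauss_hat_integral:
  assumes "e > 0"
  shows "(\<integral>\<^sup>+\<xi>. ennreal (gauss_hat e (c + \<xi>)) \<partial>lborel) = ennreal (4 * pi\<^sup>2)"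
proof -
  define p where "p z = 2 * pi / e\<^sup>2 * exp (- (2 * z / e\<^sup>2))" for z
  have "(\<integral>\<^sup>+\<xi>. ennreal (gauss_hat e (c + \<xi>)) \<partial>lborel) = (\<integral>\<^sup>+\<xi>. ennreal (gauss_hat e \<xi>) \<partial>distr lborel borel (\<lambda>x. c + x))"
    by (simp add: nn_integral_distr)
  also have "\<dots> = (\<integral>\<^sup>+\<xi>. ennreal (gauss_hat e \<xi>) \<partial>lborel)"
    by (simp add: lborel_distr_plus)
  also have "\<dots> = (\<integral>\<^sup>+\<xi>. ennreal (p ((norm (\<xi>::real^2))\<^sup>2 / 4)) \<partial>lborel)"
    by (simp add: p_def gauss_hat_def)
  also have "\<dots> = 4 * pi * (\<integral>\<^sup>+z. ennreal (p z) * indicator {0..} z \<partial>lborel)"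
    by (rule nn_integral_radial) (simp add: p_def)
  also have "(\<integral>\<^sup>+z. ennreal (p z) * indicator {0..} z \<partial>lborel) = ennreal (0 - (- pi * exp (- (2 * 0 / e\<^sup>2))))"
  proof (rule nn_integral_FTC_atLeast)
    show "((\<lambda>z. - pi * exp (- (2 * z / e\<^sup>2))) has_real_derivative p z) (at z)" for z
      using assms by (auto intro!: derivative_eq_intros simp: p_def field_simps)
    have "((\<lambda>z. exp (- (2 / e\<^sup>2 * z))) \<longlongrightarrow> 0) at_top"
      using assms by (intro filterlim_compose[OF exp_at_bot] filterlim_uminus_at_bot_at_top[THEN filterlim_compose]
          filterlim_tendsto_pos_mult_at_top[OF tendsto_const _ filterlim_ident]) auto
    from tendsto_mult_right_zero[OF this, of "- pi"]
    show "((\<lambda>z. - pi * exp (- (2 * z / e\<^sup>2))) \<longlongrightarrow> 0) at_top"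
      by simp
  qed (auto simp: p_def)
  finally show ?thesis
    by (simp add: power2_eq_square flip: ennreal_mult)
qed

text \<open>The inequality exp (-y) \<le> 1/y trades the decay of the exponential for a bound that
  is independent of e; it controls all pairs of points whose sum is not close to 0.\<close>

lemma gauss_hat_le:
  assumes "e > 0" "\<xi> \<noteq> 0"
  shows "gauss_hat e \<xi> \<le> 4 * pi / (norm \<xi>)\<^sup>2"
proof -
  define y where "y = (norm \<xi>)\<^sup>2 / (2 * e\<^sup>2)"
  have "y > 0" using assms by (simp add: y_def)
  have "y \<le> exp y" using exp_ge_add_one_self[of y] by linarith
  then have "exp (- y) \<le> 1 / y" using \<open>y > 0\<close> by (simp add: exp_minus field_simps)
  then have "gauss_hat e \<xi> \<le> 2 * pi / e\<^sup>2 * (1 / y)"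
    unfolding gauss_hat_def y_def[symmetric] by (intro mult_left_mono) auto
  also have "\<dots> = 4 * pi / (norm \<xi>)\<^sup>2" using assms by (simp add: y_def field_simps)
  finally show ?thesis .
qed

text \<open>Fatou's lemma along e = 1 / (n + 1), where the weight tends to 1 pointwise.\<close>

lemma nn_integral_gauss_limit:
  fixes \<phi> :: "real^2 \<Rightarrow> real"
  assumes [measurable]: "\<phi> \<in> borel_measurable borel" and nonneg: "\<And>x. 0 \<le> \<phi> x"
    and C: "\<And>e. e > 0 \<Longrightarrow> (\<integral>\<^sup>+x. ennreal (\<phi> x * gauss e x) \<partial>lborel) \<le> C"
  shows "(\<integral>\<^sup>+x. ennreal (\<phi> x) \<partial>lborel) \<le> C"
proof -
  define e where "e n = inverse (real (Suc n))" for n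
  have lim: "(\<lambda>n. \<phi> x * gauss (e n) x) \<longlonglongrightarrow> \<phi> x" for x
  proof -
    have "(\<lambda>n. \<phi> x * gauss (e n) x) \<longlonglongrightarrow> \<phi> x * exp (- (0\<^sup>2 * (norm x)\<^sup>2 / 2))"
      unfolding gauss_def e_def by (intro tendsto_intros LIMSEQ_inverse_real_of_nat) simp
    then show ?thesis by simp
  qed
  have "(\<integral>\<^sup>+x. ennreal (\<phi> x) \<partial>lborel) = (\<integral>\<^sup>+x. liminf (\<lambda>n. ennreal (\<phi> x * gauss (e n) x)) \<partial>lborel)"
    by (intro nn_integral_cong lim_imp_Liminf[symmetric] tendsto_ennrealI lim) simp
  also have "\<dots> \<le> liminf (\<lambda>n. \<integral>\<^sup>+x. ennreal (\<phi> x * gauss (e n) x) \<partial>lborel)"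
    by (rule nn_integral_liminf) measurable
  also have "\<dots> \<le> C"
    by (rule order_trans[OF Liminf_le_Limsup Limsup_bounded]) (auto intro!: always_eventually C simp: e_def)
  finally show ?thesis .
qed

section \<open>Antipodal symmetrization\<close>

text \<open>Periodicity on the whole line is part of the notion, so that the antipode is simply t +
  pi.\<close>

definition circle_L2 :: "(real \<Rightarrow> complex) \<Rightarrow> bool" where
  "circle_L2 F \<longleftrightarrow> F \<in> borel_measurable borel \<and> periodic F \<and> integrable T (\<lambda>t. (norm (F t))\<^sup>2)"

lemma circle_L2_measurable: "circle_L2 F \<Longrightarrow> F \<in> borel_measurable borel"
  and circle_L2_periodic: "circle_L2 F \<Longrightarrow> periodic F"
  and circle_L2_integrable_sq: "circle_L2 F \<Longrightarrow> integrable T (\<lambda>t. (norm (F t))\<^sup>2)"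
  by (auto simp: circle_L2_def)

lemma integrable_T_of_square:
  fixes f :: "real \<Rightarrow> 'b::{banach, second_countable_topology}"
  assumes "integrable T (\<lambda>t. (norm (f t))\<^sup>2)" "f \<in> borel_measurable borel"
  shows "integrable T f"
proof (rule Bochner_Integration.integrable_bound)
  show "integrable T (\<lambda>t. 1 + (norm (f t))\<^sup>2)" using assms by simp
  have "norm (f t) \<le> 1 + (norm (f t))\<^sup>2" for t
    using sum_squares_bound[of "norm (f t)" 1] by simp (smt (verit) norm_ge_zero)
  then show "AE t in T. norm (f t) \<le> norm (1 + (norm (f t))\<^sup>2)" by auto
qed (use assms in auto)

lemma circle_L2_integrable: "circle_L2 F \<Longrightarrow> integrable T F"
  by (rule integrable_T_of_square) (auto simp: circle_L2_def)

abbreviation circle_ext :: "(real \<Rightarrow> complex) \<Rightarrow> real^2 \<Rightarrow> complex" where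
  "circle_ext \<equiv> ext T circ"

lemma circ_measurable_T [measurable]: "circ \<in> borel_measurable T"
  by (rule measurable_T) measurable

lemma sigma_finite_T: "sigma_finite_measure T"
  by (rule T.sigma_finite_measure_axioms)

lemma circle_ext_measurable [measurable]:
  "F \<in> borel_measurable borel \<Longrightarrow> circle_ext F \<in> borel_measurable borel"
  by (rule ext_measurable[OF sigma_finite_T]) (auto intro: measurable_T)

text \<open>Conjugation changes the sign of the point in the exponential, and the opposite point has
  angle t + pi.\<close>

lemma cnj_circle_ext:
  assumes [measurable]: "F \<in> borel_measurable borel" and per: "periodic F"
  shows "cnj (circle_ext F x) = circle_ext (\<lambda>t. cnj (F (t + pi))) x"
proof -
  define g where "g t = cnj (F (t + pi)) * exp (- \<i> * complex_of_real (x \<bullet> circ t))" for t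
  have "periodic g"
    using periodicD[OF per, of "t + pi" for t] by (simp add: periodic_def g_def add_ac)
  have [measurable]: "cnj \<in> borel_measurable borel"
    by (intro borel_measurable_continuous_onI continuous_intros)
  have [measurable]: "g \<in> borel_measurable borel"
    unfolding g_def[abs_def] by measurable
  have "g (t + pi) = cnj (F t * exp (- \<i> * complex_of_real (x \<bullet> circ t)))" for t
    using periodicD[OF per, of t] by (simp add: g_def circ_add_pi exp_cnj add.assoc flip: mult_2)
  then have "cnj (circle_ext F x) = (\<integral>t. g (t + pi) \<partial>T)"
    unfolding ext_def by (simp flip: Bochner_Integration.integral_cnj)
  also have "\<dots> = (\<integral>t. g t \<partial>T)"
    by (rule integral_T_shift) (simp_all add: \<open>periodic g\<close>)
  finally show ?thesis by (simp add: g_def ext_def)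
qed

definition sharp :: "(real \<Rightarrow> complex) \<Rightarrow> real \<Rightarrow> real" where
  "sharp F t = sqrt (((norm (F t))\<^sup>2 + (norm (F (t + pi)))\<^sup>2) / 2)"

lemma sharp_nonneg: "0 \<le> sharp F t"
  by (simp add: sharp_def)

lemma sharp_antipodal: "periodic F \<Longrightarrow> sharp F (t + pi) = sharp F t"
  using periodicD[of F t] by (simp add: sharp_def add.assoc add.commute[of "(norm (F t))\<^sup>2"] flip: mult_2)

lemma sharp_square: "(sharp F t)\<^sup>2 = ((norm (F t))\<^sup>2 + (norm (F (t + pi)))\<^sup>2) / 2"
  by (simp add: sharp_def)

lemma sharp_measurable [measurable]:
  assumes [measurable]: "F \<in> borel_measurable borel"
  shows "sharp F \<in> borel_measurable borel"
  unfolding sharp_def[abs_def] by measurable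

lemma antipodal_periodic: "(\<And>t. f (t + pi) = f t) \<Longrightarrow> periodic f"
  unfolding periodic_def by (metis add.assoc mult_2)

lemma sharp_L2:
  assumes F: "circle_L2 F"
  shows "circle_L2 (\<lambda>t. complex_of_real (sharp F t))"
    and "(\<integral>t. (sharp F t)\<^sup>2 \<partial>T) = (\<integral>t. (norm (F t))\<^sup>2 \<partial>T)"
proof -
  have [measurable]: "F \<in> borel_measurable borel" and per: "periodic F" and int: "integrable T (\<lambda>t. (norm (F t))\<^sup>2)"
    using F by (auto simp: circle_L2_def)
  have per2: "periodic (\<lambda>t. (norm (F t))\<^sup>2)" using per by (simp add: periodic_def)
  have int2: "integrable T (\<lambda>t. (norm (F (t + pi)))\<^sup>2)"
    by (rule integrable_T_shift[OF _ per2 int]) measurable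
  show "circle_L2 (\<lambda>t. complex_of_real (sharp F t))"
    unfolding circle_L2_def
    using int int2 sharp_antipodal[OF per] by (auto simp: sharp_square intro!: antipodal_periodic)
  have "(\<integral>t. (norm (F (t + pi)))\<^sup>2 \<partial>T) = (\<integral>t. (norm (F t))\<^sup>2 \<partial>T)"
    by (rule integral_T_shift[OF _ per2]) measurable
  then show "(\<integral>t. (sharp F t)\<^sup>2 \<partial>T) = (\<integral>t. (norm (F t))\<^sup>2 \<partial>T)"
    using int int2 by (simp add: sharp_square)
qed

section \<open>The symmetrization inequality\<close>

definition circ2 :: "real \<times> real \<Rightarrow> real^2" where
  "circ2 p = circ (fst p) + circ (snd p)"

interpretation TT: pair_sigma_finite T T ..

lemma circ2_measurable [measurable]: "circ2 \<in> borel_measurable (T \<Otimes>\<^sub>M T)"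
  unfolding circ2_def[abs_def] by measurable

lemma sigma_finite_TT: "sigma_finite_measure (T \<Otimes>\<^sub>M T)"
  by (rule TT.sigma_finite_measure_axioms)

lemma ext_pair:
  assumes "integrable T a" "integrable T b"
  shows "ext (T \<Otimes>\<^sub>M T) circ2 (\<lambda>p. a (fst p) * b (snd p)) x = circle_ext a x * circle_ext b x"
  unfolding circ2_def[abs_def] by (rule TT.ext_pair_mult) (use assms in auto)

text \<open>The squared modulus of the extension of F is an extension over pairs of points with
  density \<open>a\<close>, and the same holds for \<open>sharp F\<close> with density
  \<open>b\<close> \<ge> |\<open>a\<close>|. Three multiplications of the Gaussian by such functions
  produce the sixth power and keep the majorization.\<close>

lemma symmetrization_gauss:
  assumes F: "circle_L2 F" and e: "e > 0"
  shows "integrable lborel (\<lambda>x. norm (circle_ext F x) ^ 6 * gauss e x)"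
    and "(\<integral>x. norm (circle_ext F x) ^ 6 * gauss e x \<partial>lborel) \<le>
      (\<integral>x. norm (circle_ext (\<lambda>t. complex_of_real (sharp F t)) x) ^ 6 * gauss e x \<partial>lborel)"
proof -
  define h where "h t = complex_of_real (sharp F t)" for t
  define F' where "F' t = cnj (F (t + pi))" for t
  have [measurable]: "F \<in> borel_measurable borel" and per: "periodic F"
    using F by (auto simp: circle_L2_def)
  have h: "circle_L2 h" unfolding h_def[abs_def] by (rule sharp_L2[OF F])
  have intF: "integrable T F" by (rule circle_L2_integrable[OF F])
  have inth: "integrable T h" by (rule circle_L2_integrable[OF h])
  have "integrable T (\<lambda>t. F (t + pi))"
    by (rule integrable_T_shift[OF _ per intF]) measurable
  then have intF': "integrable T F'"
    unfolding F'_def[abs_def] by simp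
  \<comment> \<open>Exchanging the two points does not change the extension, and only the
    symmetrized density obeys the bound by \<open>b\<close>; a single term would lose a factor
    2.\<close>
  define a where "a p = (1 / 2) * (F (fst p) * F' (snd p) + F' (fst p) * F (snd p))" for p
  define b where "b p = sharp F (fst p) * sharp F (snd p)" for p
  note int1 = TT.integrable_pair_mult(1)[OF intF intF'] and int2 = TT.integrable_pair_mult(1)[OF intF' intF]
  have inta: "integrable (T \<Otimes>\<^sub>M T) a"
    unfolding a_def[abs_def] using int1 int2 by simp
  have intb': "integrable (T \<Otimes>\<^sub>M T) (\<lambda>p. complex_of_real (b p))"
    using TT.integrable_pair_mult(1)[OF inth inth] unfolding b_def[abs_def] h_def by simp
  then have intb: "integrable (T \<Otimes>\<^sub>M T) b" by (simp add: complex_of_real_integrable_eq)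
  have ab: "norm (a p) \<le> b p" for p
  proof -
    obtain t u where p: "p = (t, u)" by (cases p)
    have "norm (a p) \<le> (norm (F t) * norm (F (u + pi)) + norm (F (t + pi)) * norm (F u)) / 2"
      unfolding a_def p F'_def using norm_triangle_ineq[of "F t * cnj (F (u + pi))" "cnj (F (t + pi)) * F u"]
      by (simp add: norm_mult)
    also have "\<dots> \<le> b p"
    proof (rule power2_le_imp_le)
      let ?p = "norm (F t)" and ?q = "norm (F (t + pi))" and ?r = "norm (F u)" and ?s = "norm (F (u + pi))"
      \<comment> \<open>Lagrange's identity, that is the Cauchy-Schwarz inequality for the vectors
        (p, q) and (s, r).\<close>
      have "(?p * ?s + ?q * ?r)\<^sup>2 + (?p * ?r - ?q * ?s)\<^sup>2 = (?p\<^sup>2 + ?q\<^sup>2) * (?r\<^sup>2 + ?s\<^sup>2)"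
        by (simp add: power2_eq_square algebra_simps)
      then have "(?p * ?s + ?q * ?r)\<^sup>2 \<le> (?p\<^sup>2 + ?q\<^sup>2) * (?r\<^sup>2 + ?s\<^sup>2)"
        by (smt (verit) zero_le_power2)
      then show "((?p * ?s + ?q * ?r) / 2)\<^sup>2 \<le> (b p)\<^sup>2"
        by (simp add: b_def p power_mult_distrib sharp_square power_divide)
      show "0 \<le> b p" by (simp add: b_def sharp_nonneg)
    qed
    finally show ?thesis .
  qed
  have exta: "ext (T \<Otimes>\<^sub>M T) circ2 a x = complex_of_real ((norm (circle_ext F x))\<^sup>2)" for x
  proof -
    have "ext (T \<Otimes>\<^sub>M T) circ2 a x = (ext (T \<Otimes>\<^sub>M T) circ2 (\<lambda>p. F (fst p) * F' (snd p)) x + ext (T \<Otimes>\<^sub>M T) circ2 (\<lambda>p. F' (fst p) * F (snd p)) x) / 2"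
      unfolding a_def ext_cmult ext_add[OF int1 int2 circ2_measurable] by simp
    also have "\<dots> = circle_ext F x * circle_ext F' x"
      using intF intF' by (simp add: ext_pair)
    also have "circle_ext F' x = cnj (circle_ext F x)"
      unfolding F'_def[abs_def] by (rule cnj_circle_ext[symmetric, OF _ per]) measurable
    finally show ?thesis by (simp only: complex_norm_square)
  qed
  have extb: "ext (T \<Otimes>\<^sub>M T) circ2 (\<lambda>p. complex_of_real (b p)) x = complex_of_real ((norm (circle_ext h x))\<^sup>2)" for x
  proof -
    have "cnj (circle_ext h x) = circle_ext (\<lambda>t. cnj (h (t + pi))) x"
      using h by (intro cnj_circle_ext) (auto simp: circle_L2_def)
    then have "cnj (circle_ext h x) = circle_ext h x"
      by (simp add: h_def[abs_def] sharp_antipodal[OF per])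
    moreover have "ext (T \<Otimes>\<^sub>M T) circ2 (\<lambda>p. complex_of_real (b p)) x = circle_ext h x * circle_ext h x"
      using ext_pair[OF inth inth, of x] by (simp add: b_def h_def)
    ultimately show ?thesis
      by (simp only: complex_norm_square)
  qed
  have g: "majorized (\<lambda>x. complex_of_real (gauss e x)) (\<lambda>x. complex_of_real (gauss e x))"
    unfolding majorized_def using gauss_ft[OF e] gauss_hat_nonneg by auto
  note m = majorized_mult[OF _ sigma_finite_TT inta intb circ2_measurable ab, unfolded exta extb]
  from m[OF m[OF m[OF g]]]
  have maj: "majorized (\<lambda>x. complex_of_real (norm (circle_ext F x) ^ 6 * gauss e x))
     (\<lambda>x. complex_of_real (norm (circle_ext h x) ^ 6 * gauss e x))"
    by (simp add: mult.assoc[symmetric] flip: power_add)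
  then have int: "integrable lborel (\<lambda>x. norm (circle_ext F x) ^ 6 * gauss e x)" "integrable lborel (\<lambda>x. norm (circle_ext h x) ^ 6 * gauss e x)"
    unfolding majorized_def complex_of_real_integrable_eq by auto
  show "integrable lborel (\<lambda>x. norm (circle_ext F x) ^ 6 * gauss e x)" by fact
  have "norm (complex_of_real (\<integral>x. norm (circle_ext F x) ^ 6 * gauss e x \<partial>lborel)) \<le> (\<integral>x. norm (circle_ext h x) ^ 6 * gauss e x \<partial>lborel)"
    using majorized_integral[OF maj] by (simp only: integral_complex_of_real Re_complex_of_real)
  then show "(\<integral>x. norm (circle_ext F x) ^ 6 * gauss e x \<partial>lborel) \<le>
      (\<integral>x. norm (circle_ext (\<lambda>t. complex_of_real (sharp F t)) x) ^ 6 * gauss e x \<partial>lborel)"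
    unfolding h_def[abs_def] by simp
qed

definition ext6 :: "(real \<Rightarrow> complex) \<Rightarrow> ennreal" where
  "ext6 F = (\<integral>\<^sup>+x. ennreal (norm (circle_ext F x) ^ 6) \<partial>lborel)"

text \<open>Fatou's lemma removes the weight on the left, and the bound 1 for the weight removes it
  on the right. Both sides are still allowed to be infinite.\<close>

lemma symmetrization:
  assumes F: "circle_L2 F"
  shows "ext6 F \<le> ext6 (\<lambda>t. complex_of_real (sharp F t))"
  unfolding ext6_def
proof (rule nn_integral_gauss_limit)
  have [measurable]: "F \<in> borel_measurable borel" using F by (simp add: circle_L2_def)
  show "(\<lambda>x. norm (circle_ext F x) ^ 6) \<in> borel_measurable borel" by measurable
  fix e :: real assume e: "e > 0"
  have h: "circle_L2 (\<lambda>t. complex_of_real (sharp F t))" by (rule sharp_L2[OF F])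
  have "(\<integral>\<^sup>+x. ennreal (norm (circle_ext F x) ^ 6 * gauss e x) \<partial>lborel) = ennreal (\<integral>x. norm (circle_ext F x) ^ 6 * gauss e x \<partial>lborel)"
    by (rule nn_integral_eq_integral[OF symmetrization_gauss(1)[OF F e]]) (simp add: gauss_pos less_imp_le)
  also have "\<dots> \<le> ennreal (\<integral>x. norm (circle_ext (\<lambda>t. complex_of_real (sharp F t)) x) ^ 6 * gauss e x \<partial>lborel)"
    by (rule ennreal_leI[OF symmetrization_gauss(2)[OF F e]])
  also have "\<dots> = (\<integral>\<^sup>+x. ennreal (norm (circle_ext (\<lambda>t. complex_of_real (sharp F t)) x) ^ 6 * gauss e x) \<partial>lborel)"
    by (rule nn_integral_eq_integral[OF symmetrization_gauss(1)[OF h e], symmetric]) (simp add: gauss_pos less_imp_le)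
  also have "\<dots> \<le> (\<integral>\<^sup>+x. ennreal (norm (circle_ext (\<lambda>t. complex_of_real (sharp F t)) x) ^ 6) \<partial>lborel)"
    by (intro nn_integral_mono ennreal_leI mult_left_le) (auto simp: gauss_pos)
  finally show "(\<integral>\<^sup>+x. ennreal (norm (circle_ext F x) ^ 6 * gauss e x) \<partial>lborel) \<le>
    (\<integral>\<^sup>+x. ennreal (norm (circle_ext (\<lambda>t. complex_of_real (sharp F t)) x) ^ 6) \<partial>lborel)" .
qed simp

section \<open>Sums of three points of the circle\<close>

text \<open>The density of \<open>a + b cos t\<close> with respect to the total mass \<open>2\<pi>\<close>.\<close>

definition arcsine_density :: "real \<Rightarrow> real \<Rightarrow> real \<Rightarrow> real" where
  "arcsine_density a b w = (if \<bar>w - a\<bar> < \<bar>b\<bar> then 2 / sqrt (b\<^sup>2 - (w - a)\<^sup>2) else 0)"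

lemma arcsine_density_measurable [measurable]: "arcsine_density a b \<in> borel_measurable borel"
  unfolding arcsine_density_def[abs_def] by measurable

lemma arcsine_density_nonneg: "0 \<le> arcsine_density a b w"
  unfolding arcsine_density_def by (auto simp: abs_le_square_iff[symmetric])

text \<open>The two half circles contribute equally, whence the factor 2. The substitution uses the
  increasing function -cos on [0, pi]; a reflection restores the sign.\<close>

lemma nn_integral_cos_unit:
  assumes [measurable]: "\<phi> \<in> borel_measurable borel"
  shows "(\<integral>\<^sup>+u. \<phi> (cos u) \<partial>T) = (\<integral>\<^sup>+c. \<phi> c * ennreal (arcsine_density 0 1 c) \<partial>lborel)"
proof -
  define I where "I = (\<integral>\<^sup>+u. \<phi> (cos u) * indicator {0..pi} u \<partial>lborel)"
  have "(\<integral>\<^sup>+u. \<phi> (cos u) * indicator {pi..2 * pi} u \<partial>lborel) =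
      ennreal \<bar>-1\<bar> * (\<integral>\<^sup>+u. \<phi> (cos (2 * pi + (-1) * u)) * indicator {pi..2 * pi} (2 * pi + (-1) * u) \<partial>lborel)"
    by (rule nn_integral_real_affine) auto
  also have "\<dots> = I"
    unfolding I_def by (auto intro!: nn_integral_cong simp: indicator_def cos_diff)
  finally have refl: "(\<integral>\<^sup>+u. \<phi> (cos u) * indicator {pi..2 * pi} u \<partial>lborel) = I" .
  have "(\<integral>\<^sup>+u. \<phi> (cos u) \<partial>T) = (\<integral>\<^sup>+u. \<phi> (cos u) * indicator {0..pi} u + \<phi> (cos u) * indicator {pi..2 * pi} u \<partial>lborel)"
    unfolding nn_integral_T
  proof (rule nn_integral_cong_AE)
    show "AE u in lborel. \<phi> (cos u) * indicator {0..<2 * pi} u =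
        \<phi> (cos u) * indicator {0..pi} u + \<phi> (cos u) * indicator {pi..2 * pi} u"
      using AE_lborel_singleton[of pi] AE_lborel_singleton[of "2 * pi"]
      by eventually_elim (auto simp: indicator_def)
  qed
  also have "\<dots> = I + (\<integral>\<^sup>+u. \<phi> (cos u) * indicator {pi..2 * pi} u \<partial>lborel)"
    unfolding I_def by (rule nn_integral_add) measurable
  finally have two: "(\<integral>\<^sup>+u. \<phi> (cos u) \<partial>T) = 2 * I"
    unfolding refl mult_2[of I] .
  define f where "f x = \<phi> (- x) * ennreal (1 / sqrt (1 - x\<^sup>2))" for x
  have [measurable]: "f \<in> borel_measurable borel" unfolding f_def[abs_def] by measurable
  have "(\<integral>\<^sup>+x. f x * indicator {- cos 0..- cos pi} x \<partial>lborel) = (\<integral>\<^sup>+u. f (- cos u) * ennreal (sin u) * indicator {0..pi} u \<partial>lborel)"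
    by (rule nn_integral_substitution_aux)
       (auto intro!: derivative_eq_intros continuous_intros sin_ge_zero)
  also have "\<dots> = I"
    unfolding I_def
  proof (rule nn_integral_cong_AE)
    show "AE u in lborel. f (- cos u) * ennreal (sin u) * indicator {0..pi} u = \<phi> (cos u) * indicator {0..pi} u"
      using AE_lborel_singleton[of 0] AE_lborel_singleton[of pi]
    proof eventually_elim
      fix u :: real assume u: "u \<noteq> 0" "u \<noteq> pi"
      show "f (- cos u) * ennreal (sin u) * indicator {0..pi} u = \<phi> (cos u) * indicator {0..pi} u"
      proof (cases "u \<in> {0..pi}")
        case True
        then have "0 < sin u" using u by (auto intro!: sin_gt_zero)
        moreover have "sqrt (1 - (cos u)\<^sup>2) = sin u"
          using \<open>0 < sin u\<close> by (simp add: sin_squared_eq[symmetric])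
        ultimately show ?thesis
          using True by (simp add: f_def mult.assoc flip: ennreal_mult)
      qed simp
    qed
  qed
  finally have "I = (\<integral>\<^sup>+x. f x * indicator {-1..1} x \<partial>lborel)" by simp
  also have "\<dots> = ennreal \<bar>-1\<bar> * (\<integral>\<^sup>+x. f (0 + (-1) * x) * indicator {-1..1} (0 + (-1) * x) \<partial>lborel)"
    by (rule nn_integral_real_affine) auto
  finally have "I = (\<integral>\<^sup>+x. \<phi> x * ennreal (1 / sqrt (1 - x\<^sup>2)) * indicator {-1..1} x \<partial>lborel)"
    by (simp add: f_def indicator_def conj_commute)
  then have "2 * I = (\<integral>\<^sup>+x. 2 * (\<phi> x * ennreal (1 / sqrt (1 - x\<^sup>2)) * indicator {-1..1} x) \<partial>lborel)"
    by (simp add: nn_integral_cmult)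
  also have "\<dots> = (\<integral>\<^sup>+c. \<phi> c * ennreal (arcsine_density 0 1 c) \<partial>lborel)"
  proof (rule nn_integral_cong_AE)
    show "AE x in lborel. 2 * (\<phi> x * ennreal (1 / sqrt (1 - x\<^sup>2)) * indicator {-1..1} x) = \<phi> x * ennreal (arcsine_density 0 1 x)"
      using AE_lborel_singleton[of 1] AE_lborel_singleton[of "-1"]
    proof eventually_elim
      fix x :: real assume x: "x \<noteq> 1" "x \<noteq> - 1"
      have "ennreal (2 / sqrt (1 - x\<^sup>2)) = 2 * ennreal (1 / sqrt (1 - x\<^sup>2))" if "\<bar>x\<bar> < 1"
      proof -
        have "0 \<le> 1 / sqrt (1 - x\<^sup>2)" using that by (simp add: abs_square_le_1 less_imp_le)
        then show ?thesis using ennreal_mult[of 2 "1 / sqrt (1 - x\<^sup>2)"] by simp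
      qed
      then show "2 * (\<phi> x * ennreal (1 / sqrt (1 - x\<^sup>2)) * indicator {-1..1} x) = \<phi> x * ennreal (arcsine_density 0 1 x)"
        using x by (auto simp: arcsine_density_def indicator_def mult_ac abs_if split: if_splits)
    qed
  qed
  finally show ?thesis unfolding two .
qed

lemma nn_integral_cos:
  assumes [measurable]: "\<phi> \<in> borel_measurable borel" and b: "b \<noteq> 0"
  shows "(\<integral>\<^sup>+u. \<phi> (a + b * cos u) \<partial>T) = (\<integral>\<^sup>+w. \<phi> w * ennreal (arcsine_density a b w) \<partial>lborel)"
proof -
  have dens: "\<bar>b\<bar> * arcsine_density a b (a + b * c) = arcsine_density 0 1 c" for c
  proof -
    have "b\<^sup>2 - (b * c)\<^sup>2 = b\<^sup>2 * (1 - c\<^sup>2)" by (simp add: power_mult_distrib algebra_simps)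
    moreover have "\<bar>b * c\<bar> < \<bar>b\<bar> \<longleftrightarrow> \<bar>c\<bar> < 1"
      using b by (simp add: abs_mult)
    ultimately show ?thesis
      using b by (simp add: arcsine_density_def real_sqrt_mult)
  qed
  have "(\<integral>\<^sup>+w. \<phi> w * ennreal (arcsine_density a b w) \<partial>lborel) =
      ennreal \<bar>b\<bar> * (\<integral>\<^sup>+c. \<phi> (a + b * c) * ennreal (arcsine_density a b (a + b * c)) \<partial>lborel)"
    using b by (intro nn_integral_real_affine) auto
  also have "\<dots> = (\<integral>\<^sup>+c. \<phi> (a + b * c) * ennreal (\<bar>b\<bar> * arcsine_density a b (a + b * c)) \<partial>lborel)"
    by (subst nn_integral_cmult[symmetric]) (auto simp: ennreal_mult arcsine_density_nonneg mult_ac)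
  also have "\<dots> = (\<integral>\<^sup>+u. \<phi> (a + b * cos u) \<partial>T)"
    unfolding dens by (rule nn_integral_cos_unit[symmetric]) measurable
  finally show ?thesis ..
qed

lemma arcsine_density_total: "b \<noteq> 0 \<Longrightarrow> (\<integral>\<^sup>+w. ennreal (arcsine_density a b w) \<partial>lborel) = ennreal (2 * pi)"
  using nn_integral_cos[of "\<lambda>_. 1" b a] emeasure_T by simp

section \<open>The squared length of a sum of three points\<close>

lemma nn_integral_T_swap:
  assumes [measurable]: "(\<lambda>p. f (fst p) (snd p)) \<in> borel_measurable (borel \<Otimes>\<^sub>M borel)"
  shows "(\<integral>\<^sup>+x. (\<integral>\<^sup>+y. f x y \<partial>T) \<partial>T) = (\<integral>\<^sup>+y. (\<integral>\<^sup>+x. f x y \<partial>T) \<partial>T)"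
proof -
  have "(\<lambda>p. (fst p, snd p)) \<in> T \<Otimes>\<^sub>M T \<rightarrow>\<^sub>M borel \<Otimes>\<^sub>M borel"
    by (intro measurable_Pair measurable_compose[OF measurable_fst measurable_T[OF measurable_ident_sets[OF refl]]]
       measurable_compose[OF measurable_snd measurable_T[OF measurable_ident_sets[OF refl]]])
  from measurable_compose[OF this assms] show ?thesis
    by (intro TT.Fubini'[symmetric]) (simp add: split_beta')
qed

text \<open>In terms of \<open>\<rho> = \<surd>w\<close>, \<open>4X - (w - 1 - X)\<^sup>2 = (X - (\<rho> - 1)\<^sup>2) ((\<rho> + 1)\<^sup>2 - X)\<close>. The smaller root of \<open>X\<close> stays
  away from 0 when \<open>w\<close> stays away from 1, which is where the density of the sum has its singularity.\<close>

lemma arcsine_product_bound: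
  assumes w: "144 / 100 \<le> w" and X: "(w - 1 - X)\<^sup>2 < 4 * X"
  shows "2 / sqrt (4 * X - (w - 1 - X)\<^sup>2) * arcsine_density 2 2 X \<le>
     12 * arcsine_density ((4 + (sqrt w - 1)\<^sup>2) / 2) ((4 - (sqrt w - 1)\<^sup>2) / 2) X"
proof (cases "X < 4")
  case False
  then have "\<not> \<bar>X - 2\<bar> < \<bar>2\<bar>" by auto
  then show ?thesis using arcsine_density_nonneg by (simp add: arcsine_density_def[of 2 2])
next
  case True
  define s where "s = sqrt w"
  have s: "12 / 10 \<le> s" "s\<^sup>2 = w"
    using w real_le_rsqrt[of "12/10" w] by (auto simp: s_def power_divide)
  define p where "p = (s - 1)\<^sup>2"
  define q where "q = (s + 1)\<^sup>2"
  have fact: "4 * X - (w - 1 - X)\<^sup>2 = (X - p) * (q - X)"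
    unfolding p_def q_def s(2)[symmetric] by (simp add: power2_eq_square algebra_simps)
  have pos: "0 < (X - p) * (q - X)" using X fact by simp
  have "p \<le> q" unfolding p_def q_def using s by (simp add: power2_eq_square algebra_simps)
  then have Xp: "p < X" "X < q" using pos by (auto simp: zero_less_mult_iff)
  have "(2 / 10)\<^sup>2 \<le> p" unfolding p_def using s by (intro power_mono) auto
  then have p: "4 / 100 \<le> p" by (simp add: power_divide)
  have "(22 / 10)\<^sup>2 \<le> q" unfolding q_def using s by (intro power_mono) auto
  then have q: "84 / 100 \<le> q - X" using True by (simp add: power_divide)
  have X0: "0 < X" "4 / 100 \<le> X" using p Xp by auto
  have d1: "arcsine_density 2 2 X = 2 / sqrt (X * (4 - X))"
  proof -
    have "\<bar>X - 2\<bar> < \<bar>2\<bar>" "2\<^sup>2 - (X - 2)\<^sup>2 = X * (4 - X)"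
      using X0 True by (auto simp: power2_eq_square algebra_simps)
    then show ?thesis by (simp add: arcsine_density_def)
  qed
  \<comment> \<open>The target is the arcsine law on [p, 4], whose total mass is 2 pi for every p.
    The factor (4 - X)(X - p) is kept, and only X (q - X) is estimated.\<close>
  have d2: "arcsine_density ((4 + p) / 2) ((4 - p) / 2) X = 2 / sqrt ((4 - X) * (X - p))"
  proof -
    have "\<bar>X - (4 + p) / 2\<bar> < \<bar>(4 - p) / 2\<bar>" using Xp True by (auto simp: abs_if field_simps)
    moreover have "((4 - p) / 2)\<^sup>2 - (X - (4 + p) / 2)\<^sup>2 = (4 - X) * (X - p)"
      by (simp add: power2_eq_square field_simps)
    ultimately show ?thesis by (simp add: arcsine_density_def)
  qed
  \<comment> \<open>The value 0.04 * 0.84 = 0.0336 exceeds 1/36, so 4 / sqrt (X (q - X)) \<le>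
    24.\<close>
  have "(1 / 6)\<^sup>2 \<le> (4 / 100) * (84 / 100 :: real)" by (simp add: power_divide)
  also have "\<dots> \<le> X * (q - X)" using X0 q by (intro mult_mono) auto
  finally have sq: "1 / 6 \<le> sqrt (X * (q - X))" by (intro real_le_rsqrt)
  have "2 / sqrt ((X - p) * (q - X)) * (2 / sqrt (X * (4 - X))) =
      4 / sqrt (X * (q - X)) * (1 / sqrt ((4 - X) * (X - p)))"
    by (simp add: real_sqrt_mult)
  also have "\<dots> \<le> 24 * (1 / sqrt ((4 - X) * (X - p)))"
  proof (intro mult_right_mono)
    have "4 / sqrt (X * (q - X)) \<le> 4 / (1 / 6)"
      using sq by (intro divide_left_mono mult_pos_pos) linarith+
    then show "4 / sqrt (X * (q - X)) \<le> 24" by simp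
    show "0 \<le> 1 / sqrt ((4 - X) * (X - p))" using True Xp by simp
  qed
  also have "\<dots> = 12 * (2 / sqrt ((4 - X) * (X - p)))" by simp
  finally show ?thesis unfolding fact d1 using d2 by (simp add: p_def s_def)
qed

text \<open>Let X = 2 + 2 cos t be the squared length of the sum of two points at angle t. Given X,
  the total squared length w follows an arcsine law, and X itself follows the arcsine law of centre
  and radius 2. After Fubini, \<open>arcsine_product_bound\<close> leaves an integral over X of at
  most 12 * 2 pi.\<close>

lemma length_sq_density:
  assumes [measurable]: "\<psi> \<in> borel_measurable borel" and supp: "\<And>w. w < 144 / 100 \<Longrightarrow> \<psi> w = 0"
  shows "(\<integral>\<^sup>+t. (\<integral>\<^sup>+u. \<psi> (3 + 2 * cos t + 4 * cos (t / 2) * cos u) \<partial>T) \<partial>T) \<le> ennreal (24 * pi) * (\<integral>\<^sup>+w. \<psi> w \<partial>lborel)"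
proof -
  \<comment> \<open>The conditional density at w given X, where centre 3 + 2 cos t = X + 1 and
    squared radius 4X are expressed through X.\<close>
  define m where "m w X = (if (w - 1 - X)\<^sup>2 < 4 * X then 2 / sqrt (4 * X - (w - 1 - X)\<^sup>2) else 0)" for w X :: real
  have m_nonneg: "0 \<le> m w X" for w X by (simp add: m_def)
  have m_meas [measurable]: "(\<lambda>p. m (fst p) (snd p)) \<in> borel_measurable (borel \<Otimes>\<^sub>M borel)"
    unfolding m_def by measurable
  have m_meas1 [measurable]: "m w \<in> borel_measurable borel" for w
    unfolding m_def[abs_def] by measurable
  have dens: "arcsine_density (3 + 2 * cos t) (4 * cos (t / 2)) w = m w (2 + 2 * cos t)" for t w
  proof -
    have "cos t = 2 * (cos (t / 2))\<^sup>2 - 1" using cos_double_cos[of "t / 2"] by simp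
    then have b: "(4 * cos (t / 2))\<^sup>2 = 4 * (2 + 2 * cos t)" by (simp add: power_mult_distrib)
    have "\<bar>w - (3 + 2 * cos t)\<bar> < \<bar>4 * cos (t / 2)\<bar> \<longleftrightarrow> (w - (3 + 2 * cos t))\<^sup>2 < (4 * cos (t / 2))\<^sup>2"
      by (simp only: not_le[symmetric] abs_le_square_iff)
    also have "w - (3 + 2 * cos t) = w - 1 - (2 + 2 * cos t)" by simp
    finally show ?thesis unfolding arcsine_density_def m_def b by (simp add: algebra_simps)
  qed
  have bound: "(\<integral>\<^sup>+t. ennreal (m w (2 + 2 * cos t)) \<partial>T) \<le> ennreal (24 * pi)" if w: "144 / 100 \<le> w" for w
  proof -
    define b where "b = (4 - (sqrt w - 1)\<^sup>2) / 2"
    define a where "a = (4 + (sqrt w - 1)\<^sup>2) / 2"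
    have le: "m w X * arcsine_density 2 2 X \<le> 12 * arcsine_density a b X" for X
      using arcsine_product_bound[OF w, of X] arcsine_density_nonneg[of a b X]
      by (auto simp: m_def a_def b_def)
    have "(\<integral>\<^sup>+t. ennreal (m w (2 + 2 * cos t)) \<partial>T) = (\<integral>\<^sup>+X. ennreal (m w X) * ennreal (arcsine_density 2 2 X) \<partial>lborel)"
      by (rule nn_integral_cos) auto
    also have "\<dots> \<le> (\<integral>\<^sup>+X. ennreal 12 * ennreal (arcsine_density a b X) \<partial>lborel)"
    proof (rule nn_integral_mono)
      fix X
      show "ennreal (m w X) * ennreal (arcsine_density 2 2 X) \<le> ennreal 12 * ennreal (arcsine_density a b X)"
        using ennreal_leI[OF le[of X]] by (simp only: ennreal_mult m_nonneg arcsine_density_nonneg zero_le_numeral)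
    qed
    also have "\<dots> = ennreal 12 * (\<integral>\<^sup>+X. ennreal (arcsine_density a b X) \<partial>lborel)"
      by (rule nn_integral_cmult) measurable
    also have "\<dots> \<le> ennreal 12 * ennreal (2 * pi)"
    \<comment> \<open>For sqrt w = 3 the interval degenerates to a point and
      \<open>arcsine_density\<close> takes its default value 0.\<close>
    proof (cases "b = 0")
      case True
      then show ?thesis by (simp add: arcsine_density_def)
    next
      case False
      then show ?thesis by (simp add: arcsine_density_total)
    qed
    also have "\<dots> = ennreal (24 * pi)" by (subst ennreal_mult[symmetric]) auto
    finally show ?thesis .
  qed
  have "(\<integral>\<^sup>+t. (\<integral>\<^sup>+u. \<psi> (3 + 2 * cos t + 4 * cos (t / 2) * cos u) \<partial>T) \<partial>T) =
      (\<integral>\<^sup>+t. (\<integral>\<^sup>+w. \<psi> w * ennreal (m w (2 + 2 * cos t)) \<partial>lborel) \<partial>T)"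
    unfolding nn_integral_T[of "\<lambda>t. \<integral>\<^sup>+u. _ t u \<partial>T"] nn_integral_T[of "\<lambda>t. \<integral>\<^sup>+w. _ t w \<partial>lborel"]
  proof (rule nn_integral_cong_AE)
    show "AE t in lborel. (\<integral>\<^sup>+u. \<psi> (3 + 2 * cos t + 4 * cos (t / 2) * cos u) \<partial>T) * indicator {0..<2 * pi} t =
        (\<integral>\<^sup>+w. \<psi> w * ennreal (m w (2 + 2 * cos t)) \<partial>lborel) * indicator {0..<2 * pi} t"
      using AE_lborel_singleton[of pi]
    proof eventually_elim
      \<comment> \<open>At t = pi two of the points cancel and the length no longer depends on u, so
        \<open>nn_integral_cos\<close> does not apply.\<close>
      fix t assume "t \<noteq> pi"
      show "(\<integral>\<^sup>+u. \<psi> (3 + 2 * cos t + 4 * cos (t / 2) * cos u) \<partial>T) * indicator {0..<2 * pi} t =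
        (\<integral>\<^sup>+w. \<psi> w * ennreal (m w (2 + 2 * cos t)) \<partial>lborel) * indicator {0..<2 * pi} t"
      proof (cases "t \<in> {0..<2 * pi}")
        case True
        have "cos (t / 2) \<noteq> 0"
        proof
          assume "cos (t / 2) = 0"
          then have "cos (t / 2) = cos (pi / 2)" by simp
          moreover have "0 \<le> t / 2" "t / 2 \<le> pi" "0 \<le> pi / 2" "pi / 2 \<le> pi" using True by auto
          ultimately have "t / 2 = pi / 2" using cos_inj_pi by blast
          then show False using \<open>t \<noteq> pi\<close> by simp
        qed
        then show ?thesis
          using nn_integral_cos[of \<psi> "4 * cos (t / 2)" "3 + 2 * cos t"] by (simp add: dens)
      qed simp
    qed
  qed
  also have "\<dots> = (\<integral>\<^sup>+w. (\<integral>\<^sup>+t. \<psi> w * ennreal (m w (2 + 2 * cos t)) \<partial>T) \<partial>lborel)"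
    unfolding nn_integral_T
  proof -
    have [measurable]: "(\<lambda>p. m (snd p) (2 + 2 * cos (fst p))) \<in> borel_measurable (borel \<Otimes>\<^sub>M borel)"
      using measurable_compose[of "\<lambda>p. (snd p, 2 + 2 * cos (fst p))" "borel \<Otimes>\<^sub>M borel", OF _ m_meas] by simp
    have "(\<integral>\<^sup>+t. (\<integral>\<^sup>+w. \<psi> w * ennreal (m w (2 + 2 * cos t)) \<partial>lborel) * indicator {0..<2 * pi} t \<partial>lborel) =
       (\<integral>\<^sup>+t. (\<integral>\<^sup>+w. \<psi> w * ennreal (m w (2 + 2 * cos t)) * indicator {0..<2 * pi} t \<partial>lborel) \<partial>lborel)"
    proof (rule nn_integral_cong)
      fix t
      have [measurable]: "(\<lambda>w. m w (2 + 2 * cos t)) \<in> borel_measurable borel"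
        unfolding m_def by measurable
      show "(\<integral>\<^sup>+w. \<psi> w * ennreal (m w (2 + 2 * cos t)) \<partial>lborel) * indicator {0..<2 * pi} t =
        (\<integral>\<^sup>+w. \<psi> w * ennreal (m w (2 + 2 * cos t)) * indicator {0..<2 * pi} t \<partial>lborel)"
        by (rule nn_integral_multc[symmetric]) measurable
    qed
    also have "\<dots> = (\<integral>\<^sup>+w. (\<integral>\<^sup>+t. \<psi> w * ennreal (m w (2 + 2 * cos t)) * indicator {0..<2 * pi} t \<partial>lborel) \<partial>lborel)"
      by (intro lborel_pair.Fubini'[symmetric]) (simp add: split_beta')
    finally show "(\<integral>\<^sup>+t. (\<integral>\<^sup>+w. \<psi> w * ennreal (m w (2 + 2 * cos t)) \<partial>lborel) * indicator {0..<2 * pi} t \<partial>lborel) =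
       (\<integral>\<^sup>+w. (\<integral>\<^sup>+t. \<psi> w * ennreal (m w (2 + 2 * cos t)) * indicator {0..<2 * pi} t \<partial>lborel) \<partial>lborel)" .
  qed
  also have "\<dots> \<le> (\<integral>\<^sup>+w. ennreal (24 * pi) * \<psi> w \<partial>lborel)"
  proof (rule nn_integral_mono)
    fix w
    have "(\<integral>\<^sup>+t. \<psi> w * ennreal (m w (2 + 2 * cos t)) \<partial>T) = \<psi> w * (\<integral>\<^sup>+t. ennreal (m w (2 + 2 * cos t)) \<partial>T)"
      by (rule nn_integral_cmult) measurable
    also have "\<dots> \<le> \<psi> w * ennreal (24 * pi)"
      using bound[of w] supp[of w] by (cases "w < 144 / 100") (auto intro!: mult_left_mono)
    finally show "(\<integral>\<^sup>+t. \<psi> w * ennreal (m w (2 + 2 * cos t)) \<partial>T) \<le> ennreal (24 * pi) * \<psi> w"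
      by (simp add: mult.commute)
  qed
  also have "\<dots> = ennreal (24 * pi) * (\<integral>\<^sup>+w. \<psi> w \<partial>lborel)"
    by (rule nn_integral_cmult) measurable
  finally show ?thesis .
qed

lemma norm_circ_sum_sq: "(norm (circ t + circ u + circ 0))\<^sup>2 = 3 + 2 * cos t + 2 * cos u + 2 * cos (t - u)"
proof -
  have "(norm (circ t + circ u + circ 0))\<^sup>2 = (cos t + cos u + 1)\<^sup>2 + (sin t + sin u)\<^sup>2"
    by (simp add: norm_vec2_sq)
  also have "\<dots> = ((sin t)\<^sup>2 + (cos t)\<^sup>2) + ((sin u)\<^sup>2 + (cos u)\<^sup>2) + 1 + 2 * cos t + 2 * cos u + 2 * cos (t - u)"
    unfolding cos_diff by algebra
  finally show ?thesis by simp
qed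

lemma nn_integral_T_cong_shift:
  fixes f g :: "real \<Rightarrow> ennreal"
  assumes "g \<in> borel_measurable borel" "periodic g" "\<And>t. f t = g (t + a)"
  shows "(\<integral>\<^sup>+t. f t \<partial>T) = (\<integral>\<^sup>+t. g t \<partial>T)"
  using nn_integral_T_shift[OF assms(1,2), of a] assms(3) by simp

text \<open>A common rotation moves the third point to angle 0 and makes the inner integral an orbit
  average that depends only on the length of the sum. The squared length is handled by
  \<open>length_sq_density\<close>, and polar coordinates lead back to the plane.\<close>

lemma circ3_density:
  assumes [measurable]: "k \<in> borel_measurable borel"
  shows "(\<integral>\<^sup>+t. (\<integral>\<^sup>+u. (\<integral>\<^sup>+v. k (circ t + circ u + circ v) * indicator {x. 144 / 100 \<le> (norm x)\<^sup>2} (circ t + circ u + circ v) \<partial>T) \<partial>T) \<partial>T)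
    \<le> ennreal (48 * pi) * (\<integral>\<^sup>+x. k x \<partial>lborel)"
proof -
  define K where "K x = k x * indicator {x. 144 / 100 \<le> (norm x)\<^sup>2} x" for x
  have [measurable]: "K \<in> borel_measurable borel" unfolding K_def[abs_def] by measurable
  define q where "q t u = circ t + circ u + circ 0" for t u
  define P where "P z = (\<integral>\<^sup>+a. K ((2 * sqrt z) *\<^sub>R circ a) \<partial>T)" for z
  have [measurable]: "P \<in> borel_measurable borel"
    unfolding P_def[abs_def] nn_integral_T by measurable
  define \<psi> where "\<psi> w = P (w / 4) * indicator {0..} w" for w
  have [measurable]: "\<psi> \<in> borel_measurable borel" unfolding \<psi>_def[abs_def] by measurable
  have supp: "\<psi> w = 0" if "w < 144 / 100" for w
  proof (cases "0 \<le> w")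
    case True
    then have "K ((2 * sqrt (w / 4)) *\<^sub>R circ a) = 0" for a
      using that by (simp add: K_def power_mult_distrib)
    then show ?thesis by (simp add: \<psi>_def P_def)
  qed (simp add: \<psi>_def)
  have rotq: "circ (t + v) + circ (u + v) + circ v = rot v (q t u)" for t u v
    using linear_add[OF linear_rot[of v]] rot_circ[of v 1] by (simp add: q_def add.commute)
  have "(\<integral>\<^sup>+t. (\<integral>\<^sup>+u. (\<integral>\<^sup>+v. K (circ t + circ u + circ v) \<partial>T) \<partial>T) \<partial>T) =
      (\<integral>\<^sup>+t. (\<integral>\<^sup>+v. (\<integral>\<^sup>+u. K (circ t + circ u + circ v) \<partial>T) \<partial>T) \<partial>T)"
    by (intro nn_integral_cong nn_integral_T_swap) measurable
  also have "\<dots> = (\<integral>\<^sup>+v. (\<integral>\<^sup>+t. (\<integral>\<^sup>+u. K (circ t + circ u + circ v) \<partial>T) \<partial>T) \<partial>T)"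
    unfolding nn_integral_T[of "\<lambda>u. K (_ + circ u + _)"] by (rule nn_integral_T_swap) measurable
  also have "\<dots> = (\<integral>\<^sup>+v. (\<integral>\<^sup>+t. (\<integral>\<^sup>+u. K (rot v (q t u)) \<partial>T) \<partial>T) \<partial>T)"
  proof (rule nn_integral_cong)
    fix v
    have "(\<integral>\<^sup>+t. (\<integral>\<^sup>+u. K (circ t + circ u + circ v) \<partial>T) \<partial>T) = (\<integral>\<^sup>+t. (\<integral>\<^sup>+u. K (circ (t + v) + circ u + circ v) \<partial>T) \<partial>T)"
    proof (rule nn_integral_T_cong_shift[symmetric, where a = v])
      show "(\<lambda>t. \<integral>\<^sup>+u. K (circ t + circ u + circ v) \<partial>T) \<in> borel_measurable borel"
        unfolding nn_integral_T by measurable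
    qed (simp_all add: periodic_def)
    also have "\<dots> = (\<integral>\<^sup>+t. (\<integral>\<^sup>+u. K (circ (t + v) + circ (u + v) + circ v) \<partial>T) \<partial>T)"
      by (rule nn_integral_cong, rule nn_integral_T_cong_shift[symmetric, where a = v]) (simp_all add: periodic_def)
    finally show "(\<integral>\<^sup>+t. (\<integral>\<^sup>+u. K (circ t + circ u + circ v) \<partial>T) \<partial>T) = (\<integral>\<^sup>+t. (\<integral>\<^sup>+u. K (rot v (q t u)) \<partial>T) \<partial>T)"
      unfolding rotq .
  qed
  also have "\<dots> = (\<integral>\<^sup>+t. (\<integral>\<^sup>+v. (\<integral>\<^sup>+u. K (circ (t + v) + circ (u + v) + circ v) \<partial>T) \<partial>T) \<partial>T)"
    unfolding rotq[symmetric] nn_integral_T[of "\<lambda>u. K (circ (_ + _) + circ (u + _) + circ _)"]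
    by (rule nn_integral_T_swap) measurable
  also have "\<dots> = (\<integral>\<^sup>+t. (\<integral>\<^sup>+u. (\<integral>\<^sup>+v. K (circ (t + v) + circ (u + v) + circ v) \<partial>T) \<partial>T) \<partial>T)"
    by (intro nn_integral_cong nn_integral_T_swap) measurable
  also have "\<dots> = (\<integral>\<^sup>+t. (\<integral>\<^sup>+u. \<psi> ((norm (q t u))\<^sup>2) \<partial>T) \<partial>T)"
    unfolding rotq by (intro nn_integral_cong) (simp add: nn_integral_rot_orbit \<psi>_def P_def real_sqrt_divide)
  also have "\<dots> = (\<integral>\<^sup>+t. (\<integral>\<^sup>+u. \<psi> (3 + 2 * cos t + 2 * cos u + 2 * cos (t - u)) \<partial>T) \<partial>T)"
    unfolding q_def norm_circ_sum_sq ..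
  also have "\<dots> = (\<integral>\<^sup>+u. (\<integral>\<^sup>+t. \<psi> (3 + 2 * cos t + 2 * cos u + 2 * cos (t - u)) \<partial>T) \<partial>T)"
    by (rule nn_integral_T_swap) measurable
  \<comment> \<open>Translating t by u makes t the angle between the first two points.\<close>
  also have "\<dots> = (\<integral>\<^sup>+u. (\<integral>\<^sup>+t. \<psi> (3 + 2 * cos (t + u) + 2 * cos u + 2 * cos t) \<partial>T) \<partial>T)"
  proof (rule nn_integral_cong)
    fix u
    have "t + 2 * pi - u = (t - u) + 2 * pi" for t by simp
    then have per: "periodic (\<lambda>t. \<psi> (3 + 2 * cos t + 2 * cos u + 2 * cos (t - u)))"
      unfolding periodic_def by (simp only: cos_periodic) simp
    show "(\<integral>\<^sup>+t. \<psi> (3 + 2 * cos t + 2 * cos u + 2 * cos (t - u)) \<partial>T) =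
        (\<integral>\<^sup>+t. \<psi> (3 + 2 * cos (t + u) + 2 * cos u + 2 * cos t) \<partial>T)"
      by (rule nn_integral_T_cong_shift[OF _ per, where a = u, symmetric]) simp_all
  qed
  also have "\<dots> = (\<integral>\<^sup>+t. (\<integral>\<^sup>+u. \<psi> (3 + 2 * cos (t + u) + 2 * cos u + 2 * cos t) \<partial>T) \<partial>T)"
    by (rule nn_integral_T_swap) measurable
  also have "\<dots> = (\<integral>\<^sup>+t. (\<integral>\<^sup>+u. \<psi> (3 + 2 * cos t + 4 * cos (t / 2) * cos u) \<partial>T) \<partial>T)"
  proof (rule nn_integral_cong)
    fix t
    have per: "periodic (\<lambda>u. \<psi> (3 + 2 * cos t + 4 * cos (t / 2) * cos u))"
      by (simp add: periodic_def)
    \<comment> \<open>The two points with angle t between them add up to a vector of length 2 |cos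
      (t/2)| in the direction u + t/2, possibly reversed.\<close>
    have eq: "3 + 2 * cos (t + u) + 2 * cos u + 2 * cos t = 3 + 2 * cos t + 4 * cos (t / 2) * cos (u + t / 2)" for u
    proof -
      have "cos (t + u) + cos u = 2 * cos (u + t / 2) * cos (t / 2)"
        using cos_plus_cos[of "t + u" u] by (simp add: add_divide_distrib add.commute)
      then show ?thesis by (simp add: algebra_simps)
    qed
    show "(\<integral>\<^sup>+u. \<psi> (3 + 2 * cos (t + u) + 2 * cos u + 2 * cos t) \<partial>T) =
        (\<integral>\<^sup>+u. \<psi> (3 + 2 * cos t + 4 * cos (t / 2) * cos u) \<partial>T)"
      by (rule nn_integral_T_cong_shift[OF _ per, where a = "t / 2"]) (simp_all only: eq, measurable)
  qed
  also have "\<dots> \<le> ennreal (24 * pi) * (\<integral>\<^sup>+w. \<psi> w \<partial>lborel)"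
    by (rule length_sq_density) (simp_all add: supp)
  \<comment> \<open>With w = 4z the factor 4 splits as 2 * 2, one of which belongs to
    \<open>nn_integral_polar\<close>; hence 48 pi.\<close>
  also have "(\<integral>\<^sup>+w. \<psi> w \<partial>lborel) = ennreal \<bar>4\<bar> * (\<integral>\<^sup>+z. \<psi> (0 + 4 * z) \<partial>lborel)"
    by (rule nn_integral_real_affine) auto
  also have "\<dots> = 2 * (2 * (\<integral>\<^sup>+z. P z * indicator {0..} z \<partial>lborel))"
    by (simp add: \<psi>_def indicator_def flip: mult.assoc)
  also have "2 * (\<integral>\<^sup>+z. P z * indicator {0..} z \<partial>lborel) = (\<integral>\<^sup>+x. K x \<partial>lborel)"
    unfolding P_def by (rule nn_integral_polar[symmetric]) measurable
  also have "ennreal (24 * pi) * (2 * (\<integral>\<^sup>+x. K x \<partial>lborel)) = ennreal (48 * pi) * (\<integral>\<^sup>+x. K x \<partial>lborel)"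
  proof -
    have "ennreal (48 * pi) = ennreal (24 * pi) * ennreal 2"
      by (subst ennreal_mult[symmetric]) auto
    then show ?thesis by (simp only: mult.assoc ennreal_numeral)
  qed
  also have "\<dots> \<le> ennreal (48 * pi) * (\<integral>\<^sup>+x. k x \<partial>lborel)"
    by (intro mult_left_mono nn_integral_mono) (auto simp: K_def indicator_def)
  finally show ?thesis unfolding K_def .
qed

section \<open>The Tomas-Stein inequality\<close>

abbreviation T3 :: "(real \<times> real \<times> real) measure" where
  "T3 \<equiv> T \<Otimes>\<^sub>M (T \<Otimes>\<^sub>M T)"

definition circ3 :: "real \<times> real \<times> real \<Rightarrow> real^2" where
  "circ3 p = circ (fst p) + circ2 (snd p)"

interpretation T3: pair_sigma_finite T "T \<Otimes>\<^sub>M T" ..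

interpretation T6: pair_sigma_finite T3 T3 ..

lemma sigma_finite_T6: "sigma_finite_measure (T3 \<Otimes>\<^sub>M T3)"
  by (rule T6.sigma_finite_measure_axioms)

interpretation T2: finite_measure "T \<Otimes>\<^sub>M T"
  by (intro finite_measure_pair_measure T.finite_measure_axioms)

interpretation T3: finite_measure T3
  by (intro finite_measure_pair_measure T.finite_measure_axioms)

lemma circ3_measurable [measurable]: "circ3 \<in> borel_measurable T3"
  unfolding circ3_def[abs_def] by measurable

definition tensor3 :: "(real \<Rightarrow> 'a::comm_monoid_mult) \<Rightarrow> (real \<Rightarrow> 'a) \<Rightarrow> (real \<Rightarrow> 'a) \<Rightarrow> real \<times> real \<times> real \<Rightarrow> 'a" where
  "tensor3 a b c p = a (fst p) * (b (fst (snd p)) * c (snd (snd p)))"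

lemma tensor3_integrable:
  fixes a b c :: "real \<Rightarrow> 'a::{real_normed_field, banach, second_countable_topology}"
  assumes "integrable T a" "integrable T b" "integrable T c"
  shows "integrable T3 (tensor3 a b c)"
    and "(\<integral>p. tensor3 a b c p \<partial>T3) = (\<integral>t. a t \<partial>T) * ((\<integral>t. b t \<partial>T) * (\<integral>t. c t \<partial>T))"
proof -
  note bc = TT.integrable_pair_mult[OF assms(2,3)]
  show "integrable T3 (tensor3 a b c)"
    unfolding tensor3_def[abs_def] by (rule T3.integrable_pair_mult(1)[OF assms(1) bc(1)])
  show "(\<integral>p. tensor3 a b c p \<partial>T3) = (\<integral>t. a t \<partial>T) * ((\<integral>t. b t \<partial>T) * (\<integral>t. c t \<partial>T))"
    unfolding tensor3_def[abs_def] T3.integrable_pair_mult(2)[OF assms(1) bc(1)] bc(2) ..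
qed

lemma ext_tensor3:
  assumes "integrable T a" "integrable T b" "integrable T c"
  shows "ext T3 circ3 (tensor3 a b c) x = circle_ext a x * (circle_ext b x * circle_ext c x)"
  unfolding tensor3_def[abs_def] circ3_def[abs_def]
    T3.ext_pair_mult[OF assms(1) TT.integrable_pair_mult(1)[OF assms(2,3)] circ_measurable_T circ2_measurable]
    ext_pair[OF assms(2,3)] ..

lemma gauss_hat_bounded: "e > 0 \<Longrightarrow> gauss_hat e x \<le> 2 * pi / e\<^sup>2"
  unfolding gauss_hat_def by (intro mult_left_le) auto

text \<open>A smoothed convolution evaluated at frequency 0: the integral of a product of two
  extensions against \<open>gauss e\<close> is an integral over pairs of triples against
  \<open>gauss_hat e\<close> of the total sum.\<close>

lemma sextic_pairing:
  assumes e: "e > 0" and a: "integrable T3 a" and b: "integrable T3 b"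
  shows "(\<integral>p. a (fst p) * b (snd p) * complex_of_real (gauss_hat e (circ3 (fst p) + circ3 (snd p))) \<partial>(T3 \<Otimes>\<^sub>M T3)) =
     (\<integral>x. ext T3 circ3 a x * ext T3 circ3 b x * complex_of_real (gauss e x) \<partial>lborel)"
    and "integrable lborel (\<lambda>x. ext T3 circ3 a x * ext T3 circ3 b x * complex_of_real (gauss e x))"
proof -
  let ?s = "\<lambda>p. circ3 (fst p) + circ3 (snd p)"
  have ab: "integrable (T3 \<Otimes>\<^sub>M T3) (\<lambda>p. a (fst p) * b (snd p))"
    by (rule T6.integrable_pair_mult(1)[OF a b])
  have s: "?s \<in> borel_measurable (T3 \<Otimes>\<^sub>M T3)" by measurable
  have x: "ext (T3 \<Otimes>\<^sub>M T3) ?s (\<lambda>p. a (fst p) * b (snd p)) x = ext T3 circ3 a x * ext T3 circ3 b x" for x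
    by (rule T6.ext_pair_mult[OF a b]) measurable
  note ft = ft_ext_mult(1)[OF sigma_finite_T6 ab s gauss_ft(1)[OF e], of 0]
  show "(\<integral>p. a (fst p) * b (snd p) * complex_of_real (gauss_hat e (?s p)) \<partial>(T3 \<Otimes>\<^sub>M T3)) =
     (\<integral>x. ext T3 circ3 a x * ext T3 circ3 b x * complex_of_real (gauss e x) \<partial>lborel)"
    using ft unfolding x gauss_ft(2)[OF e] by (simp add: ft_def)
  show "integrable lborel (\<lambda>x. ext T3 circ3 a x * ext T3 circ3 b x * complex_of_real (gauss e x))"
    using ext_mult_integrable[OF sigma_finite_T6 ab s gauss_ft(1)[OF e]] unfolding x .
qed

text \<open>Nonnegativity of the variance of f.\<close>

lemma integral_T_square_le:
  fixes f :: "real \<Rightarrow> real"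
  assumes f: "integrable T f" "integrable T (\<lambda>t. (f t)\<^sup>2)"
  shows "(\<integral>t. f t \<partial>T)\<^sup>2 \<le> 2 * pi * (\<integral>t. (f t)\<^sup>2 \<partial>T)"
proof -
  define m where "m = (\<integral>t. f t \<partial>T)"
  have "0 \<le> (\<integral>t. (f t - m / (2 * pi))\<^sup>2 \<partial>T)" by (intro Bochner_Integration.integral_nonneg) simp
  also have "(\<integral>t. (f t - m / (2 * pi))\<^sup>2 \<partial>T) = (\<integral>t. (f t)\<^sup>2 + ((- (m / pi)) * f t + (m / (2 * pi))\<^sup>2) \<partial>T)"
    by (intro Bochner_Integration.integral_cong) (simp_all add: power2_eq_square field_simps)
  also have "\<dots> = (\<integral>t. (f t)\<^sup>2 \<partial>T) + ((- (m / pi)) * m + 2 * pi * (m / (2 * pi))\<^sup>2)"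
    using f measure_T by (simp add: m_def)
  also have "\<dots> = (\<integral>t. (f t)\<^sup>2 \<partial>T) - m\<^sup>2 / (2 * pi)" by (simp add: power2_eq_square field_simps)
  finally show ?thesis by (simp add: m_def field_simps)
qed

section \<open>The inequality for an antipodally symmetric function\<close>

text \<open>The scale e is fixed once, and the final constant does not depend on it. Nonnegativity
  of h makes the pairing monotone in its weight; antipodal symmetry makes the extension
  real.\<close>

locale tomas_stein =
  fixes h :: "real \<Rightarrow> real" and e :: real
  assumes h_L2: "circle_L2 (\<lambda>t. complex_of_real (h t))"
    and h_nonneg: "\<And>t. 0 \<le> h t"
    and h_antipodal: "\<And>t. h (t + pi) = h t"
    and e_pos: "e > 0"
begin

lemma h_measurable [measurable]: "h \<in> borel_measurable borel"
proof -
  have "(\<lambda>t. Re (complex_of_real (h t))) \<in> borel_measurable borel"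
    using circle_L2_measurable[OF h_L2] by measurable
  then show ?thesis by simp
qed

lemma h_sq_integrable: "integrable T (\<lambda>t. (h t)\<^sup>2)"
  using circle_L2_integrable_sq[OF h_L2] by simp

lemma h_mult_integrable:
  assumes [measurable]: "g \<in> borel_measurable borel" and "\<And>t. \<bar>g t\<bar> \<le> 1"
  shows "integrable T (\<lambda>t. h t * g t)" "integrable T (\<lambda>t. complex_of_real (h t * g t))"
proof -
  have "integrable T h"
    by (rule integrable_T_of_square) (simp_all add: h_sq_integrable)
  then show "integrable T (\<lambda>t. h t * g t)"
  proof (rule Bochner_Integration.integrable_bound)
    show "(\<lambda>t. h t * g t) \<in> borel_measurable T" by (rule measurable_T) measurable
    show "AE t in T. norm (h t * g t) \<le> norm (h t)"
      using assms(2) by (intro AE_I2) (simp add: abs_mult mult_left_le)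
  qed
  then show "integrable T (\<lambda>t. complex_of_real (h t * g t))" by (rule integrable_of_real)
qed

definition H :: "real \<times> real \<times> real \<Rightarrow> real" where
  "H = tensor3 h h h"

definition K :: "(real \<times> real \<times> real) \<times> (real \<times> real \<times> real) \<Rightarrow> real" where
  "K p = gauss_hat e (circ3 (fst p) + circ3 (snd p))"

text \<open>As \<open>e \<rightarrow> 0\<close>, \<open>K\<close> concentrates on the six-tuples with sum 0.\<close>

definition J :: "(real^2 \<Rightarrow> real^2 \<Rightarrow> real) \<Rightarrow> real" where
  "J w = (\<integral>p. H (fst p) * H (snd p) * K p * w (circ3 (fst p)) (circ3 (snd p)) \<partial>(T3 \<Otimes>\<^sub>M T3))"

lemma K_measurable [measurable]: "K \<in> borel_measurable (T3 \<Otimes>\<^sub>M T3)"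
  unfolding K_def[abs_def] by measurable

lemma K_nonneg: "0 \<le> K p"
  by (simp add: K_def gauss_hat_nonneg)

lemma H_nonneg: "0 \<le> H p"
  by (simp add: H_def tensor3_def h_nonneg)

lemma h_integrable: "integrable T h"
  using h_mult_integrable(1)[of "\<lambda>_. 1"] by simp

lemma H_integrable: "integrable T3 H"
  unfolding H_def by (rule tensor3_integrable(1)[OF h_integrable h_integrable h_integrable])

lemma H_measurable [measurable]: "H \<in> borel_measurable T3"
  using H_integrable by auto

lemma mult_K_integrable:
  fixes f :: "_ \<Rightarrow> real"
  assumes "integrable (T3 \<Otimes>\<^sub>M T3) f"
  shows "integrable (T3 \<Otimes>\<^sub>M T3) (\<lambda>p. f p * K p)"
proof (rule Bochner_Integration.integrable_bound)
  have [measurable]: "f \<in> borel_measurable (T3 \<Otimes>\<^sub>M T3)" using assms by auto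
  show "integrable (T3 \<Otimes>\<^sub>M T3) (\<lambda>p. f p * (2 * pi / e\<^sup>2))" using assms by simp
  show "(\<lambda>p. f p * K p) \<in> borel_measurable (T3 \<Otimes>\<^sub>M T3)" by measurable
  show "AE p in T3 \<Otimes>\<^sub>M T3. norm (f p * K p) \<le> norm (f p * (2 * pi / e\<^sup>2))"
  proof (rule AE_I2)
    fix p
    have "\<bar>K p\<bar> \<le> \<bar>2 * pi / e\<^sup>2\<bar>"
      using gauss_hat_bounded[OF e_pos] K_nonneg[of p] by (simp add: K_def)
    then show "norm (f p * K p) \<le> norm (f p * (2 * pi / e\<^sup>2))"
      unfolding real_norm_def abs_mult by (intro mult_left_mono) auto
  qed
qed

lemma norm_circ3_le: "norm (circ3 p) \<le> 3"
proof -
  have "norm (circ3 p) \<le> norm (circ (fst p)) + (norm (circ (fst (snd p))) + norm (circ (snd (snd p))))"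
    unfolding circ3_def circ2_def by (intro order_trans[OF norm_triangle_ineq] add_left_mono norm_triangle_ineq)
  then show ?thesis by simp
qed

lemma J_integrable:
  assumes [measurable]: "(\<lambda>p. w (fst p) (snd p)) \<in> borel_measurable (borel \<Otimes>\<^sub>M borel)"
    and B: "\<And>x y. norm x \<le> 3 \<Longrightarrow> norm y \<le> 3 \<Longrightarrow> \<bar>w x y\<bar> \<le> B"
  shows "integrable (T3 \<Otimes>\<^sub>M T3) (\<lambda>p. H (fst p) * H (snd p) * K p * w (circ3 (fst p)) (circ3 (snd p)))"
proof (rule Bochner_Integration.integrable_bound)
  have "integrable (T3 \<Otimes>\<^sub>M T3) (\<lambda>p. H (fst p) * H (snd p))"
    by (rule T6.integrable_pair_mult(1)[OF H_integrable H_integrable])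
  from mult_K_integrable[OF this] show "integrable (T3 \<Otimes>\<^sub>M T3) (\<lambda>p. H (fst p) * H (snd p) * K p * B)" by simp
  have [measurable]: "(\<lambda>p. w (circ3 (fst p)) (circ3 (snd p))) \<in> borel_measurable (T3 \<Otimes>\<^sub>M T3)"
  proof -
    have "(\<lambda>p. (circ3 (fst p), circ3 (snd p))) \<in> T3 \<Otimes>\<^sub>M T3 \<rightarrow>\<^sub>M borel \<Otimes>\<^sub>M borel" by measurable
    from measurable_compose[OF this assms(1)] show ?thesis by simp
  qed
  show "(\<lambda>p. H (fst p) * H (snd p) * K p * w (circ3 (fst p)) (circ3 (snd p))) \<in> borel_measurable (T3 \<Otimes>\<^sub>M T3)"
    by measurable
  show "AE p in T3 \<Otimes>\<^sub>M T3. norm (H (fst p) * H (snd p) * K p * w (circ3 (fst p)) (circ3 (snd p))) \<le> norm (H (fst p) * H (snd p) * K p * B)"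
  proof (rule AE_I2)
    fix p
    have "\<bar>w (circ3 (fst p)) (circ3 (snd p))\<bar> \<le> \<bar>B\<bar>"
      using B[OF norm_circ3_le norm_circ3_le, of "fst p" "snd p"] by linarith
    then show "norm (H (fst p) * H (snd p) * K p * w (circ3 (fst p)) (circ3 (snd p))) \<le> norm (H (fst p) * H (snd p) * K p * B)"
      unfolding real_norm_def abs_mult[of _ "w _ _"] abs_mult[of _ B] by (intro mult_left_mono) auto
  qed
qed

lemma J_mono:
  assumes [measurable]: "(\<lambda>p. w (fst p) (snd p)) \<in> borel_measurable (borel \<Otimes>\<^sub>M borel)"
    "(\<lambda>p. w' (fst p) (snd p)) \<in> borel_measurable (borel \<Otimes>\<^sub>M borel)"
    and B: "\<And>x y. norm x \<le> 3 \<Longrightarrow> norm y \<le> 3 \<Longrightarrow> \<bar>w x y\<bar> \<le> B"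
    "\<And>x y. norm x \<le> 3 \<Longrightarrow> norm y \<le> 3 \<Longrightarrow> \<bar>w' x y\<bar> \<le> B'"
    and le: "\<And>x y. norm x \<le> 3 \<Longrightarrow> norm y \<le> 3 \<Longrightarrow> w x y \<le> w' x y"
  shows "J w \<le> J w'"
  unfolding J_def
proof (rule integral_mono[OF J_integrable[of w B] J_integrable[of w' B']])
  fix p
  show "H (fst p) * H (snd p) * K p * w (circ3 (fst p)) (circ3 (snd p)) \<le>
     H (fst p) * H (snd p) * K p * w' (circ3 (fst p)) (circ3 (snd p))"
    using le[OF norm_circ3_le norm_circ3_le] by (intro mult_left_mono mult_nonneg_nonneg H_nonneg K_nonneg) auto
qed (use assms in auto)

lemma J_add:
  assumes "(\<lambda>p. w (fst p) (snd p)) \<in> borel_measurable (borel \<Otimes>\<^sub>M borel)"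
    "(\<lambda>p. w' (fst p) (snd p)) \<in> borel_measurable (borel \<Otimes>\<^sub>M borel)"
    and B: "\<And>x y. norm x \<le> 3 \<Longrightarrow> norm y \<le> 3 \<Longrightarrow> \<bar>w x y\<bar> \<le> B"
    "\<And>x y. norm x \<le> 3 \<Longrightarrow> norm y \<le> 3 \<Longrightarrow> \<bar>w' x y\<bar> \<le> B'"
  shows "J (\<lambda>x y. w x y + w' x y) = J w + J w'"
  unfolding J_def distrib_left
  by (rule Bochner_Integration.integral_add[OF J_integrable[of w B] J_integrable[of w' B']]) (use assms in auto)

section \<open>Moments of the sum of three points\<close>

definition hx :: "(real \<Rightarrow> real) \<Rightarrow> real^2 \<Rightarrow> complex" where
  "hx g = circle_ext (\<lambda>t. complex_of_real (h t * g t))"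

abbreviation "v \<equiv> hx (\<lambda>_. 1)"

lemma J_product:
  assumes "integrable T3 a" "integrable T3 b"
    and "\<And>p. a p = H p * f (circ3 p)" "\<And>p. b p = H p * g (circ3 p)"
  shows "complex_of_real (J (\<lambda>x y. f x * g y)) =
     (\<integral>x. ext T3 circ3 (\<lambda>p. complex_of_real (a p)) x * ext T3 circ3 (\<lambda>p. complex_of_real (b p)) x * complex_of_real (gauss e x) \<partial>lborel)"
    and "integrable lborel (\<lambda>x. ext T3 circ3 (\<lambda>p. complex_of_real (a p)) x * ext T3 circ3 (\<lambda>p. complex_of_real (b p)) x * complex_of_real (gauss e x))"
proof -
  have ab: "integrable T3 (\<lambda>p. complex_of_real (a p))" "integrable T3 (\<lambda>p. complex_of_real (b p))"
    by (rule integrable_of_real[OF assms(1)], rule integrable_of_real[OF assms(2)])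
  have "complex_of_real (J (\<lambda>x y. f x * g y)) =
     (\<integral>p. complex_of_real (a (fst p)) * complex_of_real (b (snd p)) * complex_of_real (gauss_hat e (circ3 (fst p) + circ3 (snd p))) \<partial>(T3 \<Otimes>\<^sub>M T3))"
    unfolding J_def integral_complex_of_real[symmetric] assms(3,4) K_def
    by (intro Bochner_Integration.integral_cong) (simp_all add: mult_ac)
  then show "complex_of_real (J (\<lambda>x y. f x * g y)) =
     (\<integral>x. ext T3 circ3 (\<lambda>p. complex_of_real (a p)) x * ext T3 circ3 (\<lambda>p. complex_of_real (b p)) x * complex_of_real (gauss e x) \<partial>lborel)"
    unfolding sextic_pairing(1)[OF e_pos ab] .
  show "integrable lborel (\<lambda>x. ext T3 circ3 (\<lambda>p. complex_of_real (a p)) x * ext T3 circ3 (\<lambda>p. complex_of_real (b p)) x * complex_of_real (gauss e x))"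
    by (rule sextic_pairing(2)[OF e_pos ab])
qed

lemma ext_tensor3_h:
  assumes [measurable]: "f \<in> borel_measurable borel" "g \<in> borel_measurable borel" "k \<in> borel_measurable borel"
    and b: "\<And>t. \<bar>f t\<bar> \<le> 1" "\<And>t. \<bar>g t\<bar> \<le> 1" "\<And>t. \<bar>k t\<bar> \<le> 1"
  shows "ext T3 circ3 (\<lambda>p. complex_of_real (tensor3 (\<lambda>t. h t * f t) (\<lambda>t. h t * g t) (\<lambda>t. h t * k t) p)) x = hx f x * (hx g x * hx k x)"
    and "integrable T3 (tensor3 (\<lambda>t. h t * f t) (\<lambda>t. h t * g t) (\<lambda>t. h t * k t))"
proof -
  have "(\<lambda>p. complex_of_real (tensor3 (\<lambda>t. h t * f t) (\<lambda>t. h t * g t) (\<lambda>t. h t * k t) p)) =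
     tensor3 (\<lambda>t. complex_of_real (h t * f t)) (\<lambda>t. complex_of_real (h t * g t)) (\<lambda>t. complex_of_real (h t * k t))"
    by (simp add: tensor3_def fun_eq_iff)
  then show "ext T3 circ3 (\<lambda>p. complex_of_real (tensor3 (\<lambda>t. h t * f t) (\<lambda>t. h t * g t) (\<lambda>t. h t * k t) p)) x = hx f x * (hx g x * hx k x)"
    using ext_tensor3[OF h_mult_integrable(2) h_mult_integrable(2) h_mult_integrable(2), OF assms(1) b(1) assms(2) b(2) assms(3) b(3)]
    by (simp add: hx_def)
  show "integrable T3 (tensor3 (\<lambda>t. h t * f t) (\<lambda>t. h t * g t) (\<lambda>t. h t * k t))"
    by (intro tensor3_integrable(1) h_mult_integrable(1) assms)
qed

text \<open>H times the sum of g over the three points; below, \<open>H2\<close> carries the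
  products over pairs. Both are written as sums of tensors so that their extensions factor into
  one-dimensional ones.\<close>

definition H1 :: "(real \<Rightarrow> real) \<Rightarrow> real \<times> real \<times> real \<Rightarrow> real" where
  "H1 g p = tensor3 (\<lambda>t. h t * g t) (\<lambda>t. h t * 1) (\<lambda>t. h t * 1) p + (tensor3 (\<lambda>t. h t * 1) (\<lambda>t. h t * g t) (\<lambda>t. h t * 1) p
    + tensor3 (\<lambda>t. h t * 1) (\<lambda>t. h t * 1) (\<lambda>t. h t * g t) p)"

definition H2 :: "(real \<Rightarrow> real) \<Rightarrow> real \<times> real \<times> real \<Rightarrow> real" where
  "H2 g p = tensor3 (\<lambda>t. h t * g t) (\<lambda>t. h t * g t) (\<lambda>t. h t * 1) p + (tensor3 (\<lambda>t. h t * 1) (\<lambda>t. h t * g t) (\<lambda>t. h t * g t) p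
    + tensor3 (\<lambda>t. h t * g t) (\<lambda>t. h t * 1) (\<lambda>t. h t * g t) p)"

lemma ext_H0: "ext T3 circ3 (\<lambda>p. complex_of_real (H p)) x = v x ^ 3"
  using ext_tensor3_h(1)[of "\<lambda>_. 1" "\<lambda>_. 1" "\<lambda>_. 1" x] by (simp add: H_def power3_eq_cube)

lemma ext_H12:
  assumes [measurable]: "g \<in> borel_measurable borel" and b: "\<And>t. \<bar>g t\<bar> \<le> 1"
  shows "ext T3 circ3 (\<lambda>p. complex_of_real (H1 g p)) x = 3 * v x ^ 2 * hx g x" "integrable T3 (H1 g)"
    "ext T3 circ3 (\<lambda>p. complex_of_real (H2 g p)) x = 3 * v x * hx g x ^ 2" "integrable T3 (H2 g)"
proof -
  have c: "(\<lambda>_::real. 1::real) \<in> borel_measurable borel" by simp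
  have one: "\<bar>(\<lambda>_::real. 1::real) t\<bar> \<le> 1" for t by simp
  note i1 = ext_tensor3_h[OF assms(1) c c b one one] and i2 = ext_tensor3_h[OF c assms(1) c one b one]
    and i3 = ext_tensor3_h[OF c c assms(1) one one b]
  note j1 = ext_tensor3_h[OF assms(1) assms(1) c b b one] and j2 = ext_tensor3_h[OF c assms(1) assms(1) one b b]
    and j3 = ext_tensor3_h[OF assms(1) c assms(1) b one b]
  show "integrable T3 (H1 g)" unfolding H1_def[abs_def]
    by (intro Bochner_Integration.integrable_add i1(2) i2(2) i3(2))
  show "integrable T3 (H2 g)" unfolding H2_def[abs_def]
    by (intro Bochner_Integration.integrable_add j1(2) j2(2) j3(2))
  show "ext T3 circ3 (\<lambda>p. complex_of_real (H1 g p)) x = 3 * v x ^ 2 * hx g x"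
    unfolding H1_def of_real_add
    by (subst ext_add, use i1(2) in simp, use i2(2) i3(2) in simp, measurable)
       (subst ext_add, use i2(2) in simp, use i3(2) in simp, measurable, simp only: i1(1) i2(1) i3(1), simp add: power2_eq_square)
  show "ext T3 circ3 (\<lambda>p. complex_of_real (H2 g p)) x = 3 * v x * hx g x ^ 2"
    unfolding H2_def of_real_add
    by (subst ext_add, use j1(2) in simp, use j2(2) j3(2) in simp, measurable)
       (subst ext_add, use j2(2) in simp, use j3(2) in simp, measurable, simp only: j1(1) j2(1) j3(1), simp add: power2_eq_square)
qed

lemma H1_sum: "H1 g p = H p * (g (fst p) + g (fst (snd p)) + g (snd (snd p)))"
  by (simp add: H1_def H_def tensor3_def algebra_simps)

lemma H12_square: "H1 (\<lambda>t. (g t)\<^sup>2) p + 2 * H2 g p = H p * (g (fst p) + g (fst (snd p)) + g (snd (snd p)))\<^sup>2"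
  by (simp add: H1_def H2_def H_def tensor3_def algebra_simps power2_eq_square)

lemma circ3_nth: "circ3 p $ 1 = cos (fst p) + cos (fst (snd p)) + cos (snd (snd p))"
  "circ3 p $ 2 = sin (fst p) + sin (fst (snd p)) + sin (snd (snd p))"
  by (simp_all add: circ3_def circ2_def)

lemma hx_cos_sin_sq: "hx (\<lambda>t. (cos t)\<^sup>2) x + hx (\<lambda>t. (sin t)\<^sup>2) x = v x"
proof -
  have "hx (\<lambda>t. (cos t)\<^sup>2) x + hx (\<lambda>t. (sin t)\<^sup>2) x =
     circle_ext (\<lambda>t. complex_of_real (h t * (cos t)\<^sup>2) + complex_of_real (h t * (sin t)\<^sup>2)) x"
    unfolding hx_def
    by (rule ext_add[symmetric]; (rule h_mult_integrable(2))?) (auto simp: abs_square_le_1)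
  also have "(\<lambda>t. complex_of_real (h t * (cos t)\<^sup>2) + complex_of_real (h t * (sin t)\<^sup>2)) = (\<lambda>t. complex_of_real (h t * 1))"
    by (intro HOL.ext) (simp only: of_real_add[symmetric] distrib_left[symmetric] sin_cos_squared_add2)
  finally show ?thesis by (simp add: hx_def)
qed

lemma J_nonneg: "(\<And>x y. 0 \<le> w x y) \<Longrightarrow> 0 \<le> J w"
  unfolding J_def by (intro Bochner_Integration.integral_nonneg mult_nonneg_nonneg H_nonneg K_nonneg)

lemma J_product_integrable:
  assumes "integrable T3 a" "integrable T3 b"
    and "\<And>p. a p = H p * f (circ3 p)" "\<And>p. b p = H p * g (circ3 p)"
  shows "integrable (T3 \<Otimes>\<^sub>M T3) (\<lambda>p. H (fst p) * H (snd p) * K p * (f (circ3 (fst p)) * g (circ3 (snd p))))"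
  using mult_K_integrable[OF T6.integrable_pair_mult(1)[OF assms(1,2)]] unfolding assms(3,4)
  by (simp add: mult_ac)

text \<open>Both sides expand into inner products, and by symmetry the
  average of \<open>\<omega>\<^sub>i \<bullet> \<omega>\<^sub>j\<close> is the same for all pairs \<open>i \<noteq> j\<close> among the six points.\<close>

lemma moment_identity:
  "5 * J (\<lambda>x y. (norm x)\<^sup>2) - 9 * J (\<lambda>x y. 1) = J (\<lambda>x y. (norm (x + y))\<^sup>2)"
proof -
  define ac as where "ac p = H1 (\<lambda>t. (cos t)\<^sup>2) p + 2 * H2 cos p" and "as p = H1 (\<lambda>t. (sin t)\<^sup>2) p + 2 * H2 sin p" for p
  have sq1: "\<bar>(cos t)\<^sup>2\<bar> \<le> 1" "\<bar>(sin t)\<^sup>2\<bar> \<le> 1" for t :: real by (auto simp: abs_square_le_1)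
  note xc = ext_H12[of cos, OF _ abs_cos_le_one, simplified] and xs = ext_H12[of sin, OF _ abs_sin_le_one, simplified]
  note xc2 = ext_H12[of "\<lambda>t. (cos t)\<^sup>2", OF _ sq1(1), simplified] and xs2 = ext_H12[of "\<lambda>t. (sin t)\<^sup>2", OF _ sq1(2), simplified]
  have ac: "integrable T3 ac" "\<And>p. ac p = H p * (circ3 p $ 1)\<^sup>2"
  proof -
    show "integrable T3 ac"
      unfolding ac_def[abs_def] by (intro Bochner_Integration.integrable_add integrable_mult_right xc2(2) xc(4))
    show "ac p = H p * (circ3 p $ 1)\<^sup>2" for p
      by (simp add: ac_def H12_square circ3_nth)
  qed
  have as: "integrable T3 as" "\<And>p. as p = H p * (circ3 p $ 2)\<^sup>2"
  proof -
    show "integrable T3 as"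
      unfolding as_def[abs_def] by (intro Bochner_Integration.integrable_add integrable_mult_right xs2(2) xs(4))
    show "as p = H p * (circ3 p $ 2)\<^sup>2" for p
      by (simp add: as_def H12_square circ3_nth)
  qed
  have bc: "integrable T3 (H1 cos)" "\<And>p. H1 cos p = H p * (circ3 p $ 1)"
  proof -
    show "integrable T3 (H1 cos)" by (rule xc(2))
    show "H1 cos p = H p * (circ3 p $ 1)" for p by (simp add: H1_sum circ3_nth)
  qed
  have bs: "integrable T3 (H1 sin)" "\<And>p. H1 sin p = H p * (circ3 p $ 2)"
  proof -
    show "integrable T3 (H1 sin)" by (rule xs(2))
    show "H1 sin p = H p * (circ3 p $ 2)" for p by (simp add: H1_sum circ3_nth)
  qed
  have one: "\<And>p. H p = H p * (\<lambda>_. 1) (circ3 p)" by simp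
  have ext_ac: "ext T3 circ3 (\<lambda>p. complex_of_real (ac p)) x = 3 * v x ^ 2 * hx (\<lambda>t. (cos t)\<^sup>2) x + 6 * v x * hx cos x ^ 2" for x
  proof -
    have "ext T3 circ3 (\<lambda>p. complex_of_real (ac p)) x =
      ext T3 circ3 (\<lambda>p. complex_of_real (H1 (\<lambda>t. (cos t)\<^sup>2) p)) x + ext T3 circ3 (\<lambda>p. 2 * complex_of_real (H2 cos p)) x"
      unfolding ac_def of_real_add of_real_mult of_real_numeral
      by (rule ext_add) (use xc2(2) xc(4) in auto)
    then show ?thesis unfolding ext_cmult xc2(1) xc(3) by simp
  qed
  have ext_as: "ext T3 circ3 (\<lambda>p. complex_of_real (as p)) x = 3 * v x ^ 2 * hx (\<lambda>t. (sin t)\<^sup>2) x + 6 * v x * hx sin x ^ 2" for x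
  proof -
    have "ext T3 circ3 (\<lambda>p. complex_of_real (as p)) x =
      ext T3 circ3 (\<lambda>p. complex_of_real (H1 (\<lambda>t. (sin t)\<^sup>2) p)) x + ext T3 circ3 (\<lambda>p. 2 * complex_of_real (H2 sin p)) x"
      unfolding as_def of_real_add of_real_mult of_real_numeral
      by (rule ext_add) (use xs2(2) xs(4) in auto)
    then show ?thesis unfolding ext_cmult xs2(1) xs(3) by simp
  qed
  let ?G = "\<lambda>x. complex_of_real (gauss e x)"
  define f0 where "f0 x = v x ^ 3 * v x ^ 3 * ?G x" for x
  define fc where "fc x = (3 * v x ^ 2 * hx (\<lambda>t. (cos t)\<^sup>2) x + 6 * v x * hx cos x ^ 2) * v x ^ 3 * ?G x" for x
  define fs where "fs x = (3 * v x ^ 2 * hx (\<lambda>t. (sin t)\<^sup>2) x + 6 * v x * hx sin x ^ 2) * v x ^ 3 * ?G x" for x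
  define gc where "gc x = 3 * v x ^ 2 * hx cos x * (3 * v x ^ 2 * hx cos x) * ?G x" for x
  define gs where "gs x = 3 * v x ^ 2 * hx sin x * (3 * v x ^ 2 * hx sin x) * ?G x" for x
  note p0 = J_product[OF H_integrable H_integrable one one, unfolded ext_H0, folded f0_def]
  note pc = J_product[OF ac(1) H_integrable ac(2) one, unfolded ext_H0 ext_ac, folded fc_def]
  note ps = J_product[OF as(1) H_integrable as(2) one, unfolded ext_H0 ext_as, folded fs_def]
  note qc = J_product[OF bc(1) bc(1) bc(2) bc(2), unfolded xc(1), folded gc_def]
  note qs = J_product[OF bs(1) bs(1) bs(2) bs(2), unfolded xs(1), folded gs_def]
  note pc' = J_product(1)[OF H_integrable ac(1) one ac(2), unfolded ext_H0 ext_ac]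
  note ps' = J_product(1)[OF H_integrable as(1) one as(2), unfolded ext_H0 ext_as]
  have J0: "complex_of_real (J (\<lambda>x y. 1)) = (\<integral>x. f0 x \<partial>lborel)" using p0(1) by simp
  have Jc: "complex_of_real (J (\<lambda>x y. (x $ 1)\<^sup>2)) = (\<integral>x. fc x \<partial>lborel)"
    "complex_of_real (J (\<lambda>x y. (x $ 2)\<^sup>2)) = (\<integral>x. fs x \<partial>lborel)"
    "complex_of_real (J (\<lambda>x y. (y $ 1)\<^sup>2)) = (\<integral>x. fc x \<partial>lborel)"
    "complex_of_real (J (\<lambda>x y. (y $ 2)\<^sup>2)) = (\<integral>x. fs x \<partial>lborel)"
    using pc(1) ps(1) pc' ps' by (simp_all add: fc_def fs_def mult_ac)
  have Jm: "complex_of_real (J (\<lambda>x y. x $ 1 * y $ 1)) = (\<integral>x. gc x \<partial>lborel)"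
    "complex_of_real (J (\<lambda>x y. x $ 2 * y $ 2)) = (\<integral>x. gs x \<partial>lborel)"
    using qc(1) qs(1) by simp_all
  \<comment> \<open>Both sides equal 18 v^4 ((hx cos)^2 + (hx sin)^2) times the Gaussian, because
    \<open>hx_cos_sin_sq\<close> makes the terms with squared cosines and sines cancel 9
    v^6.\<close>
  have point: "2 * gc x + 2 * gs x = 3 * fc x + 3 * fs x - 9 * f0 x" for x
  proof -
    have "3 * fc x + 3 * fs x - 9 * f0 x = 9 * v x ^ 5 * (hx (\<lambda>t. (cos t)\<^sup>2) x + hx (\<lambda>t. (sin t)\<^sup>2) x) * ?G x
       + 18 * v x ^ 4 * (hx cos x ^ 2 + hx sin x ^ 2) * ?G x - 9 * v x ^ 6 * ?G x"
      by (simp add: fc_def fs_def f0_def eval_nat_numeral algebra_simps)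
    then show ?thesis unfolding hx_cos_sin_sq
      by (simp add: gc_def gs_def eval_nat_numeral algebra_simps)
  qed
  have "(\<integral>x. 2 * gc x + 2 * gs x \<partial>lborel) = (\<integral>x. 3 * fc x + 3 * fs x - 9 * f0 x \<partial>lborel)"
    unfolding point ..
  then have "2 * (\<integral>x. gc x \<partial>lborel) + 2 * (\<integral>x. gs x \<partial>lborel) = 3 * (\<integral>x. fc x \<partial>lborel) + 3 * (\<integral>x. fs x \<partial>lborel) - 9 * (\<integral>x. f0 x \<partial>lborel)"
    using p0(2) pc(2) ps(2) qc(2) qs(2) by simp
  then have "complex_of_real (2 * J (\<lambda>x y. x $ 1 * y $ 1) + 2 * J (\<lambda>x y. x $ 2 * y $ 2)) =
     complex_of_real (3 * J (\<lambda>x y. (x $ 1)\<^sup>2) + 3 * J (\<lambda>x y. (x $ 2)\<^sup>2) - 9 * J (\<lambda>x y. 1))"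
    by (simp add: J0 Jc Jm)
  then have key: "2 * J (\<lambda>x y. x $ 1 * y $ 1) + 2 * J (\<lambda>x y. x $ 2 * y $ 2) =
     3 * J (\<lambda>x y. (x $ 1)\<^sup>2) + 3 * J (\<lambda>x y. (x $ 2)\<^sup>2) - 9 * J (\<lambda>x y. 1)"
    by (simp only: of_real_eq_iff)
  have sym: "J (\<lambda>x y. (y $ 1)\<^sup>2) = J (\<lambda>x y. (x $ 1)\<^sup>2)" "J (\<lambda>x y. (y $ 2)\<^sup>2) = J (\<lambda>x y. (x $ 2)\<^sup>2)"
    using Jc by (metis of_real_eq_iff)+
  note i1 = J_product_integrable[OF ac(1) H_integrable ac(2) one, simplified]
    and i2 = J_product_integrable[OF as(1) H_integrable as(2) one, simplified]
    and i3 = J_product_integrable[OF H_integrable ac(1) one ac(2), simplified]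
    and i4 = J_product_integrable[OF H_integrable as(1) one as(2), simplified]
    and i5 = J_product_integrable[OF bc(1) bc(1) bc(2) bc(2)]
    and i6 = J_product_integrable[OF bs(1) bs(1) bs(2) bs(2)]
  have E: "J (\<lambda>x y. (norm x)\<^sup>2) = J (\<lambda>x y. (x $ 1)\<^sup>2) + J (\<lambda>x y. (x $ 2)\<^sup>2)"
    unfolding J_def norm_vec2_sq distrib_left by (rule Bochner_Integration.integral_add[OF i1 i2])
  have pN: "a * (norm (x + y))\<^sup>2 = a * (x $ 1)\<^sup>2 + (a * (x $ 2)\<^sup>2 + (a * (y $ 1)\<^sup>2 + (a * (y $ 2)\<^sup>2 +
      (2 * (a * (x $ 1 * y $ 1)) + 2 * (a * (x $ 2 * y $ 2))))))" for a and x y :: "real^2"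
    by (simp only: norm_vec2_sq) (simp add: power2_eq_square algebra_simps)
  have N: "J (\<lambda>x y. (norm (x + y))\<^sup>2) = J (\<lambda>x y. (x $ 1)\<^sup>2) + (J (\<lambda>x y. (x $ 2)\<^sup>2) + (J (\<lambda>x y. (y $ 1)\<^sup>2) + (J (\<lambda>x y. (y $ 2)\<^sup>2) +
      (2 * J (\<lambda>x y. x $ 1 * y $ 1) + 2 * J (\<lambda>x y. x $ 2 * y $ 2)))))"
    unfolding J_def pN integral_mult_right_zero[symmetric]
    by (simp only: Bochner_Integration.integral_add Bochner_Integration.integrable_add integrable_mult_right i1 i2 i3 i4 i5 i6)
  show ?thesis unfolding E N sym using key by simp
qed

section \<open>Splitting near the singular circle\<close>

text \<open>The radii 1.3 and 1.2 are chosen with 1 < 1.2 < 1.3 and 1.3^2 = 1.69 < 9/5. If x + y is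
  small, a point x outside the larger radius forces y outside the smaller one.\<close>

definition far1 :: "real^2 \<Rightarrow> real" where "far1 x = indicator {x. 169 / 100 \<le> (norm x)\<^sup>2} x"
definition far2 :: "real^2 \<Rightarrow> real" where "far2 x = indicator {x. 144 / 100 \<le> (norm x)\<^sup>2} x"

lemma far_measurable [measurable]: "far1 \<in> borel_measurable borel" "far2 \<in> borel_measurable borel"
  unfolding far1_def[abs_def] far2_def[abs_def] by measurable

lemma far_bounds: "0 \<le> far1 x" "far1 x \<le> 1" "0 \<le> far2 x" "far2 x \<le> 1" "far1 x \<le> far2 x"
  by (auto simp: far1_def far2_def indicator_def)

text \<open>A Chebyshev argument. The moment identity and J (|x + y|^2) \<ge> 0 give 9 J(1) \<le> 5
  J(|x|^2), while |x|^2 \<le> 9 far1 + 1.69 on sums of three points. Hence (9 - 8.45) J(1) \<le> 45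
  J(far1), and 45 / 0.55 < 82.\<close>

lemma J_le_far: "J (\<lambda>x y. 1) \<le> 82 * J (\<lambda>x y. far1 x)"
proof -
  have "0 \<le> J (\<lambda>x y. (norm (x + y))\<^sup>2)" by (rule J_nonneg) simp
  then have 1: "9 * J (\<lambda>x y. 1) \<le> 5 * J (\<lambda>x y. (norm x)\<^sup>2)"
    using moment_identity by linarith
  have sq: "(norm x)\<^sup>2 \<le> 9" if "norm x \<le> 3" for x :: "real^2"
    using power_mono[OF that, of 2] by simp
  have i1: "integrable (T3 \<Otimes>\<^sub>M T3) (\<lambda>p. H (fst p) * H (snd p) * K p * (norm (circ3 (fst p)))\<^sup>2)"
    by (rule J_integrable[of "\<lambda>x y. (norm x)\<^sup>2" 9]) (use sq in auto)
  have i2: "integrable (T3 \<Otimes>\<^sub>M T3) (\<lambda>p. H (fst p) * H (snd p) * K p * far1 (circ3 (fst p)))"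
    by (rule J_integrable[of "\<lambda>x y. far1 x" 1]) (use far_bounds in auto)
  have i3: "integrable (T3 \<Otimes>\<^sub>M T3) (\<lambda>p. H (fst p) * H (snd p) * K p * 1)"
    by (rule J_integrable[of "\<lambda>x y. 1" 1]) auto
  have "J (\<lambda>x y. (norm x)\<^sup>2) \<le> (\<integral>p. 9 * (H (fst p) * H (snd p) * K p * far1 (circ3 (fst p))) +
      169 / 100 * (H (fst p) * H (snd p) * K p * 1) \<partial>(T3 \<Otimes>\<^sub>M T3))"
    unfolding J_def
  proof (rule integral_mono[OF i1])
    show "integrable (T3 \<Otimes>\<^sub>M T3) (\<lambda>p. 9 * (H (fst p) * H (snd p) * K p * far1 (circ3 (fst p))) +
      169 / 100 * (H (fst p) * H (snd p) * K p * 1))"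
      by (intro Bochner_Integration.integrable_add integrable_mult_right i2 i3)
    fix p :: "(real \<times> real \<times> real) \<times> (real \<times> real \<times> real)"
    have "(norm (circ3 (fst p)))\<^sup>2 \<le> 9 * far1 (circ3 (fst p)) + 169 / 100"
      using sq[OF norm_circ3_le, of "fst p"] by (auto simp: far1_def indicator_def)
    then have "H (fst p) * H (snd p) * K p * (norm (circ3 (fst p)))\<^sup>2 \<le> H (fst p) * H (snd p) * K p * (9 * far1 (circ3 (fst p)) + 169 / 100)"
      by (intro mult_left_mono mult_nonneg_nonneg H_nonneg K_nonneg)
    then show "H (fst p) * H (snd p) * K p * (norm (circ3 (fst p)))\<^sup>2 \<le>
      9 * (H (fst p) * H (snd p) * K p * far1 (circ3 (fst p))) + 169 / 100 * (H (fst p) * H (snd p) * K p * 1)"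
      by (simp add: algebra_simps)
  qed
  also have "\<dots> = 9 * J (\<lambda>x y. far1 x) + 169 / 100 * J (\<lambda>x y. 1)"
    unfolding J_def integral_mult_right_zero[symmetric]
    by (rule Bochner_Integration.integral_add; intro integrable_mult_right i2 i3)
  finally have "J (\<lambda>x y. (norm x)\<^sup>2) \<le> 9 * J (\<lambda>x y. far1 x) + 169 / 100 * J (\<lambda>x y. 1)" .
  moreover have "0 \<le> J (\<lambda>x y. far1 x)" by (rule J_nonneg) (simp add: far_bounds)
  ultimately show ?thesis using 1 by linarith
qed

text \<open>Away from the singular circle the density of the sum is at most 48 pi, and
  \<open>gauss_hat\<close> has mass 4 pi^2 wherever it is centred.\<close>

lemma truncated_bound: "(\<integral>y. far2 (circ3 y) * gauss_hat e (x + circ3 y) \<partial>T3) \<le> 192 * pi ^ 3"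
proof -
  define k where "k z = ennreal (gauss_hat e (x + z)) * indicator {z. 144 / 100 \<le> (norm z)\<^sup>2} z" for z
  have [measurable]: "k \<in> borel_measurable borel" unfolding k_def[abs_def] by measurable
  have int: "integrable T3 (\<lambda>y. far2 (circ3 y) * gauss_hat e (x + circ3 y))"
  proof (rule Bochner_Integration.integrable_bound)
    show "integrable T3 (\<lambda>y. 2 * pi / e\<^sup>2)" by simp
    show "(\<lambda>y. far2 (circ3 y) * gauss_hat e (x + circ3 y)) \<in> borel_measurable T3" by measurable
    show "AE y in T3. norm (far2 (circ3 y) * gauss_hat e (x + circ3 y)) \<le> norm (2 * pi / e\<^sup>2)"
    proof (rule AE_I2)
      fix y
      have "far2 (circ3 y) * gauss_hat e (x + circ3 y) \<le> 1 * (2 * pi / e\<^sup>2)"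
        by (intro mult_mono far_bounds gauss_hat_bounded e_pos gauss_hat_nonneg) auto
      then show "norm (far2 (circ3 y) * gauss_hat e (x + circ3 y)) \<le> norm (2 * pi / e\<^sup>2)"
        by (simp add: far_bounds gauss_hat_nonneg)
    qed
  qed
  have "ennreal (\<integral>y. far2 (circ3 y) * gauss_hat e (x + circ3 y) \<partial>T3) = (\<integral>\<^sup>+y. ennreal (far2 (circ3 y) * gauss_hat e (x + circ3 y)) \<partial>T3)"
    by (rule nn_integral_eq_integral[OF int, symmetric]) (simp add: far_bounds gauss_hat_nonneg)
  also have "\<dots> = (\<integral>\<^sup>+y. k (circ3 y) \<partial>T3)"
    by (intro nn_integral_cong) (simp add: k_def far2_def indicator_def)
  also have "\<dots> = (\<integral>\<^sup>+t. (\<integral>\<^sup>+q. k (circ3 (t, q)) \<partial>(T \<Otimes>\<^sub>M T)) \<partial>T)"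
    by (rule sigma_finite_measure.nn_integral_fst[OF sigma_finite_TT, symmetric]) measurable
  also have "\<dots> = (\<integral>\<^sup>+t. (\<integral>\<^sup>+u. (\<integral>\<^sup>+w. k (circ3 (t, u, w)) \<partial>T) \<partial>T) \<partial>T)"
    by (rule nn_integral_cong, rule sigma_finite_measure.nn_integral_fst[OF sigma_finite_T, symmetric]) measurable
  also have "\<dots> = (\<integral>\<^sup>+t. (\<integral>\<^sup>+u. (\<integral>\<^sup>+w. ennreal (gauss_hat e (x + (circ t + circ u + circ w))) *
      indicator {z. 144 / 100 \<le> (norm z)\<^sup>2} (circ t + circ u + circ w) \<partial>T) \<partial>T) \<partial>T)"
    by (simp add: k_def circ3_def circ2_def add.assoc)
  also have "\<dots> \<le> ennreal (48 * pi) * (\<integral>\<^sup>+z. ennreal (gauss_hat e (x + z)) \<partial>lborel)"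
    by (rule circ3_density) measurable
  also have "\<dots> = ennreal (192 * pi ^ 3)"
    unfolding gauss_hat_integral[OF e_pos] by (subst ennreal_mult[symmetric]) (auto simp: power2_eq_square power3_eq_cube)
  finally show ?thesis by (subst (asm) ennreal_le_iff) auto
qed

lemma H_sq_integral: "integrable T3 (\<lambda>p. (H p)\<^sup>2)" "(\<integral>p. (H p)\<^sup>2 \<partial>T3) = (\<integral>t. (h t)\<^sup>2 \<partial>T) ^ 3"
  "(\<integral>p. H p \<partial>T3) = (\<integral>t. h t \<partial>T) ^ 3"
proof -
  have eq: "(\<lambda>p. (H p)\<^sup>2) = tensor3 (\<lambda>t. (h t)\<^sup>2) (\<lambda>t. (h t)\<^sup>2) (\<lambda>t. (h t)\<^sup>2)"
    by (simp add: H_def tensor3_def fun_eq_iff power_mult_distrib)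
  show "integrable T3 (\<lambda>p. (H p)\<^sup>2)" "(\<integral>p. (H p)\<^sup>2 \<partial>T3) = (\<integral>t. (h t)\<^sup>2 \<partial>T) ^ 3"
    unfolding eq using tensor3_integrable[OF h_sq_integrable h_sq_integrable h_sq_integrable] by (auto simp: power3_eq_cube)
  show "(\<integral>p. H p \<partial>T3) = (\<integral>t. h t \<partial>T) ^ 3"
    unfolding H_def using tensor3_integrable(2)[OF h_integrable h_integrable h_integrable] by (simp add: power3_eq_cube)
qed

text \<open>A Schur test: H(p) H(q) is at most the mean of the squares, and in each half the kernel
  is integrated over the other variable by \<open>truncated_bound\<close>.\<close>

lemma J_far_far: "J (\<lambda>x y. far1 x * far2 y) \<le> 192 * pi ^ 3 * (\<integral>t. (h t)\<^sup>2 \<partial>T) ^ 3"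
proof -
  have one: "integrable T3 (\<lambda>_. 1::real)" by simp
  have a: "integrable (T3 \<Otimes>\<^sub>M T3) (\<lambda>p. (H (fst p))\<^sup>2 * (far2 (circ3 (snd p)) * K p))"
  proof -
    have "integrable T3 (\<lambda>y. far2 (circ3 y))"
      by (rule T3.integrable_const_bound[of _ 1]) (auto simp: far_bounds)
    from mult_K_integrable[OF T6.integrable_pair_mult(1)[OF H_sq_integral(1) this]]
    show ?thesis by (simp add: mult.assoc)
  qed
  have b: "integrable (T3 \<Otimes>\<^sub>M T3) (\<lambda>p. (H (snd p))\<^sup>2 * (far2 (circ3 (fst p)) * K p))"
  proof -
    have "integrable T3 (\<lambda>y. far2 (circ3 y))"
      by (rule T3.integrable_const_bound[of _ 1]) (auto simp: far_bounds)
    from mult_K_integrable[OF T6.integrable_pair_mult(1)[OF this H_sq_integral(1)]]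
    show ?thesis by (simp add: mult_ac)
  qed
  have bound: "(\<integral>x. (H x)\<^sup>2 * (\<integral>y. far2 (circ3 y) * gauss_hat e (circ3 x + circ3 y) \<partial>T3) \<partial>T3) \<le> 192 * pi ^ 3 * (\<integral>t. (h t)\<^sup>2 \<partial>T) ^ 3"
    if "integrable T3 (\<lambda>x. (H x)\<^sup>2 * (\<integral>y. far2 (circ3 y) * gauss_hat e (circ3 x + circ3 y) \<partial>T3))"
  proof -
    have "(\<integral>x. (H x)\<^sup>2 * (\<integral>y. far2 (circ3 y) * gauss_hat e (circ3 x + circ3 y) \<partial>T3) \<partial>T3) \<le> (\<integral>x. (H x)\<^sup>2 * (192 * pi ^ 3) \<partial>T3)"
      by (intro integral_mono that integrable_mult_left H_sq_integral(1) mult_left_mono truncated_bound) auto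
    also have "\<dots> = (\<integral>t. (h t)\<^sup>2 \<partial>T) ^ 3 * (192 * pi ^ 3)"
      unfolding integral_mult_left_zero H_sq_integral(2) ..
    finally show ?thesis by (simp only: mult.commute)
  qed
  have Ia: "(\<integral>p. (H (fst p))\<^sup>2 * (far2 (circ3 (snd p)) * K p) \<partial>(T3 \<Otimes>\<^sub>M T3)) \<le> 192 * pi ^ 3 * (\<integral>t. (h t)\<^sup>2 \<partial>T) ^ 3"
    using bound T6.integrable_fst'[OF a] T6.integral_fst'[OF a] by (simp add: K_def)
  have Ib: "(\<integral>p. (H (snd p))\<^sup>2 * (far2 (circ3 (fst p)) * K p) \<partial>(T3 \<Otimes>\<^sub>M T3)) \<le> 192 * pi ^ 3 * (\<integral>t. (h t)\<^sup>2 \<partial>T) ^ 3"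
  proof -
    have b': "integrable (T3 \<Otimes>\<^sub>M T3) (case_prod (\<lambda>x y. (H y)\<^sup>2 * (far2 (circ3 x) * K (x, y))))"
      using b by (simp add: split_beta')
    show ?thesis
      using bound T6.integrable_snd[OF b'] T6.integral_snd[OF b'] by (simp add: K_def split_beta' add.commute)
  qed
  have "J (\<lambda>x y. far1 x * far2 y) \<le> (\<integral>p. 1 / 2 * ((H (fst p))\<^sup>2 * (far2 (circ3 (snd p)) * K p)) + 1 / 2 * ((H (snd p))\<^sup>2 * (far2 (circ3 (fst p)) * K p)) \<partial>(T3 \<Otimes>\<^sub>M T3))"
    unfolding J_def
  proof (rule integral_mono)
    have "0 \<le> far1 x * far2 y" "far1 x * far2 y \<le> 1" for x y
      using far_bounds by (auto intro: mult_nonneg_nonneg mult_le_one)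
    then show "integrable (T3 \<Otimes>\<^sub>M T3) (\<lambda>p. H (fst p) * H (snd p) * K p * (far1 (circ3 (fst p)) * far2 (circ3 (snd p))))"
      by (intro J_integrable[of "\<lambda>x y. far1 x * far2 y" 1]) auto
    show "integrable (T3 \<Otimes>\<^sub>M T3) (\<lambda>p. 1 / 2 * ((H (fst p))\<^sup>2 * (far2 (circ3 (snd p)) * K p)) + 1 / 2 * ((H (snd p))\<^sup>2 * (far2 (circ3 (fst p)) * K p)))"
      by (intro Bochner_Integration.integrable_add integrable_mult_right a b)
    fix p :: "(real \<times> real \<times> real) \<times> (real \<times> real \<times> real)"
    define A B k f f' where "A = H (fst p)" and "B = H (snd p)" and "k = K p" and "f = far1 (circ3 (fst p)) * far2 (circ3 (snd p))" and "f' = far2 (circ3 (fst p))"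
    \<comment> \<open>Since \<open>far1\<close> \<le> \<open>far2\<close>, the cut-off can be placed
      on whichever variable is integrated first.\<close>
    have f: "0 \<le> f" "f \<le> far2 (circ3 (snd p))" "f \<le> f'"
      using far_bounds[of "circ3 (fst p)"] far_bounds[of "circ3 (snd p)"]
      unfolding f_def f'_def by (auto intro: mult_nonneg_nonneg mult_left_le_one_le order_trans[OF mult_left_le])
    have "A * B \<le> (A\<^sup>2 + B\<^sup>2) / 2" using sum_squares_bound[of A B] by simp
    then have "A * B * (k * f) \<le> (A\<^sup>2 + B\<^sup>2) / 2 * (k * f)"
      using f K_nonneg[of p] by (intro mult_right_mono) (auto simp: k_def)
    also have "\<dots> = 1 / 2 * (A\<^sup>2 * (f * k)) + 1 / 2 * (B\<^sup>2 * (f * k))" by (simp add: algebra_simps add_divide_distrib)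
    also have "\<dots> \<le> 1 / 2 * (A\<^sup>2 * (far2 (circ3 (snd p)) * k)) + 1 / 2 * (B\<^sup>2 * (f' * k))"
      using f K_nonneg[of p] by (intro add_mono mult_left_mono mult_right_mono) (auto simp: k_def)
    finally show "H (fst p) * H (snd p) * K p * (far1 (circ3 (fst p)) * far2 (circ3 (snd p))) \<le>
      1 / 2 * ((H (fst p))\<^sup>2 * (far2 (circ3 (snd p)) * K p)) + 1 / 2 * ((H (snd p))\<^sup>2 * (far2 (circ3 (fst p)) * K p))"
      by (simp add: A_def B_def k_def f_def f'_def mult.assoc)
  qed
  also have "\<dots> = 1 / 2 * (\<integral>p. (H (fst p))\<^sup>2 * (far2 (circ3 (snd p)) * K p) \<partial>(T3 \<Otimes>\<^sub>M T3)) + 1 / 2 * (\<integral>p. (H (snd p))\<^sup>2 * (far2 (circ3 (fst p)) * K p) \<partial>(T3 \<Otimes>\<^sub>M T3))"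
    unfolding integral_mult_right_zero[symmetric]
    by (rule Bochner_Integration.integral_add; intro integrable_mult_right a b)
  finally show ?thesis using Ia Ib by linarith
qed

text \<open>Where \<open>far1\<close> holds for x but \<open>far2\<close> fails for y, the radii
  differ by 0.1, so |x + y| \<ge> 0.1 and the kernel is at most 4 pi / 0.01 = 400 pi, uniformly in
  e.\<close>

lemma J_far: "J (\<lambda>x y. far1 x) \<le> J (\<lambda>x y. far1 x * far2 y) + 400 * pi * (\<integral>t. h t \<partial>T) ^ 6"
proof -
  have HH: "integrable (T3 \<Otimes>\<^sub>M T3) (\<lambda>p. H (fst p) * H (snd p))"
    by (rule T6.integrable_pair_mult(1)[OF H_integrable H_integrable])
  have "0 \<le> far1 x * far2 y" "far1 x * far2 y \<le> 1" for x y
    using far_bounds by (auto intro: mult_nonneg_nonneg mult_le_one)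
  then have i1: "integrable (T3 \<Otimes>\<^sub>M T3) (\<lambda>p. H (fst p) * H (snd p) * K p * (far1 (circ3 (fst p)) * far2 (circ3 (snd p))))"
    by (intro J_integrable[of "\<lambda>x y. far1 x * far2 y" 1]) auto
  have i2: "integrable (T3 \<Otimes>\<^sub>M T3) (\<lambda>p. H (fst p) * H (snd p) * K p * far1 (circ3 (fst p)))"
    by (rule J_integrable[of "\<lambda>x y. far1 x" 1]) (use far_bounds in auto)
  have "J (\<lambda>x y. far1 x) \<le> (\<integral>p. H (fst p) * H (snd p) * K p * (far1 (circ3 (fst p)) * far2 (circ3 (snd p))) + 400 * pi * (H (fst p) * H (snd p)) \<partial>(T3 \<Otimes>\<^sub>M T3))"
    unfolding J_def
  proof (rule integral_mono[OF i2])
    show "integrable (T3 \<Otimes>\<^sub>M T3) (\<lambda>p. H (fst p) * H (snd p) * K p * (far1 (circ3 (fst p)) * far2 (circ3 (snd p))) + 400 * pi * (H (fst p) * H (snd p)))"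
      by (intro Bochner_Integration.integrable_add integrable_mult_right i1 HH)
    fix p :: "(real \<times> real \<times> real) \<times> (real \<times> real \<times> real)"
    define x y where "x = circ3 (fst p)" and "y = circ3 (snd p)"
    have "K p * far1 x \<le> K p * (far1 x * far2 y) + 400 * pi"
    proof (cases "169 / 100 \<le> (norm x)\<^sup>2 \<and> (norm y)\<^sup>2 < 144 / 100")
      case True
      have "13 / 10 \<le> norm x" using True by (intro power2_le_imp_le[of "13/10"]) (auto simp: power_divide)
      moreover have "norm y < 12 / 10" using True by (intro power2_less_imp_less[of _ "12/10"]) (auto simp: power_divide)
      moreover have "norm x - norm y \<le> norm (x + y)" using norm_diff_ineq[of x y] by simp
      ultimately have n: "1 / 10 \<le> norm (x + y)" by linarith
      then have "(1 / 10)\<^sup>2 \<le> (norm (x + y))\<^sup>2" by (intro power_mono) auto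
      then have n2: "1 / 100 \<le> (norm (x + y))\<^sup>2" by (simp add: power_divide)
      have "x + y \<noteq> 0" using n by auto
      then have "K p \<le> 4 * pi / (norm (x + y))\<^sup>2"
        unfolding K_def x_def y_def by (rule gauss_hat_le[OF e_pos])
      also have "\<dots> \<le> 4 * pi / (1 / 100)"
        using n2 by (intro divide_left_mono mult_pos_pos) auto
      finally show ?thesis using True by (simp add: far1_def far2_def)
    next
      case False
      then show ?thesis by (auto simp: far1_def far2_def indicator_def not_less K_nonneg)
    qed
    then have "H (fst p) * H (snd p) * (K p * far1 x) \<le> H (fst p) * H (snd p) * (K p * (far1 x * far2 y) + 400 * pi)"
      by (intro mult_left_mono mult_nonneg_nonneg H_nonneg)
    then show "H (fst p) * H (snd p) * K p * far1 (circ3 (fst p)) \<le>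
        H (fst p) * H (snd p) * K p * (far1 (circ3 (fst p)) * far2 (circ3 (snd p))) + 400 * pi * (H (fst p) * H (snd p))"
      by (simp add: x_def y_def algebra_simps)
  qed
  also have "\<dots> = J (\<lambda>x y. far1 x * far2 y) + (\<integral>p. 400 * pi * (H (fst p) * H (snd p)) \<partial>(T3 \<Otimes>\<^sub>M T3))"
    unfolding J_def by (rule Bochner_Integration.integral_add[OF i1]) (intro integrable_mult_right HH)
  also have "(\<integral>p. 400 * pi * (H (fst p) * H (snd p)) \<partial>(T3 \<Otimes>\<^sub>M T3)) = 400 * pi * (\<integral>t. h t \<partial>T) ^ 6"
    unfolding integral_mult_right_zero T6.integrable_pair_mult(2)[OF H_integrable H_integrable] H_sq_integral(3)
    by (simp flip: power_add)
  finally show ?thesis .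
qed

lemma h_integral_sq_le: "(\<integral>t. h t \<partial>T)\<^sup>2 \<le> 2 * pi * (\<integral>t. (h t)\<^sup>2 \<partial>T)"
  by (rule integral_T_square_le[OF h_integrable h_sq_integrable])

text \<open>The factor 82 restores the discarded part, 192 pi^3 is the Schur bound, and (2 pi)^3
  turns the sixth power of the integral of h into its L2 norm.\<close>

definition ts_const :: real where "ts_const = 82 * (192 * pi ^ 3 + 400 * pi * (2 * pi) ^ 3)"

lemma J_le: "J (\<lambda>x y. 1) \<le> ts_const * (\<integral>t. (h t)\<^sup>2 \<partial>T) ^ 3"
proof -
  have "((\<integral>t. h t \<partial>T)\<^sup>2) ^ 3 \<le> (2 * pi * (\<integral>t. (h t)\<^sup>2 \<partial>T)) ^ 3"
    by (rule power_mono[OF h_integral_sq_le]) simp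
  then have "(\<integral>t. h t \<partial>T) ^ 6 \<le> (2 * pi) ^ 3 * (\<integral>t. (h t)\<^sup>2 \<partial>T) ^ 3"
    by (simp add: power_mult_distrib flip: power_mult)
  then have "400 * pi * (\<integral>t. h t \<partial>T) ^ 6 \<le> 400 * pi * ((2 * pi) ^ 3 * (\<integral>t. (h t)\<^sup>2 \<partial>T) ^ 3)"
    by (intro mult_left_mono) auto
  from order_trans[OF J_far add_mono[OF J_far_far this]]
  have "82 * J (\<lambda>x y. far1 x) \<le> 82 * (192 * pi ^ 3 * (\<integral>t. (h t)\<^sup>2 \<partial>T) ^ 3 + 400 * pi * ((2 * pi) ^ 3 * (\<integral>t. (h t)\<^sup>2 \<partial>T) ^ 3))"
    by (rule mult_left_mono) simp
  from order_trans[OF J_le_far this]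
  have "J (\<lambda>x y. 1) \<le> 82 * (192 * pi ^ 3 * (\<integral>t. (h t)\<^sup>2 \<partial>T) ^ 3 + 400 * pi * ((2 * pi) ^ 3 * (\<integral>t. (h t)\<^sup>2 \<partial>T) ^ 3))" .
  also have "\<dots> = ts_const * (\<integral>t. (h t)\<^sup>2 \<partial>T) ^ 3"
    unfolding ts_const_def by (simp add: algebra_simps)
  finally show ?thesis .
qed

text \<open>The extension is real, so the product of its two cubes is the sixth power of its
  modulus, and the pairing with weight 1 is exactly the weighted integral.\<close>

lemma tomas_stein_gauss:
  "(\<integral>\<^sup>+x. ennreal (norm (circle_ext (\<lambda>t. complex_of_real (h t)) x) ^ 6 * gauss e x) \<partial>lborel) \<le> ennreal (ts_const * (\<integral>t. (h t)\<^sup>2 \<partial>T) ^ 3)"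
proof -
  have v: "v x = circle_ext (\<lambda>t. complex_of_real (h t)) x" for x by (simp add: hx_def)
  have real: "cnj (v x) = v x" for x
    unfolding v using cnj_circle_ext[of "\<lambda>t. complex_of_real (h t)" x] circle_L2_measurable[OF h_L2] circle_L2_periodic[OF h_L2]
    by (simp add: h_antipodal)
  have six: "v x ^ 3 * v x ^ 3 = complex_of_real (norm (v x) ^ 6)" for x
  proof -
    have "complex_of_real ((norm (v x))\<^sup>2) = v x ^ 2"
      using complex_norm_square[of "v x"] by (simp add: real power2_eq_square)
    then have e: "(complex_of_real (norm (v x)))\<^sup>2 = v x ^ 2" by simp
    have "complex_of_real (norm (v x) ^ 6) = ((complex_of_real (norm (v x)))\<^sup>2) ^ 3"
      by (simp flip: power_mult)
    also have "\<dots> = v x ^ 3 * v x ^ 3"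
      unfolding e by (simp flip: power_mult power_add)
    finally show ?thesis ..
  qed
  have one: "\<And>p. H p = H p * (\<lambda>_. 1) (circ3 p)" by simp
  note p0 = J_product[OF H_integrable H_integrable one one, unfolded ext_H0 six]
  have int: "integrable lborel (\<lambda>x. norm (v x) ^ 6 * gauss e x)"
    using p0(2) unfolding of_real_mult[symmetric] complex_of_real_integrable_eq .
  have "complex_of_real (J (\<lambda>x y. 1)) = complex_of_real (\<integral>x. norm (v x) ^ 6 * gauss e x \<partial>lborel)"
    using p0(1) unfolding of_real_mult[symmetric] integral_complex_of_real mult_1_right .
  then have "(\<integral>x. norm (v x) ^ 6 * gauss e x \<partial>lborel) \<le> ts_const * (\<integral>t. (h t)\<^sup>2 \<partial>T) ^ 3"
    using J_le by (simp only: of_real_eq_iff)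
  then show ?thesis
    unfolding v[symmetric] using nn_integral_eq_integral[OF int] by (simp add: gauss_pos less_imp_le ennreal_leI)
qed

end

text \<open>Symmetrization reduces a general F to \<open>sharp F\<close>, which has the same L2
  norm; then e tends to 0.\<close>

lemma tomas_stein:
  assumes F: "circle_L2 F"
  shows "ext6 F \<le> ennreal (82 * (192 * pi ^ 3 + 400 * pi * (2 * pi) ^ 3) * (\<integral>t. (norm (F t))\<^sup>2 \<partial>T) ^ 3)"
proof -
  have "ext6 F \<le> ext6 (\<lambda>t. complex_of_real (sharp F t))"
    by (rule symmetrization[OF F])
  also have "\<dots> \<le> ennreal (82 * (192 * pi ^ 3 + 400 * pi * (2 * pi) ^ 3) * (\<integral>t. (sharp F t)\<^sup>2 \<partial>T) ^ 3)"
    unfolding ext6_def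
  proof (rule nn_integral_gauss_limit)
    have [measurable]: "(\<lambda>t. complex_of_real (sharp F t)) \<in> borel_measurable borel"
      by (rule circle_L2_measurable[OF sharp_L2(1)[OF F]])
    show "(\<lambda>x. norm (circle_ext (\<lambda>t. complex_of_real (sharp F t)) x) ^ 6) \<in> borel_measurable borel" by measurable
    fix e :: real assume "e > 0"
    then interpret tomas_stein "sharp F" e
      by unfold_locales (auto simp: sharp_L2(1)[OF F] sharp_nonneg sharp_antipodal[OF circle_L2_periodic[OF F]])
    show "(\<integral>\<^sup>+x. ennreal (norm (circle_ext (\<lambda>t. complex_of_real (sharp F t)) x) ^ 6 * gauss e x) \<partial>lborel) \<le>
       ennreal (82 * (192 * pi ^ 3 + 400 * pi * (2 * pi) ^ 3) * (\<integral>t. (sharp F t)\<^sup>2 \<partial>T) ^ 3)"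
      using tomas_stein_gauss unfolding ts_const_def .
  qed simp
  finally show ?thesis unfolding sharp_L2(2)[OF F] .
qed

section \<open>The Jacobi-Anger expansion\<close>

text \<open>Counts the frequencies 2m and -2m that are merged into one cosine.\<close>

definition fold_weight :: "nat \<Rightarrow> real" where
  "fold_weight m = (if m = 0 then 1 else 2)"

lemma fold_weight_bounds: "0 \<le> fold_weight m" "fold_weight m \<le> 2"
  by (auto simp: fold_weight_def)

lemma sum_fold_centre:
  fixes \<phi> :: "nat \<Rightarrow> real"
  shows "(\<Sum>j\<le>2 * k. \<phi> j) = \<phi> k + (\<Sum>m=1..k. \<phi> (k + m) + \<phi> (k - m))"
proof -
  have "(\<Sum>j\<le>2 * k. \<phi> j) = sum \<phi> ({..<k} \<union> ({k} \<union> {k + 1..k + k}))"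
    by (rule sum.cong) auto
  also have "\<dots> = (\<Sum>j<k. \<phi> j) + sum \<phi> ({k} \<union> {k + 1..k + k})"
    by (rule sum.union_disjoint) auto
  also have "sum \<phi> ({k} \<union> {k + 1..k + k}) = \<phi> k + (\<Sum>j=k + 1..k + k. \<phi> j)"
    by (subst sum.union_disjoint) auto
  also have "(\<Sum>j=k + 1..k + k. \<phi> j) = (\<Sum>m=1..k. \<phi> (k + m))"
    by (rule sum.reindex_bij_witness[of _ "\<lambda>m. k + m" "\<lambda>j. j - k"]) auto
  also have "(\<Sum>j<k. \<phi> j) = (\<Sum>m=1..k. \<phi> (k - m))"
    by (rule sum.reindex_bij_witness[of _ "\<lambda>m. k - m" "\<lambda>j. k - j"]) auto
  finally show ?thesis by (simp add: sum.distrib)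
qed

text \<open>The binomial expansion of (exp (i b) + exp (-i b))^(2k), with the terms at distance m
  from the centre paired.\<close>

lemma cos_power_expansion:
  "(2 * cos b) ^ (2 * k) / fact (2 * k) = (\<Sum>m\<le>k. fold_weight m * cos (2 * real m * b) / (fact (k - m) * fact (k + m)))"
proof -
  define \<phi> where "\<phi> j = cos ((2 * real j - 2 * real k) * b) / (fact j * fact (2 * k - j))" for j
  have "complex_of_real (2 * cos b) = cis b + cis (- b)" by (simp add: complex_eq_iff)
  then have "complex_of_real ((2 * cos b) ^ (2 * k)) = (cis b + cis (- b)) ^ (2 * k)"
    by (simp only: of_real_power)
  also have "\<dots> = (\<Sum>j\<le>2 * k. of_nat (2 * k choose j) * cis b ^ j * cis (- b) ^ (2 * k - j))"
    by (rule binomial_ring)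
  finally have "(2 * cos b) ^ (2 * k) = Re (\<Sum>j\<le>2 * k. of_nat (2 * k choose j) * cis b ^ j * cis (- b) ^ (2 * k - j))"
    by (metis Re_complex_of_real)
  also have "\<dots> = (\<Sum>j\<le>2 * k. fact (2 * k) * \<phi> j)"
    unfolding Re_sum
  proof (rule sum.cong[OF refl])
    fix j assume "j \<in> {..2 * k}"
    then have j: "j \<le> 2 * k" by simp
    have "cis b ^ j * cis (- b) ^ (2 * k - j) = cis ((2 * real j - 2 * real k) * b)"
      unfolding Complex.DeMoivre cis_mult using j by (simp add: of_nat_diff algebra_simps)
    then have "Re (of_nat (2 * k choose j) * cis b ^ j * cis (- b) ^ (2 * k - j)) = real (2 * k choose j) * cos ((2 * real j - 2 * real k) * b)"
      by (simp add: mult.assoc)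
    also have "\<dots> = fact (2 * k) * \<phi> j"
      using j by (simp add: binomial_fact \<phi>_def)
    finally show "Re (of_nat (2 * k choose j) * cis b ^ j * cis (- b) ^ (2 * k - j)) = fact (2 * k) * \<phi> j" .
  qed
  finally have "(2 * cos b) ^ (2 * k) / fact (2 * k) = (\<Sum>j\<le>2 * k. \<phi> j)"
    by (simp add: sum_distrib_left[symmetric])
  also have "\<dots> = \<phi> k + (\<Sum>m=1..k. \<phi> (k + m) + \<phi> (k - m))" by (rule sum_fold_centre)
  also have "(\<Sum>m=1..k. \<phi> (k + m) + \<phi> (k - m)) =
      (\<Sum>m=1..k. fold_weight m * cos (2 * real m * b) / (fact (k - m) * fact (k + m)))"
  proof (rule sum.cong[OF refl])
    fix m assume m: "m \<in> {1..k}"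
    have "(2 * real (k - m) - 2 * real k) * b = - (2 * real m * b)"
      using m by (simp add: of_nat_diff algebra_simps)
    then have "cos ((2 * real (k - m) - 2 * real k) * b) = cos (2 * real m * b)"
      by (simp only: cos_minus)
    moreover have "2 * k - (k - m) = k + m" "2 * k - (k + m) = k - m" using m by auto
    moreover have "(2 * real (k + m) - 2 * real k) * b = 2 * real m * b" by (simp add: algebra_simps)
    ultimately have "\<phi> (k + m) = cos (2 * real m * b) / (fact (k - m) * fact (k + m))"
      "\<phi> (k - m) = cos (2 * real m * b) / (fact (k - m) * fact (k + m))"
      unfolding \<phi>_def by (simp_all only: mult.commute[of "fact (k + m)"])
    then show "\<phi> (k + m) + \<phi> (k - m) = fold_weight m * cos (2 * real m * b) / (fact (k - m) * fact (k + m))"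
      using m by (simp add: fold_weight_def)
  qed
  also have "\<phi> k = fold_weight 0 * cos (2 * real 0 * b) / (fact (k - 0) * fact (k + 0))"
  proof -
    have "2 * k - k = k" by simp
    then show ?thesis unfolding \<phi>_def fold_weight_def by simp
  qed
  also have "fold_weight 0 * cos (2 * real 0 * b) / (fact (k - 0) * fact (k + 0)) +
      (\<Sum>m=1..k. fold_weight m * cos (2 * real m * b) / (fact (k - m) * fact (k + m)))
      = (\<Sum>m\<le>k. fold_weight m * cos (2 * real m * b) / (fact (k - m) * fact (k + m)))"
    unfolding atMost_atLeast0 by (subst sum.atLeast_Suc_atMost[of 0 k]) simp_all
  finally show ?thesis .
qed

text \<open>In classical terms (-1)^m J_(2m)(2 sqrt z), doubled for m \<ge> 1.\<close>

definition anger_coeff :: "real \<Rightarrow> nat \<Rightarrow> real" where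
  "anger_coeff z m = fold_weight m * (- z) ^ m * bc (2 * m) z"

lemma abs_bc_le:
  assumes "0 \<le> z"
  shows "\<bar>bc n z\<bar> \<le> exp z / fact n"
proof -
  have t: "\<bar>(-1) ^ j / (fact j * fact (n + j)) * z ^ j\<bar> \<le> (z ^ j /\<^sub>R fact j) / fact n" for j
  proof -
    have "fact n \<le> (fact (n + j) :: real)" by (rule fact_mono) simp
    then have "z ^ j / (fact j * fact (n + j)) \<le> z ^ j / (fact j * fact n)"
      using assms by (intro divide_left_mono mult_left_mono mult_pos_pos) auto
    then show ?thesis using assms by (simp add: abs_mult field_simps)
  qed
  have s: "(\<lambda>j. (z ^ j /\<^sub>R fact j) / fact n) sums (exp z / fact n)"
    by (intro sums_divide exp_converges)
  have "\<bar>bc n z\<bar> \<le> (\<Sum>j. \<bar>(-1) ^ j / (fact j * fact (n + j)) * z ^ j\<bar>)"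
    unfolding bc_def by (rule summable_rabs[OF bc_summable_abs])
  also have "\<dots> \<le> (\<Sum>j. (z ^ j /\<^sub>R fact j) / fact n)"
    by (intro suminf_le t bc_summable_abs sums_summable[OF s])
  finally show ?thesis using sums_unique[OF s] by simp
qed

lemma anger_coeff_summable:
  assumes "0 \<le> z"
  shows "summable (\<lambda>m. \<bar>anger_coeff z m\<bar>)"
proof (rule summable_comparison_test)
  show "summable (\<lambda>m. 2 * exp z * (inverse (fact m) * z ^ m))"
    by (intro summable_mult summable_exp)
  have "\<bar>anger_coeff z m\<bar> \<le> 2 * exp z * (inverse (fact m) * z ^ m)" for m
  proof -
    have f: "fact m \<le> (fact (2 * m) :: real)" by (rule fact_mono) simp
    have "\<bar>bc (2 * m) z\<bar> \<le> exp z / fact (2 * m)" by (rule abs_bc_le[OF assms])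
    also have "\<dots> \<le> exp z / fact m" using f by (intro divide_left_mono mult_pos_pos) auto
    finally have b: "\<bar>bc (2 * m) z\<bar> \<le> exp z / fact m" .
    have "\<bar>anger_coeff z m\<bar> = fold_weight m * z ^ m * \<bar>bc (2 * m) z\<bar>"
      using assms by (simp add: anger_coeff_def fold_weight_def abs_mult power_abs)
    also have "\<dots> \<le> 2 * z ^ m * (exp z / fact m)"
      using assms b by (intro mult_mono) (auto simp: fold_weight_def)
    finally show ?thesis by (simp add: field_simps)
  qed
  then show "\<exists>N. \<forall>m\<ge>N. norm \<bar>anger_coeff z m\<bar> \<le> 2 * exp z * (inverse (fact m) * z ^ m)"
    by simp
qed

text \<open>Both sides are iterated sums of one absolutely convergent double series: summing over p
  first gives the Bessel coefficients, and summing along m + p = k gives the cosine series through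
  \<open>cos_power_expansion\<close>.\<close>

lemma jacobi_anger:
  assumes z: "0 \<le> z"
  shows "(\<lambda>m. anger_coeff z m * cos (2 * real m * b)) sums cos (2 * sqrt z * cos b)"
proof -
  define U where "U = (\<lambda>(m::nat, p::nat). fold_weight m * cos (2 * real m * b) * (- z) ^ (m + p) / (fact p * fact (2 * m + p)))"
  have abs_le: "norm (U (m, p)) \<le> 2 * (z ^ m /\<^sub>R fact m) * (z ^ p /\<^sub>R fact p)" for m p
  proof -
    have "fact m \<le> (fact (2 * m + p) :: real)" by (rule fact_mono) simp
    then have "1 / (fact p * fact (2 * m + p)) \<le> 1 / (fact p * fact m :: real)"
      by (intro divide_left_mono mult_left_mono mult_pos_pos) auto
    moreover have "fold_weight m * \<bar>cos (2 * real m * b)\<bar> \<le> 2 * 1"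
      by (intro mult_mono) (auto simp: fold_weight_def)
    ultimately have "(fold_weight m * \<bar>cos (2 * real m * b)\<bar> * z ^ (m + p)) * (1 / (fact p * fact (2 * m + p))) \<le>
        (2 * 1 * z ^ (m + p)) * (1 / (fact p * fact m))"
      using z by (intro mult_mono mult_right_mono) (auto simp: fold_weight_bounds)
    then show ?thesis
      using z by (simp add: U_def abs_mult power_abs fold_weight_def power_add field_simps)
  qed
  define E where "E m = z ^ m /\<^sub>R fact m" for m
  have E_nonneg: "0 \<le> E m" for m using z by (simp add: E_def)
  have E_sums: "E sums exp z" unfolding E_def[abs_def] by (rule exp_converges)
  have E: "(E has_sum exp z) UNIV"
    using E_sums E_nonneg by (intro norm_summable_imp_has_sum) (auto simp: sums_iff)
  have "(\<lambda>x. 2 * E (fst x) * E (snd x)) summable_on (UNIV \<times> UNIV)"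
  proof (rule summable_on_SigmaI[where g = "\<lambda>m. 2 * E m * exp z"])
    show "((\<lambda>y. 2 * E (fst (m, y)) * E (snd (m, y))) has_sum 2 * E m * exp z) UNIV" for m
      using has_sum_cmult_right[OF E, of "2 * E m"] by simp
    have "((\<lambda>m. (2 * exp z) * E m) has_sum (2 * exp z) * exp z) UNIV"
      by (rule has_sum_cmult_right[OF E])
    then show "(\<lambda>m. 2 * E m * exp z) summable_on UNIV"
      by (auto simp: summable_on_def mult_ac)
  qed (simp add: E_nonneg)
  then have "(\<lambda>x. norm (U x)) summable_on (UNIV \<times> UNIV)"
  proof (rule summable_on_comparison_test)
    fix x :: "nat \<times> nat"
    show "norm (U x) \<le> 2 * E (fst x) * E (snd x)"
      using abs_le[of "fst x" "snd x"] by (simp add: E_def)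
  qed simp
  then have sm: "U summable_on (UNIV \<times> UNIV)" by (rule Infinite_Sum.abs_summable_summable)
  define V where "V = (\<lambda>(k::nat, m::nat). U (m, k - m))"
  \<comment> \<open>The diagonals m + p = k, where p = k - m is an honest subtraction because m
    \<le> k.\<close>
  have bij: "bij_betw (\<lambda>(k, m). (m, k - m)) (SIGMA k:UNIV. {..k}) (UNIV \<times> (UNIV :: nat set))"
    by (rule bij_betwI[where g = "\<lambda>(m, p). (m + p, m)"]) auto
  have hs: "(U has_sum infsum U (UNIV \<times> UNIV)) (UNIV \<times> UNIV)" using sm by simp
  then have "((\<lambda>x. U (case x of (k, m) \<Rightarrow> (m, k - m))) has_sum infsum U (UNIV \<times> UNIV)) (SIGMA k:UNIV. {..k})"
    by (subst has_sum_reindex_bij_betw[OF bij])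
  then have "(V has_sum infsum U (UNIV \<times> UNIV)) (SIGMA k:UNIV. {..k})"
    by (simp add: V_def case_prod_unfold)
  then have k_sum: "((\<lambda>k. \<Sum>m\<le>k. V (k, m)) has_sum infsum U (UNIV \<times> UNIV)) UNIV"
    by (rule has_sum_SigmaD) (auto intro: has_sum_finiteI)
  have inner_k: "(\<Sum>m\<le>k. V (k, m)) = (-1) ^ k / fact (2 * k) * (2 * sqrt z * cos b) ^ (2 * k)" for k
  proof -
    have "(2 * sqrt z * cos b) ^ (2 * k) = z ^ k * (2 * cos b) ^ (2 * k)"
      using z by (simp add: power_mult_distrib power_mult)
    then have "(-1) ^ k / fact (2 * k) * (2 * sqrt z * cos b) ^ (2 * k) = (- z) ^ k * ((2 * cos b) ^ (2 * k) / fact (2 * k))"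
      by (simp add: power_minus[of z])
    also have "\<dots> = (\<Sum>m\<le>k. V (k, m))"
      unfolding cos_power_expansion sum_distrib_left
    proof (rule sum.cong[OF refl])
      fix m assume "m \<in> {..k}"
      then have "2 * m + (k - m) = k + m" "m + (k - m) = k" by auto
      then show "(- z) ^ k * (fold_weight m * cos (2 * real m * b) / (fact (k - m) * fact (k + m))) = V (k, m)"
        unfolding V_def U_def by (simp add: mult.commute add.commute)
    qed
    finally show ?thesis ..
  qed
  have inner_m: "((\<lambda>p. U (m, p)) has_sum anger_coeff z m * cos (2 * real m * b)) UNIV" for m
  proof -
    have "((\<lambda>p. (-1) ^ p / (fact p * fact (2 * m + p)) * z ^ p) has_sum bc (2 * m) z) UNIV"
      unfolding bc_def
      by (rule norm_summable_imp_has_sum) (use bc_summable_abs[of "2 * m" z] summable_sums[OF bc_summable] in auto)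
    from has_sum_cmult_right[OF this, of "fold_weight m * cos (2 * real m * b) * (- z) ^ m"]
    have "((\<lambda>p. fold_weight m * cos (2 * real m * b) * (- z) ^ m * ((-1) ^ p / (fact p * fact (2 * m + p)) * z ^ p)) has_sum
       anger_coeff z m * cos (2 * real m * b)) UNIV"
      by (simp add: anger_coeff_def mult_ac)
    then show ?thesis
      by (rule has_sum_cong[THEN iffD1, rotated]) (simp add: U_def power_add power_minus[of z] mult_ac)
  qed
  have "((\<lambda>m. anger_coeff z m * cos (2 * real m * b)) has_sum infsum U (UNIV \<times> UNIV)) UNIV"
    using hs by (rule has_sum_SigmaD) (rule inner_m)
  then have 1: "(\<lambda>m. anger_coeff z m * cos (2 * real m * b)) sums infsum U (UNIV \<times> UNIV)"
    by (rule has_sum_imp_sums)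
  have "(\<lambda>k. (-1) ^ k / fact (2 * k) * (2 * sqrt z * cos b) ^ (2 * k)) sums infsum U (UNIV \<times> UNIV)"
    using has_sum_imp_sums[OF k_sum] unfolding inner_k .
  moreover have "(\<lambda>k. (-1) ^ k / fact (2 * k) * (2 * sqrt z * cos b) ^ (2 * k)) sums cos (2 * sqrt z * cos b)"
    by (rule cos_paired)
  ultimately have "infsum U (UNIV \<times> UNIV) = cos (2 * sqrt z * cos b)" by (rule sums_unique2)
  with 1 show ?thesis by simp
qed

section \<open>Orthogonality of the trigonometric system\<close>

lemma measure_T' [simp]: "measure T {0..<2 * pi} = 2 * pi"
  using measure_T by simp

text \<open>Translation by the half period pi / n changes the sign of the integrand but not its
  integral.\<close>

lemma integral_T_cos:
  assumes "n \<ge> 1"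
  shows "(\<integral>t. cos (real n * t + c) \<partial>T) = 0"
proof -
  have per: "periodic (\<lambda>t. cos (real n * t + c))"
  proof -
    have "cos (real n * (t + 2 * pi) + c) = cos (real n * t + c)" for t
    proof -
      have "real n * (t + 2 * pi) + c = (real n * t + c) + 2 * pi * of_int (int n)" by (simp add: algebra_simps)
      also have "cos \<dots> = cos (real n * t + c)"
        using periodic_int[of cos "real n * t + c" "int n"] by (simp add: periodic_def)
      finally show ?thesis .
    qed
    then show ?thesis by (simp add: periodic_def)
  qed
  have "cos (real n * (t + pi / real n) + c) = - cos (real n * t + c)" for t
  proof -
    have "real n * (t + pi / real n) + c = (real n * t + c) + pi" using assms by (simp add: field_simps)
    then show ?thesis by (simp only: cos_periodic_pi)
  qed
  then have "(\<integral>t. - cos (real n * t + c) \<partial>T) = (\<integral>t. cos (real n * t + c) \<partial>T)"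
    using integral_T_shift[OF _ per, of "pi / real n"] by simp
  then show ?thesis by simp
qed

lemma integrable_T_bounded:
  fixes f :: "real \<Rightarrow> real"
  assumes [measurable]: "f \<in> borel_measurable borel" and "\<And>t. \<bar>f t\<bar> \<le> B"
  shows "integrable T f"
  by (rule T.integrable_const_bound[of _ B]) (use assms in \<open>auto intro: measurable_T\<close>)

lemma integrable_T_trig [simp]:
  "integrable T (\<lambda>t. cos (a * t + c))" "integrable T (\<lambda>t. cos (a * t))" "integrable T (\<lambda>t. sin (a * t))"
  "integrable T (\<lambda>t. cos (a * t) * cos (b * t))" "integrable T (\<lambda>t. cos (a * t) * sin (b * t))"
  "integrable T (\<lambda>t. sin (a * t) * cos (b * t))" "integrable T (\<lambda>t. sin (a * t) * sin (b * t))"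
  by (rule integrable_T_bounded[of _ 1]; auto simp: abs_mult intro!: mult_le_one)+

lemma trig_orthogonality:
  assumes "m \<ge> 1" "n \<ge> 1"
  shows "(\<integral>t. cos (2 * real m * t) * cos (2 * real n * t) \<partial>T) = (if m = n then pi else 0)"
    "(\<integral>t. sin (2 * real m * t) * sin (2 * real n * t) \<partial>T) = (if m = n then pi else 0)"
    "(\<integral>t. cos (2 * real m * t) * sin (2 * real n * t) \<partial>T) = 0"
    "(\<integral>t. sin (2 * real m * t) * cos (2 * real n * t) \<partial>T) = 0"
proof -
  have sumI: "(\<integral>t. cos (2 * (real m + real n) * t + c) \<partial>T) = 0" for c
    using integral_T_cos[of "2 * (m + n)" c] assms by simp
  have diffI: "(\<integral>t. cos (2 * (real m - real n) * t + c) \<partial>T) = (if m = n then 2 * pi * cos c else 0)" for c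
  proof (cases "m = n")
    case False
    show ?thesis
    proof (cases "n < m")
      case True
      then show ?thesis using integral_T_cos[of "2 * (m - n)" c] by (simp add: of_nat_diff)
    next
      case f: False
      with False have "m < n" by simp
      then have "(\<integral>t. cos (2 * (real n - real m) * t + (- c)) \<partial>T) = 0"
        using integral_T_cos[of "2 * (n - m)" "- c"] by (simp add: of_nat_diff)
      moreover have "cos (2 * (real m - real n) * t + c) = cos (2 * (real n - real m) * t + (- c))" for t
        using cos_minus[of "2 * (real n - real m) * t + (- c)"] by (simp add: algebra_simps)
      ultimately show ?thesis using False by simp
    qed
  qed simp
  \<comment> \<open>Sines are written as cosines with a phase, so that all four products reduce to
    \<open>sumI\<close> and \<open>diffI\<close>.\<close>
  have quarter: "cos (x + (- pi / 2)) = sin x" for x :: real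
    by (simp add: cos_diff)
  have arg: "2 * (real m - real n) * t = 2 * real m * t - 2 * real n * t" "2 * (real m + real n) * t = 2 * real m * t + 2 * real n * t" for t
    by (simp_all add: algebra_simps)
  have cc: "cos (2 * real m * t) * cos (2 * real n * t) = 1 / 2 * cos (2 * (real m - real n) * t + 0) + 1 / 2 * cos (2 * (real m + real n) * t + 0)" for t
    unfolding arg add_0_right cos_add cos_diff by (simp add: field_simps)
  have ss: "sin (2 * real m * t) * sin (2 * real n * t) = 1 / 2 * cos (2 * (real m - real n) * t + 0) + (- 1 / 2) * cos (2 * (real m + real n) * t + 0)" for t
    unfolding arg add_0_right cos_add cos_diff by (simp add: field_simps)
  have cs: "cos (2 * real m * t) * sin (2 * real n * t) = 1 / 2 * cos (2 * (real m + real n) * t + (- pi / 2)) + (- 1 / 2) * cos (2 * (real m - real n) * t + (- pi / 2))" for t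
    unfolding quarter arg sin_add sin_diff by (simp add: field_simps)
  have sc: "sin (2 * real m * t) * cos (2 * real n * t) = 1 / 2 * cos (2 * (real m + real n) * t + (- pi / 2)) + 1 / 2 * cos (2 * (real m - real n) * t + (- pi / 2))" for t
    unfolding quarter arg sin_add sin_diff by (simp add: field_simps)
  show "(\<integral>t. cos (2 * real m * t) * cos (2 * real n * t) \<partial>T) = (if m = n then pi else 0)"
    unfolding cc by (subst Bochner_Integration.integral_add) (simp_all only: integrable_mult_right integrable_T_trig integral_mult_right_zero sumI diffI, simp)
  show "(\<integral>t. sin (2 * real m * t) * sin (2 * real n * t) \<partial>T) = (if m = n then pi else 0)"
    unfolding ss by (subst Bochner_Integration.integral_add) (simp_all only: integrable_mult_right integrable_T_trig integral_mult_right_zero sumI diffI, simp)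
  show "(\<integral>t. cos (2 * real m * t) * sin (2 * real n * t) \<partial>T) = 0"
    unfolding cs by (subst Bochner_Integration.integral_add) (simp_all only: integrable_mult_right integrable_T_trig integral_mult_right_zero sumI diffI, simp)
  show "(\<integral>t. sin (2 * real m * t) * cos (2 * real n * t) \<partial>T) = 0"
    unfolding sc by (subst Bochner_Integration.integral_add) (simp_all only: integrable_mult_right integrable_T_trig integral_mult_right_zero sumI diffI, simp)
qed

section \<open>The quadratic form\<close>

definition trig_sum :: "(nat \<Rightarrow> real) \<Rightarrow> (nat \<Rightarrow> real) \<Rightarrow> nat \<Rightarrow> real \<Rightarrow> real" where
  "trig_sum p q N t = (\<Sum>m=1..N. p m * cos (2 * real m * t) + q m * sin (2 * real m * t))"

text \<open>Only even frequencies are recorded: these are the ones to which the even function cos (x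
  . omega) couples.\<close>

definition fcos :: "(real \<Rightarrow> real) \<Rightarrow> nat \<Rightarrow> real" where
  "fcos g m = (\<integral>t. g t * cos (2 * real m * t) \<partial>T)"

definition fsin :: "(real \<Rightarrow> real) \<Rightarrow> nat \<Rightarrow> real" where
  "fsin g m = (\<integral>t. g t * sin (2 * real m * t) \<partial>T)"

lemma integrable_T_mult_bounded:
  fixes g f :: "real \<Rightarrow> real"
  assumes "integrable T g" and [measurable]: "f \<in> borel_measurable borel" and "\<And>t. \<bar>f t\<bar> \<le> 1"
  shows "integrable T (\<lambda>t. g t * f t)"
proof (rule Bochner_Integration.integrable_bound[OF assms(1)])
  have [measurable]: "g \<in> borel_measurable T" "f \<in> borel_measurable T" using assms by (auto intro: measurable_T)
  show "(\<lambda>t. g t * f t) \<in> borel_measurable T" by measurable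
  show "AE t in T. norm (g t * f t) \<le> norm (g t)"
    using assms(3) by (intro AE_I2) (simp add: abs_mult mult_left_le)
qed

lemma integral_mult_trig_sum:
  assumes g: "integrable T g"
  shows "integrable T (\<lambda>t. g t * trig_sum p q N t)"
    "(\<integral>t. g t * trig_sum p q N t \<partial>T) = (\<Sum>m=1..N. p m * fcos g m + q m * fsin g m)"
proof -
  have i: "integrable T (\<lambda>t. g t * cos (2 * real m * t))" "integrable T (\<lambda>t. g t * sin (2 * real m * t))" for m
    by (rule integrable_T_mult_bounded[OF g]; simp)+
  have eq: "g t * trig_sum p q N t = (\<Sum>m=1..N. p m * (g t * cos (2 * real m * t)) + q m * (g t * sin (2 * real m * t)))" for t
    unfolding trig_sum_def sum_distrib_left by (rule sum.cong) (simp_all add: algebra_simps)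
  show "integrable T (\<lambda>t. g t * trig_sum p q N t)"
    unfolding eq by (intro Bochner_Integration.integrable_sum Bochner_Integration.integrable_add integrable_mult_right i)
  show "(\<integral>t. g t * trig_sum p q N t \<partial>T) = (\<Sum>m=1..N. p m * fcos g m + q m * fsin g m)"
    unfolding eq fcos_def fsin_def
    by (subst Bochner_Integration.integral_sum) (auto intro!: sum.cong simp: i)
qed

lemma trig_sum_square:
  "integrable T (\<lambda>t. (trig_sum p q N t)\<^sup>2)"
  "(\<integral>t. (trig_sum p q N t)\<^sup>2 \<partial>T) = pi * (\<Sum>m=1..N. (p m)\<^sup>2 + (q m)\<^sup>2)"
proof -
  have ti: "integrable T (trig_sum p q N)"
    unfolding trig_sum_def[abs_def] by (intro Bochner_Integration.integrable_sum Bochner_Integration.integrable_add integrable_mult_right integrable_T_trig)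
  show "integrable T (\<lambda>t. (trig_sum p q N t)\<^sup>2)"
    using integral_mult_trig_sum(1)[OF ti] by (simp add: power2_eq_square)
  have f: "fcos (trig_sum p q N) n = pi * p n" "fsin (trig_sum p q N) n = pi * q n" if n: "n \<in> {1..N}" for n
  proof -
    have i1: "integrable T (\<lambda>t. cos (2 * real n * t))" "integrable T (\<lambda>t. sin (2 * real n * t))" by simp_all
    have "fcos (trig_sum p q N) n = (\<Sum>m=1..N. p m * fcos (\<lambda>t. cos (2 * real n * t)) m + q m * fsin (\<lambda>t. cos (2 * real n * t)) m)"
      using integral_mult_trig_sum(2)[OF i1(1), of p q N] by (simp add: fcos_def mult.commute)
    also have "\<dots> = (\<Sum>m=1..N. if n = m then pi * p m else 0)"
      using n by (intro sum.cong refl) (auto simp: fcos_def fsin_def trig_orthogonality)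
    finally show "fcos (trig_sum p q N) n = pi * p n" using n by simp
    have "fsin (trig_sum p q N) n = (\<Sum>m=1..N. p m * fcos (\<lambda>t. sin (2 * real n * t)) m + q m * fsin (\<lambda>t. sin (2 * real n * t)) m)"
      using integral_mult_trig_sum(2)[OF i1(2), of p q N] by (simp add: fsin_def mult.commute)
    also have "\<dots> = (\<Sum>m=1..N. if n = m then pi * q m else 0)"
      using n by (intro sum.cong refl) (auto simp: fcos_def fsin_def trig_orthogonality)
    finally show "fsin (trig_sum p q N) n = pi * q n" using n by simp
  qed
  have "(\<integral>t. (trig_sum p q N t)\<^sup>2 \<partial>T) = (\<Sum>m=1..N. p m * fcos (trig_sum p q N) m + q m * fsin (trig_sum p q N) m)"
    using integral_mult_trig_sum(2)[OF ti, of p q N] by (simp add: power2_eq_square)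
  also have "\<dots> = (\<Sum>m=1..N. pi * ((p m)\<^sup>2 + (q m)\<^sup>2))"
    by (intro sum.cong refl) (simp add: f power2_eq_square algebra_simps)
  finally show "(\<integral>t. (trig_sum p q N t)\<^sup>2 \<partial>T) = pi * (\<Sum>m=1..N. (p m)\<^sup>2 + (q m)\<^sup>2)"
    by (simp add: sum_distrib_left)
qed

text \<open>The squared distance from g to its orthogonal projection is nonnegative; the
  coefficients are divided by pi because the trigonometric functions have squared norm pi.\<close>

lemma bessel_inequality:
  assumes g: "integrable T g" "integrable T (\<lambda>t. (g t)\<^sup>2)"
  shows "(\<Sum>m=1..N. (fcos g m)\<^sup>2 + (fsin g m)\<^sup>2) \<le> pi * (\<integral>t. (g t)\<^sup>2 \<partial>T)"
proof -
  define p q where "p m = fcos g m / pi" and "q m = fsin g m / pi" for m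
  define S where "S = (\<Sum>m=1..N. (fcos g m)\<^sup>2 + (fsin g m)\<^sup>2)"
  have S1: "(\<Sum>m=1..N. p m * fcos g m + q m * fsin g m) = S / pi"
    unfolding S_def sum_divide_distrib by (intro sum.cong refl) (simp add: p_def q_def power2_eq_square add_divide_distrib)
  have S2: "pi * (\<Sum>m=1..N. (p m)\<^sup>2 + (q m)\<^sup>2) = S / pi"
    unfolding S_def sum_divide_distrib sum_distrib_left by (intro sum.cong refl) (simp add: p_def q_def power2_eq_square field_simps)
  have "0 \<le> (\<integral>t. (g t - trig_sum p q N t)\<^sup>2 \<partial>T)" by (intro Bochner_Integration.integral_nonneg) simp
  also have "(\<integral>t. (g t - trig_sum p q N t)\<^sup>2 \<partial>T) = (\<integral>t. (g t)\<^sup>2 + ((- 2) * (g t * trig_sum p q N t) + (trig_sum p q N t)\<^sup>2) \<partial>T)"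
    by (intro Bochner_Integration.integral_cong refl) (simp add: power2_eq_square algebra_simps)
  also have "\<dots> = (\<integral>t. (g t)\<^sup>2 \<partial>T) + ((- 2) * (S / pi) + S / pi)"
    using g(2) integral_mult_trig_sum[OF g(1), of p q N, unfolded S1] trig_sum_square[of p q N, unfolded S2] by simp
  finally show ?thesis unfolding S_def[symmetric] by (simp add: field_simps)
qed

section \<open>Angular expansion of the extension\<close>

definition cos_ext :: "(real \<Rightarrow> real) \<Rightarrow> real^2 \<Rightarrow> real" where
  "cos_ext g x = (\<integral>t. g t * cos (x \<bullet> circ t) \<partial>T)"

text \<open>Jacobi-Anger with b = t - a, integrated term by term; the summable coefficients
  dominate.\<close>

lemma cos_ext_polar_sums:
  assumes g: "integrable T g" and z: "0 \<le> z"
  shows "(\<lambda>m. anger_coeff z m * (fcos g m * cos (2 * real m * a) + fsin g m * sin (2 * real m * a)))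
     sums cos_ext g ((2 * sqrt z) *\<^sub>R circ a)"
proof -
  have [measurable]: "g \<in> borel_measurable T" using g by auto
  define f where "f m t = g t * (anger_coeff z m * cos (2 * real m * (t - a)))" for m t
  have i: "integrable T (f m)" for m
  proof -
    have "integrable T (\<lambda>t. anger_coeff z m * (g t * cos (2 * real m * (t - a))))"
      by (intro integrable_mult_right integrable_T_mult_bounded[OF g]) auto
    then show ?thesis by (simp add: f_def[abs_def] mult_ac)
  qed
  have f_le: "norm (f m t) \<le> \<bar>g t\<bar> * \<bar>anger_coeff z m\<bar>" for m t
    by (simp add: f_def abs_mult mult_left_mono mult_left_le)
  have sn: "summable (\<lambda>m. norm (f m t))" for t
    by (rule summable_comparison_test'[where g = "\<lambda>m. \<bar>g t\<bar> * \<bar>anger_coeff z m\<bar>" and N = 0])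
       (use f_le anger_coeff_summable[OF z] in \<open>auto intro: summable_mult\<close>)
  have "summable (\<lambda>m. \<integral>t. norm (f m t) \<partial>T)"
  proof (rule summable_comparison_test'[where g = "\<lambda>m. (\<integral>t. \<bar>g t\<bar> \<partial>T) * \<bar>anger_coeff z m\<bar>" and N = 0])
    show "summable (\<lambda>m. (\<integral>t. \<bar>g t\<bar> \<partial>T) * \<bar>anger_coeff z m\<bar>)"
      by (intro summable_mult anger_coeff_summable z)
    fix m
    have "(\<integral>t. norm (f m t) \<partial>T) \<le> (\<integral>t. \<bar>g t\<bar> * \<bar>anger_coeff z m\<bar> \<partial>T)"
      using g by (intro integral_mono f_le integrable_norm i integrable_mult_left) auto
    then show "norm (\<integral>t. norm (f m t) \<partial>T) \<le> (\<integral>t. \<bar>g t\<bar> \<partial>T) * \<bar>anger_coeff z m\<bar>"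
      by simp
  qed
  then have "(\<lambda>m. \<integral>t. f m t \<partial>T) sums (\<integral>t. (\<Sum>m. f m t) \<partial>T)"
    using i sn by (intro sums_integral) auto
  moreover have "(\<Sum>m. f m t) = g t * cos (((2 * sqrt z) *\<^sub>R circ a) \<bullet> circ t)" for t
    unfolding f_def using sums_mult[OF jacobi_anger[OF z, of "t - a"], of "g t"]
    by (simp add: sums_iff inner_circ_circ)
  moreover have "(\<integral>t. f m t \<partial>T) = anger_coeff z m * (fcos g m * cos (2 * real m * a) + fsin g m * sin (2 * real m * a))" for m
  proof -
    have "f m t = anger_coeff z m * (cos (2 * real m * a) * (g t * cos (2 * real m * t)) + sin (2 * real m * a) * (g t * sin (2 * real m * t)))" for t
      by (simp add: f_def right_diff_distrib cos_diff algebra_simps)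
    moreover have "integrable T (\<lambda>t. g t * cos (2 * real m * t))" "integrable T (\<lambda>t. g t * sin (2 * real m * t))"
      by (rule integrable_T_mult_bounded[OF g]; simp)+
    ultimately show ?thesis by (simp add: fcos_def fsin_def mult.commute)
  qed
  ultimately show ?thesis by (simp add: cos_ext_def)
qed

text \<open>All coefficients with m \<ge> 1 vanish, and only the J_0 term remains.\<close>

lemma cos_ext_one:
  assumes z: "0 \<le> z"
  shows "cos_ext (\<lambda>_. 1) ((2 * sqrt z) *\<^sub>R circ a) = 2 * pi * bc 0 z"
proof -
  have fc: "fcos (\<lambda>_. 1) m = (if m = 0 then 2 * pi else 0)" for m
    using integral_T_cos[of "2 * m" 0] measure_T by (simp add: fcos_def)
  have fs: "fsin (\<lambda>_. 1) m = 0" for m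
  proof (cases "m = 0")
    case False
    have "(\<integral>t. cos (real (2 * m) * t + (- pi / 2)) \<partial>T) = 0" using False by (intro integral_T_cos) auto
    then show ?thesis by (simp add: fsin_def cos_diff)
  qed (simp add: fsin_def)
  have t: "anger_coeff z m * (fcos (\<lambda>_. 1) m * cos (2 * real m * a) + fsin (\<lambda>_. 1) m * sin (2 * real m * a)) =
      (if m = 0 then 2 * pi * bc 0 z else 0)" for m
    by (cases "m = 0") (simp_all add: anger_coeff_def fold_weight_def fc fs)
  have "integrable T (\<lambda>_. 1 :: real)" by simp
  from cos_ext_polar_sums[OF this z, of a, unfolded t]
  have "(\<lambda>m. if m = 0 then 2 * pi * bc 0 z else 0) sums cos_ext (\<lambda>_. 1) ((2 * sqrt z) *\<^sub>R circ a)" .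
  moreover have "(\<lambda>m. if m = 0 then 2 * pi * bc 0 z else 0) sums (2 * pi * bc 0 z)"
    using sums_If_finite_set[of "{0::nat}" "\<lambda>_. 2 * pi * bc 0 z"] by simp
  ultimately show ?thesis by (rule sums_unique2)
qed

text \<open>The inequality half of Parseval, by Fatou on the partial sums. Mean zero removes the
  term m = 0, and the factor 4 pi is the squared weight 2^2 times the squared norm pi.\<close>

lemma cos_ext_angular_square:
  assumes g: "integrable T g" "(\<integral>t. g t \<partial>T) = 0" and z: "0 \<le> z"
  shows "(\<integral>\<^sup>+a. ennreal ((cos_ext g ((2 * sqrt z) *\<^sub>R circ a))\<^sup>2) \<partial>T) \<le>
    (\<Sum>m. ennreal (4 * pi * (z ^ (2 * Suc m) * (bc (2 * Suc m) z)\<^sup>2) * ((fcos g (Suc m))\<^sup>2 + (fsin g (Suc m))\<^sup>2)))"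
proof -
  define p q where "p m = anger_coeff z m * fcos g m" and "q m = anger_coeff z m * fsin g m" for m
  have sq: "(p (Suc m))\<^sup>2 + (q (Suc m))\<^sup>2 = 4 * (z ^ (2 * Suc m) * (bc (2 * Suc m) z)\<^sup>2) * ((fcos g (Suc m))\<^sup>2 + (fsin g (Suc m))\<^sup>2)" for m
  proof -
    have "(anger_coeff z (Suc m))\<^sup>2 = 4 * (z ^ (2 * Suc m) * (bc (2 * Suc m) z)\<^sup>2)"
      by (simp only: anger_coeff_def fold_weight_def power_mult_distrib power_even_eq[symmetric] power_mult[symmetric] mult.commute[of "Suc m" 2])
         (simp add: power_mult)
    then show ?thesis by (simp add: p_def q_def power_mult_distrib distrib_left)
  qed
  have lim: "(\<lambda>N. trig_sum p q N a) \<longlonglongrightarrow> cos_ext g ((2 * sqrt z) *\<^sub>R circ a)" for a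
  proof -
    have "(\<lambda>m. p m * cos (2 * real m * a) + q m * sin (2 * real m * a)) sums cos_ext g ((2 * sqrt z) *\<^sub>R circ a)"
      using cos_ext_polar_sums[OF g(1) z, of a] by (simp add: p_def q_def algebra_simps)
    then have "(\<lambda>N. \<Sum>m\<le>N. p m * cos (2 * real m * a) + q m * sin (2 * real m * a)) \<longlonglongrightarrow> cos_ext g ((2 * sqrt z) *\<^sub>R circ a)"
      by (simp add: sums_def_le)
    moreover have "p 0 = 0" using g(2) by (simp add: p_def fcos_def)
    then have "(\<Sum>m\<le>N. p m * cos (2 * real m * a) + q m * sin (2 * real m * a)) = trig_sum p q N a" for N
      unfolding trig_sum_def atMost_atLeast0 by (subst sum.atLeast_Suc_atMost) simp_all
    ultimately show ?thesis by simp
  qed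
  have [measurable]: "trig_sum p q N \<in> borel_measurable borel" for N
    unfolding trig_sum_def[abs_def] by measurable
  have "(\<integral>\<^sup>+a. ennreal ((cos_ext g ((2 * sqrt z) *\<^sub>R circ a))\<^sup>2) \<partial>T) = (\<integral>\<^sup>+a. liminf (\<lambda>N. ennreal ((trig_sum p q N a)\<^sup>2)) \<partial>T)"
    by (intro nn_integral_cong lim_imp_Liminf[symmetric] tendsto_ennrealI tendsto_power lim) simp
  also have "\<dots> \<le> liminf (\<lambda>N. \<integral>\<^sup>+a. ennreal ((trig_sum p q N a)\<^sup>2) \<partial>T)"
    by (rule nn_integral_liminf) (rule measurable_T, measurable)
  also have "\<dots> \<le> (\<Sum>m. ennreal (4 * pi * (z ^ (2 * Suc m) * (bc (2 * Suc m) z)\<^sup>2) * ((fcos g (Suc m))\<^sup>2 + (fsin g (Suc m))\<^sup>2)))"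
  proof (rule order_trans[OF Liminf_le_Limsup Limsup_bounded], simp, rule always_eventually, rule allI)
    fix N
    have "(\<integral>\<^sup>+a. ennreal ((trig_sum p q N a)\<^sup>2) \<partial>T) = ennreal (pi * (\<Sum>m=1..N. (p m)\<^sup>2 + (q m)\<^sup>2))"
      by (subst nn_integral_eq_integral) (simp_all add: trig_sum_square)
    also have "pi * (\<Sum>m=1..N. (p m)\<^sup>2 + (q m)\<^sup>2) = (\<Sum>m<N. pi * ((p (Suc m))\<^sup>2 + (q (Suc m))\<^sup>2))"
      unfolding sum_distrib_left by (rule sum.reindex_bij_witness[of _ Suc "\<lambda>m. m - 1"]) auto
    also have "\<dots> = (\<Sum>m<N. 4 * pi * (z ^ (2 * Suc m) * (bc (2 * Suc m) z)\<^sup>2) * ((fcos g (Suc m))\<^sup>2 + (fsin g (Suc m))\<^sup>2))"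
      unfolding sq by (intro sum.cong refl) (simp only: mult_ac)
    also have "ennreal \<dots> = (\<Sum>m<N. ennreal (4 * pi * (z ^ (2 * Suc m) * (bc (2 * Suc m) z)\<^sup>2) * ((fcos g (Suc m))\<^sup>2 + (fsin g (Suc m))\<^sup>2)))"
      using z by (subst sum_ennreal) (auto intro!: mult_nonneg_nonneg zero_le_power simp del: power_Suc)
    also have "\<dots> \<le> (\<Sum>m. ennreal (4 * pi * (z ^ (2 * Suc m) * (bc (2 * Suc m) z)\<^sup>2) * ((fcos g (Suc m))\<^sup>2 + (fsin g (Suc m))\<^sup>2)))"
      by (rule sum_le_suminf) auto
    finally show "(\<integral>\<^sup>+a. ennreal ((trig_sum p q N a)\<^sup>2) \<partial>T) \<le> (\<Sum>m. ennreal (4 * pi * (z ^ (2 * Suc m) * (bc (2 * Suc m) z)\<^sup>2) * ((fcos g (Suc m))\<^sup>2 + (fsin g (Suc m))\<^sup>2)))" .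
  qed
  finally show ?thesis .
qed

lemma cos_ext_measurable [measurable]:
  assumes [measurable]: "g \<in> borel_measurable borel"
  shows "cos_ext g \<in> borel_measurable borel"
proof -
  have [measurable]: "g \<in> borel_measurable T" by (rule measurable_T) measurable
  interpret sigma_finite_measure T by (rule sigma_finite_T)
  show ?thesis unfolding cos_ext_def[abs_def] by measurable
qed

text \<open>The weight is radial, so the angular modes decouple and each is bounded by
  \<open>sixth_kernel_even_integral\<close>; Bessel's inequality sums them. The constant is 2 * 4 pi
  (2 pi)^4 * (3/100) * pi.\<close>

lemma quadratic_form_bound:
  assumes [measurable]: "g \<in> borel_measurable borel" and g: "integrable T g" "integrable T (\<lambda>t. (g t)\<^sup>2)" "(\<integral>t. g t \<partial>T) = 0"
  shows "(\<integral>\<^sup>+x. ennreal (cos_ext (\<lambda>_. 1) x ^ 4 * (cos_ext g x)\<^sup>2) \<partial>lborel) \<le>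
    ennreal (6 / 100 * (2 * pi) ^ 6 * (\<integral>t. (g t)\<^sup>2 \<partial>T))"
proof -
  define w where "w m = (fcos g (Suc m))\<^sup>2 + (fsin g (Suc m))\<^sup>2" for m
  have w_nonneg: "0 \<le> w m" for m by (simp add: w_def)
  have "(\<integral>\<^sup>+x. ennreal (cos_ext (\<lambda>_. 1) x ^ 4 * (cos_ext g x)\<^sup>2) \<partial>lborel) =
    2 * (\<integral>\<^sup>+z. (\<integral>\<^sup>+a. ennreal (cos_ext (\<lambda>_. 1) ((2 * sqrt z) *\<^sub>R circ a) ^ 4 * (cos_ext g ((2 * sqrt z) *\<^sub>R circ a))\<^sup>2) \<partial>T) * indicator {0..} z \<partial>lborel)"
    by (rule nn_integral_polar) measurable
  also have "\<dots> \<le> 2 * (\<integral>\<^sup>+z. (\<Sum>m. ennreal (4 * pi * (2 * pi) ^ 4 * w m) * (ennreal (sixth_kernel (2 * Suc m) z) * indicator {0..} z)) \<partial>lborel)"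
  proof (intro mult_left_mono nn_integral_mono)
    fix z :: real
    show "(\<integral>\<^sup>+a. ennreal (cos_ext (\<lambda>_. 1) ((2 * sqrt z) *\<^sub>R circ a) ^ 4 * (cos_ext g ((2 * sqrt z) *\<^sub>R circ a))\<^sup>2) \<partial>T) * indicator {0..} z \<le>
      (\<Sum>m. ennreal (4 * pi * (2 * pi) ^ 4 * w m) * (ennreal (sixth_kernel (2 * Suc m) z) * indicator {0..} z))"
    proof (cases "0 \<le> z")
      case z: True
      define M where "M = (2 * pi * bc 0 z) ^ 4"
      have M: "0 \<le> M" by (simp add: M_def)
      have [measurable]: "(\<lambda>a. cos_ext g ((2 * sqrt z) *\<^sub>R circ a)) \<in> borel_measurable T"
        by (rule measurable_T) measurable
      have "(\<integral>\<^sup>+a. ennreal (cos_ext (\<lambda>_. 1) ((2 * sqrt z) *\<^sub>R circ a) ^ 4 * (cos_ext g ((2 * sqrt z) *\<^sub>R circ a))\<^sup>2) \<partial>T) =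
         (\<integral>\<^sup>+a. ennreal M * ennreal ((cos_ext g ((2 * sqrt z) *\<^sub>R circ a))\<^sup>2) \<partial>T)"
        unfolding cos_ext_one[OF z] M_def[symmetric] by (simp add: ennreal_mult M)
      also have "\<dots> = ennreal M * (\<integral>\<^sup>+a. ennreal ((cos_ext g ((2 * sqrt z) *\<^sub>R circ a))\<^sup>2) \<partial>T)"
        by (rule nn_integral_cmult) measurable
      also have "\<dots> \<le> ennreal M * (\<Sum>m. ennreal (4 * pi * (z ^ (2 * Suc m) * (bc (2 * Suc m) z)\<^sup>2) * w m))"
        unfolding w_def by (intro mult_left_mono cos_ext_angular_square g z) simp
      also have "\<dots> = (\<Sum>m. ennreal M * ennreal (4 * pi * (z ^ (2 * Suc m) * (bc (2 * Suc m) z)\<^sup>2) * w m))"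
        by (rule ennreal_suminf_cmult[symmetric])
      also have "\<dots> = (\<Sum>m. ennreal (4 * pi * (2 * pi) ^ 4 * w m) * ennreal (sixth_kernel (2 * Suc m) z))"
      proof (rule suminf_cong)
        fix m
        have "M * (4 * pi * (z ^ (2 * Suc m) * (bc (2 * Suc m) z)\<^sup>2) * w m) = (4 * pi * (2 * pi) ^ 4 * w m) * sixth_kernel (2 * Suc m) z"
          unfolding M_def sixth_kernel_def power_mult_distrib[of "2 * pi"] by (simp only: mult_ac)
        moreover have "0 \<le> 4 * pi * (z ^ (2 * Suc m) * (bc (2 * Suc m) z)\<^sup>2) * w m"
          using z w_nonneg by (auto intro!: mult_nonneg_nonneg zero_le_power simp del: power_Suc)
        ultimately show "ennreal M * ennreal (4 * pi * (z ^ (2 * Suc m) * (bc (2 * Suc m) z)\<^sup>2) * w m) =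
           ennreal (4 * pi * (2 * pi) ^ 4 * w m) * ennreal (sixth_kernel (2 * Suc m) z)"
          using M w_nonneg[of m] sixth_kernel_nonneg[OF z, of "2 * Suc m"] by (subst (1 2) ennreal_mult[symmetric]) auto
      qed
      finally show ?thesis using z by simp
    qed simp
  qed simp
  also have "(\<integral>\<^sup>+z. (\<Sum>m. ennreal (4 * pi * (2 * pi) ^ 4 * w m) * (ennreal (sixth_kernel (2 * Suc m) z) * indicator {0..} z)) \<partial>lborel) =
      (\<Sum>m. ennreal (4 * pi * (2 * pi) ^ 4 * w m) * (\<integral>\<^sup>+z. ennreal (sixth_kernel (2 * Suc m) z) * indicator {0..} z \<partial>lborel))"
    by (subst nn_integral_suminf) (auto simp: nn_integral_cmult)
  also have "\<dots> \<le> (\<Sum>m. ennreal (4 * pi * (2 * pi) ^ 4 * w m) * ennreal (3 / 100))"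
    by (intro suminf_le mult_left_mono sixth_kernel_even_integral) auto
  also have "\<dots> = (\<Sum>m. ennreal (12 / 100 * pi * (2 * pi) ^ 4 * w m))"
    using w_nonneg by (intro suminf_cong) (simp add: ennreal_mult[symmetric] mult_ac)
  also have "\<dots> \<le> ennreal (12 / 100 * pi * (2 * pi) ^ 4 * (pi * (\<integral>t. (g t)\<^sup>2 \<partial>T)))"
  proof (rule suminf_le_const)
    fix N
    have "(\<Sum>m<N. ennreal (12 / 100 * pi * (2 * pi) ^ 4 * w m)) = ennreal (\<Sum>m<N. 12 / 100 * pi * (2 * pi) ^ 4 * w m)"
      using w_nonneg by (intro sum_ennreal) auto
    also have "(\<Sum>m<N. 12 / 100 * pi * (2 * pi) ^ 4 * w m) = 12 / 100 * pi * (2 * pi) ^ 4 * (\<Sum>m=1..N. (fcos g m)\<^sup>2 + (fsin g m)\<^sup>2)"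
      unfolding sum_distrib_left[symmetric] w_def
      by (intro arg_cong[where f = "\<lambda>x. 12 / 100 * pi * (2 * pi) ^ 4 * x"] sum.reindex_bij_witness[of _ "\<lambda>m. m - 1" Suc]) auto
    also have "ennreal \<dots> \<le> ennreal (12 / 100 * pi * (2 * pi) ^ 4 * (pi * (\<integral>t. (g t)\<^sup>2 \<partial>T)))"
      by (intro ennreal_leI mult_left_mono bessel_inequality g) auto
    finally show "(\<Sum>m<N. ennreal (12 / 100 * pi * (2 * pi) ^ 4 * w m)) \<le> ennreal (12 / 100 * pi * (2 * pi) ^ 4 * (pi * (\<integral>t. (g t)\<^sup>2 \<partial>T)))" .
  qed simp
  finally have "(\<integral>\<^sup>+x. ennreal (cos_ext (\<lambda>_. 1) x ^ 4 * (cos_ext g x)\<^sup>2) \<partial>lborel) \<le>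
     2 * ennreal (12 / 100 * pi * (2 * pi) ^ 4 * (pi * (\<integral>t. (g t)\<^sup>2 \<partial>T)))"
    by (simp add: mult_left_mono)
  also have "\<dots> = ennreal 2 * ennreal (12 / 100 * pi * (2 * pi) ^ 4 * (pi * (\<integral>t. (g t)\<^sup>2 \<partial>T)))"
    by simp
  also have "\<dots> = ennreal (2 * (12 / 100 * pi * (2 * pi) ^ 4 * (pi * (\<integral>t. (g t)\<^sup>2 \<partial>T))))"
    by (rule ennreal_mult[symmetric]) auto
  also have "2 * (12 / 100 * pi * (2 * pi) ^ 4 * (pi * (\<integral>t. (g t)\<^sup>2 \<partial>T))) = 6 / 100 * (2 * pi) ^ 6 * (\<integral>t. (g t)\<^sup>2 \<partial>T)"
    by (simp add: power_mult_distrib eval_nat_numeral)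
  finally show ?thesis .
qed

text \<open>Polar coordinates contribute 2, the six factors 2 pi bc 0 give (2 pi)^6, and the angular
  integral gives one more 2 pi; 306 is twice 153.\<close>

lemma sixth_power_lower_bound:
  "ennreal (306 / 1000 * (2 * pi) ^ 7) \<le> (\<integral>\<^sup>+x. ennreal (cos_ext (\<lambda>_. 1) x ^ 6) \<partial>lborel)"
proof -
  have "(\<integral>\<^sup>+x. ennreal (cos_ext (\<lambda>_. 1) x ^ 6) \<partial>lborel) =
    2 * (\<integral>\<^sup>+z. (\<integral>\<^sup>+a. ennreal (cos_ext (\<lambda>_. 1) ((2 * sqrt z) *\<^sub>R circ a) ^ 6) \<partial>T) * indicator {0..} z \<partial>lborel)"
    by (rule nn_integral_polar) measurable
  also have "\<dots> = 2 * (\<integral>\<^sup>+z. ennreal ((2 * pi) ^ 7) * (ennreal (bc 0 z ^ 6) * indicator {0..} z) \<partial>lborel)"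
  proof (intro arg_cong[where f = "\<lambda>x. 2 * x"] nn_integral_cong)
    fix z :: real
    show "(\<integral>\<^sup>+a. ennreal (cos_ext (\<lambda>_. 1) ((2 * sqrt z) *\<^sub>R circ a) ^ 6) \<partial>T) * indicator {0..} z =
      ennreal ((2 * pi) ^ 7) * (ennreal (bc 0 z ^ 6) * indicator {0..} z)"
    proof (cases "0 \<le> z")
      case z: True
      have "(\<integral>\<^sup>+a. ennreal (cos_ext (\<lambda>_. 1) ((2 * sqrt z) *\<^sub>R circ a) ^ 6) \<partial>T) = ennreal ((2 * pi * bc 0 z) ^ 6) * ennreal (2 * pi)"
        unfolding cos_ext_one[OF z] using emeasure_T by simp
      also have "\<dots> = ennreal ((2 * pi) ^ 7) * ennreal (bc 0 z ^ 6)"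
      proof -
        have "(2 * pi * bc 0 z) ^ 6 * (2 * pi) = (2 * pi) ^ 7 * bc 0 z ^ 6" by algebra
        moreover have "0 \<le> (2 * pi * bc 0 z) ^ 6" "0 \<le> bc 0 z ^ 6" "0 \<le> (2 * pi) ^ 7" "0 \<le> 2 * pi" by simp_all
        ultimately show ?thesis by (metis ennreal_mult)
      qed
      finally show ?thesis using z by simp
    qed simp
  qed
  also have "\<dots> = 2 * (ennreal ((2 * pi) ^ 7) * (\<integral>\<^sup>+z. ennreal (bc 0 z ^ 6) * indicator {0..} z \<partial>lborel))"
    by (subst nn_integral_cmult) auto
  also have "\<dots> \<ge> 2 * (ennreal ((2 * pi) ^ 7) * ennreal (153 / 1000))"
    by (intro mult_left_mono sixth_kernel_0_integral_lower) auto
  also have "2 * (ennreal ((2 * pi) ^ 7) * ennreal (153 / 1000)) = ennreal 2 * (ennreal ((2 * pi) ^ 7) * ennreal (153 / 1000))"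
    by simp
  also have "\<dots> = ennreal (2 * ((2 * pi) ^ 7 * (153 / 1000)))"
    by (subst ennreal_mult[symmetric], simp, simp, subst ennreal_mult[symmetric], simp, simp, rule refl)
  also have "2 * ((2 * pi) ^ 7 * (153 / 1000)) = 306 / 1000 * (2 * pi) ^ 7" by simp
  finally show ?thesis .
qed

section \<open>Local maximality of the constants\<close>

text \<open>The sine part of the exponential is odd under t to t + pi and integrates to 0 against
  g.\<close>

lemma circle_ext_real:
  assumes g: "integrable T g" and [measurable]: "g \<in> borel_measurable borel" and anti: "\<And>t. g (t + pi) = g t"
  shows "circle_ext (\<lambda>t. complex_of_real (g t)) x = complex_of_real (cos_ext g x)"
proof -
  have i: "integrable T (\<lambda>t. g t * cos (x \<bullet> circ t))" "integrable T (\<lambda>t. g t * sin (x \<bullet> circ t))"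
    by (rule integrable_T_mult_bounded[OF g]; simp)+
  have "periodic (\<lambda>t. g t * sin (x \<bullet> circ t))"
    using antipodal_periodic[of g, OF anti] by (simp add: periodic_def)
  then have "(\<integral>t. g (t + pi) * sin (x \<bullet> circ (t + pi)) \<partial>T) = (\<integral>t. g t * sin (x \<bullet> circ t) \<partial>T)"
    by (intro integral_T_shift[of "\<lambda>t. g t * sin (x \<bullet> circ t)"]) auto
  then have zero: "(\<integral>t. g t * sin (x \<bullet> circ t) \<partial>T) = 0"
    by (simp add: anti circ_add_pi)
  have "complex_of_real (g t) * exp (- \<i> * complex_of_real (x \<bullet> circ t)) =
      complex_of_real (g t * cos (x \<bullet> circ t)) - \<i> * complex_of_real (g t * sin (x \<bullet> circ t))" for t
    by (simp add: complex_eq_iff Re_exp Im_exp)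
  then have "circle_ext (\<lambda>t. complex_of_real (g t)) x =
      (\<integral>t. complex_of_real (g t * cos (x \<bullet> circ t)) - \<i> * complex_of_real (g t * sin (x \<bullet> circ t)) \<partial>T)"
    by (simp only: ext_def)
  also have "\<dots> = complex_of_real (\<integral>t. g t * cos (x \<bullet> circ t) \<partial>T) - \<i> * complex_of_real (\<integral>t. g t * sin (x \<bullet> circ t) \<partial>T)"
    unfolding integral_complex_of_real[symmetric] integral_mult_right_zero[symmetric]
    by (rule Bochner_Integration.integral_diff) (intro integrable_mult_right integrable_of_real i)+
  finally show ?thesis by (simp add: zero cos_ext_def)
qed

lemma real_circle_L2:
  fixes g :: "real \<Rightarrow> real"
  assumes "g \<in> borel_measurable borel" "\<And>t. g (t + pi) = g t" "integrable T (\<lambda>t. (g t)\<^sup>2)"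
  shows "circle_L2 (\<lambda>t. complex_of_real (g t))"
  unfolding circle_L2_def using assms antipodal_periodic[of "\<lambda>t. complex_of_real (g t)"] by auto

lemma ext6_real:
  fixes g :: "real \<Rightarrow> real"
  assumes "g \<in> borel_measurable borel" "\<And>t. g (t + pi) = g t" "integrable T (\<lambda>t. (g t)\<^sup>2)"
  shows "ext6 (\<lambda>t. complex_of_real (g t)) = (\<integral>\<^sup>+x. ennreal (cos_ext g x ^ 6) \<partial>lborel)"
proof -
  have "integrable T g"
    by (rule integrable_T_of_square) (simp_all add: assms)
  note real = circle_ext_real[OF this assms(1,2)]
  have "norm (circle_ext (\<lambda>t. complex_of_real (g t)) x) ^ 6 = cos_ext g x ^ 6" for x
    unfolding real by simp
  then show ?thesis unfolding ext6_def by simp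
qed

lemma cos_ext_sixth_power:
  fixes g :: "real \<Rightarrow> real"
  assumes [measurable]: "g \<in> borel_measurable borel" and "\<And>t. g (t + pi) = g t" "integrable T (\<lambda>t. (g t)\<^sup>2)"
  shows "integrable lborel (\<lambda>x. cos_ext g x ^ 6)"
    and "(\<integral>x. cos_ext g x ^ 6 \<partial>lborel) \<le> 82 * (192 * pi ^ 3 + 400 * pi * (2 * pi) ^ 3) * (\<integral>t. (g t)\<^sup>2 \<partial>T) ^ 3"
    and "ext6 (\<lambda>t. complex_of_real (g t)) = ennreal (\<integral>x. cos_ext g x ^ 6 \<partial>lborel)"
proof -
  let ?C = "82 * (192 * pi ^ 3 + 400 * pi * (2 * pi) ^ 3) * (\<integral>t. (g t)\<^sup>2 \<partial>T) ^ 3"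
  have le: "(\<integral>\<^sup>+x. ennreal (cos_ext g x ^ 6) \<partial>lborel) \<le> ennreal ?C"
    using tomas_stein[OF real_circle_L2[OF assms]] unfolding ext6_real[OF assms] by simp
  show int: "integrable lborel (\<lambda>x. cos_ext g x ^ 6)"
  proof (rule integrableI_nonneg)
    show "(\<integral>\<^sup>+x. ennreal (cos_ext g x ^ 6) \<partial>lborel) < \<infinity>"
      using le by (rule order_le_less_trans) simp
  qed auto
  have eq: "(\<integral>\<^sup>+x. ennreal (cos_ext g x ^ 6) \<partial>lborel) = ennreal (\<integral>x. cos_ext g x ^ 6 \<partial>lborel)"
    by (rule nn_integral_eq_integral[OF int]) simp
  show "ext6 (\<lambda>t. complex_of_real (g t)) = ennreal (\<integral>x. cos_ext g x ^ 6 \<partial>lborel)"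
    unfolding ext6_real[OF assms] eq ..
  have "0 \<le> (\<integral>t. (g t)\<^sup>2 \<partial>T)" by (rule Bochner_Integration.integral_nonneg) simp
  then have "0 \<le> ?C" by (intro mult_nonneg_nonneg add_nonneg_nonneg zero_le_power) auto
  then show "(\<integral>x. cos_ext g x ^ 6 \<partial>lborel) \<le> ?C"
    using le unfolding eq by (simp add: ennreal_le_iff)
qed

section \<open>The first variation\<close>

text \<open>By Fubini the average over the angle a no longer depends on t, which leaves the mean of
  g as a factor.\<close>

lemma cos_ext_orbit_zero:
  assumes [measurable]: "g \<in> borel_measurable borel" and g: "integrable T g" "(\<integral>t. g t \<partial>T) = 0"
  shows "(\<integral>a. cos_ext g (r *\<^sub>R circ a) \<partial>T) = 0"
proof -
  have [measurable]: "g \<in> borel_measurable T" by (rule measurable_T) measurable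
  have int: "integrable (T \<Otimes>\<^sub>M T) (\<lambda>(t, a). g t * cos (r * cos (t - a)))"
  proof (rule Bochner_Integration.integrable_bound)
    show "integrable (T \<Otimes>\<^sub>M T) (\<lambda>p. g (fst p) * 1)"
      using TT.integrable_pair_mult(1)[OF g(1), of "\<lambda>_. 1"] by simp
    have [measurable]: "(\<lambda>t. t) \<in> borel_measurable T" by (rule measurable_T) simp
    have [measurable]: "fst \<in> borel_measurable (T \<Otimes>\<^sub>M T)" "snd \<in> borel_measurable (T \<Otimes>\<^sub>M T)"
      using measurable_compose[OF measurable_fst \<open>(\<lambda>t. t) \<in> borel_measurable T\<close>] measurable_compose[OF measurable_snd \<open>(\<lambda>t. t) \<in> borel_measurable T\<close>]
      by simp_all
    have "(\<lambda>p. g (fst p)) \<in> borel_measurable (T \<Otimes>\<^sub>M T)"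
      by (rule measurable_compose[OF measurable_fst]) measurable
    then show "(\<lambda>(t, a). g t * cos (r * cos (t - a))) \<in> borel_measurable (T \<Otimes>\<^sub>M T)"
      unfolding split_beta' by measurable
  qed (auto simp: abs_mult mult_left_le)
  have shift: "(\<integral>a. cos (r * cos (t - a)) \<partial>T) = (\<integral>a. cos (r * cos a) \<partial>T)" for t
    using integral_T_shift[of "\<lambda>a. cos (r * cos a)" "- t"] cos_minus[of "t - _"]
    by (simp add: periodic_def)
  have "(\<integral>a. cos_ext g (r *\<^sub>R circ a) \<partial>T) = (\<integral>a. (\<integral>t. g t * cos (r * cos (t - a)) \<partial>T) \<partial>T)"
    by (simp add: cos_ext_def inner_circ_circ)
  also have "\<dots> = (\<integral>t. (\<integral>a. g t * cos (r * cos (t - a)) \<partial>T) \<partial>T)"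
    by (rule TT.Fubini_integral[OF int])
  also have "\<dots> = (\<integral>t. g t * (\<integral>a. cos (r * cos a) \<partial>T) \<partial>T)"
    by (simp add: shift)
  also have "\<dots> = 0" using g by simp
  finally show ?thesis .
qed

lemma integral_eq_0_of_rot_average:
  fixes P :: "real^2 \<Rightarrow> real"
  assumes P: "integrable lborel P" and zero: "\<And>x. (\<integral>a. P (rot a x) \<partial>T) = 0"
  shows "(\<integral>x. P x \<partial>lborel) = 0"
proof -
  interpret TL: pair_sigma_finite T "lborel :: (real^2) measure" ..
  have [measurable]: "P \<in> borel_measurable borel" using P by auto
  have rot: "(\<integral>x. f (rot a x) \<partial>lborel) = (\<integral>x. f x \<partial>lborel)" if [measurable]: "f \<in> borel_measurable borel" for a and f :: "real^2 \<Rightarrow> real"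
  proof -
    have "(\<integral>x. f x \<partial>lborel) = (\<integral>x. f x \<partial>distr lborel borel (rot a))" by (simp add: distr_lborel_rot)
    also have "\<dots> = (\<integral>x. f (rot a x) \<partial>lborel)" by (rule integral_distr) measurable
    finally show ?thesis ..
  qed
  have rot_int: "integrable lborel (\<lambda>x. P (rot a x))" for a
  proof -
    have "integrable (distr lborel borel (rot a)) P" using P by (simp add: distr_lborel_rot)
    then show ?thesis by (subst (asm) integrable_distr_eq) auto
  qed
  have "fst \<in> T \<Otimes>\<^sub>M (lborel :: (real^2) measure) \<rightarrow>\<^sub>M borel"
    by (rule measurable_compose[OF measurable_fst measurable_T[OF measurable_ident_sets[OF refl]]])
  moreover have "snd \<in> T \<Otimes>\<^sub>M (lborel :: (real^2) measure) \<rightarrow>\<^sub>M borel"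
    using measurable_snd[of T "lborel :: (real^2) measure"] by simp
  ultimately have "(\<lambda>p. (fst p, snd p)) \<in> T \<Otimes>\<^sub>M (lborel :: (real^2) measure) \<rightarrow>\<^sub>M borel \<Otimes>\<^sub>M borel"
    by (rule measurable_Pair)
  from measurable_compose[OF this, of "\<lambda>p. P (rot (fst p) (snd p))" borel]
  have meas: "(\<lambda>p. P (rot (fst p) (snd p))) \<in> borel_measurable (T \<Otimes>\<^sub>M (lborel :: (real^2) measure))"
    using measurable_compose[OF rot_measurable2] by (simp add: borel_prod)
  have int: "integrable (T \<Otimes>\<^sub>M lborel) (case_prod (\<lambda>a x. P (rot a x)))"
    unfolding split_beta'
  proof (rule TL.Fubini_integrable[OF meas])
    have "(\<integral>x. norm (P (rot a x)) \<partial>lborel) = (\<integral>x. norm (P x) \<partial>lborel)" for a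
      by (rule rot) measurable
    then show "integrable T (\<lambda>a. \<integral>x. norm (P (rot (fst (a, x)) (snd (a, x)))) \<partial>lborel)" by simp
  qed (use rot_int in simp)
  have "2 * pi * (\<integral>x. P x \<partial>lborel) = (\<integral>a. (\<integral>x. P (rot a x) \<partial>lborel) \<partial>T)"
    by (simp add: rot)
  also have "\<dots> = (\<integral>x. (\<integral>a. P (rot a x) \<partial>T) \<partial>lborel)"
    by (rule TL.Fubini_integral[OF int, symmetric])
  also have "\<dots> = 0" by (simp add: zero)
  finally show ?thesis by simp
qed

lemma cos_ext_one_circ: "cos_ext (\<lambda>_. 1) (r *\<^sub>R circ a) = cos_ext (\<lambda>_. 1) (r *\<^sub>R circ b)" if "0 \<le> r"
proof -
  have "2 * sqrt (r\<^sup>2 / 4) = r" using that by (simp add: real_sqrt_divide)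
  then show ?thesis
    using cos_ext_one[of "r\<^sup>2 / 4" a] cos_ext_one[of "r\<^sup>2 / 4" b] by simp
qed

text \<open>The extension of 1 is radial, so on each circle its fifth power is a constant in front
  of an average that vanishes.\<close>

lemma first_variation:
  assumes [measurable]: "g \<in> borel_measurable borel" and g: "integrable T g" "(\<integral>t. g t \<partial>T) = 0"
    and int: "integrable lborel (\<lambda>x. cos_ext (\<lambda>_. 1) x ^ 5 * cos_ext g x)"
  shows "(\<integral>x. cos_ext (\<lambda>_. 1) x ^ 5 * cos_ext g x \<partial>lborel) = 0"
proof (rule integral_eq_0_of_rot_average[OF int])
  fix x :: "real^2"
  obtain b where b: "x = norm x *\<^sub>R circ b" by (rule circ_polar)
  have rx: "rot a x = norm x *\<^sub>R circ (a + b)" for a by (subst b) (simp only: rot_circ)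
  have "cos_ext (\<lambda>_. 1) (rot a x) = cos_ext (\<lambda>_. 1) x" for a
    unfolding rx using cos_ext_one_circ[of "norm x" "a + b" b] b by simp
  then have "(\<integral>a. cos_ext (\<lambda>_. 1) (rot a x) ^ 5 * cos_ext g (rot a x) \<partial>T) =
      cos_ext (\<lambda>_. 1) x ^ 5 * (\<integral>a. cos_ext g (norm x *\<^sub>R circ (a + b)) \<partial>T)"
    by (simp add: rx)
  also have "(\<integral>a. cos_ext g (norm x *\<^sub>R circ (a + b)) \<partial>T) = (\<integral>a. cos_ext g (norm x *\<^sub>R circ a) \<partial>T)"
    by (rule integral_T_shift[of "\<lambda>a. cos_ext g (norm x *\<^sub>R circ a)"]) (simp_all add: periodic_def)
  also have "\<dots> = 0" by (rule cos_ext_orbit_zero) (simp_all add: g)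
  finally show "(\<integral>a. cos_ext (\<lambda>_. 1) (rot a x) ^ 5 * cos_ext g (rot a x) \<partial>T) = 0" by simp
qed

section \<open>Expansion to second order\<close>

lemma mixed_power_le:
  fixes a b :: real
  assumes "k \<le> 6"
  shows "\<bar>a ^ (6 - k) * b ^ k\<bar> \<le> a ^ 6 + b ^ 6"
proof -
  define m where "m = max \<bar>a\<bar> \<bar>b\<bar>"
  have "\<bar>a ^ (6 - k) * b ^ k\<bar> \<le> m ^ (6 - k) * m ^ k"
    unfolding abs_mult power_abs by (intro mult_mono power_mono) (auto simp: m_def)
  also have "\<dots> = m ^ 6" using assms by (simp flip: power_add)
  also have "\<dots> \<le> \<bar>a\<bar> ^ 6 + \<bar>b\<bar> ^ 6" by (auto simp: m_def max_def)
  finally show ?thesis by simp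
qed

text \<open>The binomial coefficients of the terms of order at least 3 add up to 20 + 15 + 6 + 1 =
  42; each such term is at most \<tau>^3 (a^6 + b^6) because \<tau> \<le> 1.\<close>

lemma sextic_remainder:
  fixes a b \<tau> :: real
  assumes "0 < \<tau>" "\<tau> \<le> 1"
  shows "(a + \<tau> * b) ^ 6 \<le> a ^ 6 + 6 * (a ^ 5 * (\<tau> * b)) + 15 * (a ^ 4 * (\<tau> * b)\<^sup>2) + 42 * \<tau> ^ 3 * (a ^ 6 + b ^ 6)"
proof -
  define M where "M = a ^ 6 + b ^ 6"
  have M: "0 \<le> M" by (simp add: M_def)
  have p: "\<tau> ^ k \<le> \<tau> ^ 3" if "3 \<le> k" for k
    using that assms by (intro power_decreasing) auto
  have t: "\<tau> ^ k * (a ^ (6 - k) * b ^ k) \<le> \<tau> ^ 3 * M" if "3 \<le> k" "k \<le> 6" for k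
  proof -
    have "\<tau> ^ k * (a ^ (6 - k) * b ^ k) \<le> \<tau> ^ k * M"
      using mixed_power_le[OF that(2), of a b] assms by (intro mult_left_mono) (auto simp: M_def)
    also have "\<dots> \<le> \<tau> ^ 3 * M" using p[OF that(1)] M by (intro mult_right_mono)
    finally show ?thesis .
  qed
  have "(a + \<tau> * b) ^ 6 = a ^ 6 + 6 * (a ^ 5 * (\<tau> * b)) + 15 * (a ^ 4 * (\<tau> * b)\<^sup>2) +
      (20 * (\<tau> ^ 3 * (a ^ (6 - 3) * b ^ 3)) + 15 * (\<tau> ^ 4 * (a ^ (6 - 4) * b ^ 4)) +
       6 * (\<tau> ^ 5 * (a ^ (6 - 5) * b ^ 5)) + \<tau> ^ 6 * (a ^ (6 - 6) * b ^ 6))"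
    by (simp add: eval_nat_numeral algebra_simps)
  then show ?thesis
    using t[of 3] t[of 4] t[of 5] t[of 6] unfolding M_def[symmetric] by simp
qed

text \<open>The linear term vanishes and the quadratic one contributes 15 * 6/100 = 9/10.\<close>

lemma second_variation:
  defines "S \<equiv> (\<integral>x. cos_ext (\<lambda>_. 1) x ^ 6 \<partial>lborel)" and "C \<equiv> 82 * (192 * pi ^ 3 + 400 * pi * (2 * pi) ^ 3)"
  assumes [measurable]: "g \<in> borel_measurable borel" and anti: "\<And>t. g (t + pi) = g t"
    and g: "integrable T (\<lambda>t. (g t)\<^sup>2)" "(\<integral>t. g t \<partial>T) = 0"
    and \<tau>: "(\<integral>t. (g t)\<^sup>2 \<partial>T) = \<tau>\<^sup>2" "0 < \<tau>" "\<tau> \<le> 1"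
  shows "(\<integral>x. (cos_ext (\<lambda>_. 1) x + cos_ext g x) ^ 6 \<partial>lborel) \<le> S + 9 / 10 * (2 * pi) ^ 6 * \<tau>\<^sup>2 + 42 * \<tau> ^ 3 * (S + C)"
proof -
  let ?\<mu> = "cos_ext (\<lambda>_. 1)" and ?\<gamma> = "cos_ext g"
  \<comment> \<open>Normalized by the L2 norm of g, the extension has sixth power integral at most C
    by Tomas-Stein, which makes the remainder cubic in \<tau>.\<close>
  define \<eta> where "\<eta> x = ?\<gamma> x / \<tau>" for x
  have ge: "?\<gamma> x = \<tau> * \<eta> x" for x using \<tau> by (simp add: \<eta>_def)
  have gi: "integrable T g" by (rule integrable_T_of_square) (simp_all add: g(1))
  have \<mu>6: "integrable lborel (\<lambda>x. ?\<mu> x ^ 6)"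
    using cos_ext_sixth_power(1)[of "\<lambda>_. 1"] by simp
  note \<gamma>6 = cos_ext_sixth_power(1,2)[OF assms(3) anti g(1)]
  have \<eta>6: "integrable lborel (\<lambda>x. \<eta> x ^ 6)"
    using \<gamma>6(1) by (simp add: \<eta>_def power_divide)
  have \<eta>C: "(\<integral>x. \<eta> x ^ 6 \<partial>lborel) \<le> C"
  proof -
    have "(\<integral>x. ?\<gamma> x ^ 6 \<partial>lborel) \<le> C * (\<tau>\<^sup>2) ^ 3" using \<gamma>6(2) unfolding \<tau>(1) C_def .
    then have "(\<integral>x. ?\<gamma> x ^ 6 \<partial>lborel) / \<tau> ^ 6 \<le> C" using \<tau>(2) by (simp add: divide_le_eq flip: power_mult)
    then show ?thesis by (simp add: \<eta>_def power_divide)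
  qed
  have [measurable]: "?\<mu> \<in> borel_measurable borel" "?\<gamma> \<in> borel_measurable borel" by measurable
  have mixed: "integrable lborel (\<lambda>x. ?\<mu> x ^ (6 - k) * ?\<gamma> x ^ k)" if "k \<le> 6" for k
  proof (rule Bochner_Integration.integrable_bound)
    show "integrable lborel (\<lambda>x. ?\<mu> x ^ 6 + ?\<gamma> x ^ 6)" using \<mu>6 \<gamma>6(1) by simp
    show "AE x in lborel. norm (?\<mu> x ^ (6 - k) * ?\<gamma> x ^ k) \<le> norm (?\<mu> x ^ 6 + ?\<gamma> x ^ 6)"
      using mixed_power_le[OF that] by (intro AE_I2) (simp only: real_norm_def, metis abs_ge_self order_trans)
  qed measurable
  have i1: "integrable lborel (\<lambda>x. ?\<mu> x ^ 5 * ?\<gamma> x)" using mixed[of 1] by simp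
  have i2: "integrable lborel (\<lambda>x. ?\<mu> x ^ 4 * (?\<gamma> x)\<^sup>2)" using mixed[of 2] by simp
  have Q: "(\<integral>x. ?\<mu> x ^ 4 * (?\<gamma> x)\<^sup>2 \<partial>lborel) \<le> 6 / 100 * (2 * pi) ^ 6 * \<tau>\<^sup>2"
  proof -
    have "ennreal (\<integral>x. ?\<mu> x ^ 4 * (?\<gamma> x)\<^sup>2 \<partial>lborel) = (\<integral>\<^sup>+x. ennreal (?\<mu> x ^ 4 * (?\<gamma> x)\<^sup>2) \<partial>lborel)"
      by (rule nn_integral_eq_integral[OF i2, symmetric]) simp
    also have "\<dots> \<le> ennreal (6 / 100 * (2 * pi) ^ 6 * \<tau>\<^sup>2)"
      using quadratic_form_bound[OF assms(3) gi g] unfolding \<tau>(1) .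
    finally show ?thesis by (subst (asm) ennreal_le_iff) auto
  qed
  have "(\<integral>x. (?\<mu> x + ?\<gamma> x) ^ 6 \<partial>lborel) \<le>
     (\<integral>x. (?\<mu> x ^ 6 + 6 * (?\<mu> x ^ 5 * ?\<gamma> x)) + (15 * (?\<mu> x ^ 4 * (?\<gamma> x)\<^sup>2) + 42 * \<tau> ^ 3 * (?\<mu> x ^ 6 + \<eta> x ^ 6)) \<partial>lborel)"
  proof (rule integral_mono_AE')
    show "integrable lborel (\<lambda>x. (?\<mu> x ^ 6 + 6 * (?\<mu> x ^ 5 * ?\<gamma> x)) + (15 * (?\<mu> x ^ 4 * (?\<gamma> x)\<^sup>2) + 42 * \<tau> ^ 3 * (?\<mu> x ^ 6 + \<eta> x ^ 6)))"
      by (intro Bochner_Integration.integrable_add integrable_mult_right \<mu>6 \<eta>6 i1 i2)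
    have le: "(?\<mu> x + ?\<gamma> x) ^ 6 \<le> (?\<mu> x ^ 6 + 6 * (?\<mu> x ^ 5 * ?\<gamma> x)) + (15 * (?\<mu> x ^ 4 * (?\<gamma> x)\<^sup>2) + 42 * \<tau> ^ 3 * (?\<mu> x ^ 6 + \<eta> x ^ 6))" for x
      using sextic_remainder[OF \<tau>(2,3)] unfolding ge by (simp only: add.assoc)
    show "AE x in lborel. (?\<mu> x + ?\<gamma> x) ^ 6 \<le> (?\<mu> x ^ 6 + 6 * (?\<mu> x ^ 5 * ?\<gamma> x)) + (15 * (?\<mu> x ^ 4 * (?\<gamma> x)\<^sup>2) + 42 * \<tau> ^ 3 * (?\<mu> x ^ 6 + \<eta> x ^ 6))"
      using le by (rule AE_I2)
    have "0 \<le> (?\<mu> x + ?\<gamma> x) ^ 6" for x by simp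
    then have "0 \<le> (?\<mu> x ^ 6 + 6 * (?\<mu> x ^ 5 * ?\<gamma> x)) + (15 * (?\<mu> x ^ 4 * (?\<gamma> x)\<^sup>2) + 42 * \<tau> ^ 3 * (?\<mu> x ^ 6 + \<eta> x ^ 6))" for x
      using le by (rule order_trans)
    then show "AE x in lborel. 0 \<le> (?\<mu> x ^ 6 + 6 * (?\<mu> x ^ 5 * ?\<gamma> x)) + (15 * (?\<mu> x ^ 4 * (?\<gamma> x)\<^sup>2) + 42 * \<tau> ^ 3 * (?\<mu> x ^ 6 + \<eta> x ^ 6))" by (rule AE_I2)
  qed
  also have "\<dots> = (S + 6 * 0) + (15 * (\<integral>x. ?\<mu> x ^ 4 * (?\<gamma> x)\<^sup>2 \<partial>lborel) + 42 * \<tau> ^ 3 * (S + (\<integral>x. \<eta> x ^ 6 \<partial>lborel)))"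
    using first_variation[OF assms(3) gi g(2) i1] \<mu>6 \<eta>6 i1 i2 by (simp add: S_def)
  also have "\<dots> \<le> (S + 6 * 0) + (15 * (6 / 100 * (2 * pi) ^ 6 * \<tau>\<^sup>2) + 42 * \<tau> ^ 3 * (S + C))"
    using Q \<eta>C \<tau>(2) by (intro add_mono mult_left_mono order_refl) auto
  finally show ?thesis by (simp add: mult_ac)
qed

definition const_ext6 :: real where
  "const_ext6 = (\<integral>x. cos_ext (\<lambda>_. 1) x ^ 6 \<partial>lborel)"

lemma const_ext6_lower: "306 / 1000 * (2 * pi) ^ 7 \<le> const_ext6"
proof -
  have "integrable lborel (\<lambda>x. cos_ext (\<lambda>_. 1) x ^ 6)"
    using cos_ext_sixth_power(1)[of "\<lambda>_. 1"] by simp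
  then have "(\<integral>\<^sup>+x. ennreal (cos_ext (\<lambda>_. 1) x ^ 6) \<partial>lborel) = ennreal const_ext6"
    unfolding const_ext6_def by (rule nn_integral_eq_integral) simp
  moreover have "0 \<le> const_ext6" unfolding const_ext6_def by (rule Bochner_Integration.integral_nonneg) simp
  ultimately show ?thesis using sixth_power_lower_bound by (simp add: ennreal_le_iff)
qed

lemma cos_ext_linear:
  assumes "integrable T g" "integrable T f"
  shows "cos_ext (\<lambda>t. g t + f t) x = cos_ext g x + cos_ext f x"
  unfolding cos_ext_def distrib_right
  by (rule Bochner_Integration.integral_add; rule integrable_T_mult_bounded) (use assms in auto)

lemma cos_ext_cmult: "cos_ext (\<lambda>t. c * g t) x = c * cos_ext g x"
  unfolding cos_ext_def mult.assoc by (rule integral_mult_right_zero)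

lemma cos_ext_eq_0:
  assumes "integrable T (\<lambda>t. (g t)\<^sup>2)" "(\<integral>t. (g t)\<^sup>2 \<partial>T) = 0"
  shows "cos_ext g x = 0"
proof -
  have "AE t in T. (g t)\<^sup>2 = 0"
    using integral_nonneg_eq_0_iff_AE[OF assms(1)] assms(2) by simp
  then have "AE t in T. g t * cos (x \<bullet> circ t) = 0" by eventually_elim simp
  then show ?thesis unfolding cos_ext_def by (rule integral_eq_zero_AE)
qed

text \<open>The right side grows by at least 3 \<open>const_ext6\<close> \<tau>^2 / (2 pi), that is
  by 918/1000 (2 pi)^6 \<tau>^2, and the quadratic term costs only 900/1000 of the same
  unit.\<close>

lemma perturbation_bound:
  obtains \<tau>\<^sub>0 :: real where "0 < \<tau>\<^sub>0" "\<And>g. \<lbrakk>g \<in> borel_measurable borel; \<And>t. g (t + pi) = g t; integrable T (\<lambda>t. (g t)\<^sup>2);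
      (\<integral>t. g t \<partial>T) = 0; (\<integral>t. (g t)\<^sup>2 \<partial>T) \<le> \<tau>\<^sub>0\<^sup>2\<rbrakk> \<Longrightarrow>
      (\<integral>x. (cos_ext (\<lambda>_. 1) x + cos_ext g x) ^ 6 \<partial>lborel) \<le> const_ext6 * (1 + (\<integral>t. (g t)\<^sup>2 \<partial>T) / (2 * pi)) ^ 3"
proof -
  define C :: real where "C = 82 * (192 * pi ^ 3 + 400 * pi * (2 * pi) ^ 3)"
  have "0 < C" unfolding C_def by (intro mult_pos_pos add_pos_pos) auto
  have S: "306 / 1000 * (2 * pi) ^ 7 \<le> const_ext6" by (rule const_ext6_lower)
  then have "0 < const_ext6" by (rule less_le_trans[rotated]) simp
  \<comment> \<open>The surplus 18/1000 has to absorb the cubic remainder.\<close>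
  define \<tau>\<^sub>0 where "\<tau>\<^sub>0 = min 1 (18 / 1000 * (2 * pi) ^ 6 / (42 * (const_ext6 + C)))"
  have \<tau>\<^sub>0: "0 < \<tau>\<^sub>0" unfolding \<tau>\<^sub>0_def using \<open>0 < C\<close> \<open>0 < const_ext6\<close> by simp
  have main: "(\<integral>x. (cos_ext (\<lambda>_. 1) x + cos_ext g x) ^ 6 \<partial>lborel) \<le> const_ext6 * (1 + (\<integral>t. (g t)\<^sup>2 \<partial>T) / (2 * pi)) ^ 3"
    if g: "g \<in> borel_measurable borel" "\<And>t. g (t + pi) = g t" "integrable T (\<lambda>t. (g t)\<^sup>2)" "(\<integral>t. g t \<partial>T) = 0"
      and small: "(\<integral>t. (g t)\<^sup>2 \<partial>T) \<le> \<tau>\<^sub>0\<^sup>2" for g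
  proof (cases "(\<integral>t. (g t)\<^sup>2 \<partial>T) = 0")
    case True
    then show ?thesis using cos_ext_eq_0[OF g(3)] by (simp add: const_ext6_def)
  next
    case False
    define \<tau> where "\<tau> = sqrt (\<integral>t. (g t)\<^sup>2 \<partial>T)"
    have "0 \<le> (\<integral>t. (g t)\<^sup>2 \<partial>T)" by (rule Bochner_Integration.integral_nonneg) simp
    then have \<tau>: "(\<integral>t. (g t)\<^sup>2 \<partial>T) = \<tau>\<^sup>2" "0 < \<tau>"
      using False by (simp_all add: \<tau>_def order_less_le)
    have "\<tau> \<le> \<tau>\<^sub>0" by (rule power2_le_imp_le[OF small[unfolded \<tau>(1)] less_imp_le[OF \<tau>\<^sub>0]])
    then have \<tau>1: "\<tau> \<le> 1" and "\<tau> \<le> 18 / 1000 * (2 * pi) ^ 6 / (42 * (const_ext6 + C))" by (auto simp: \<tau>\<^sub>0_def)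
    then have "42 * \<tau> * (const_ext6 + C) \<le> 18 / 1000 * (2 * pi) ^ 6"
      using \<open>0 < C\<close> \<open>0 < const_ext6\<close> by (simp add: pos_le_divide_eq mult_ac)
    then have rem: "\<tau>\<^sup>2 * (42 * \<tau> * (const_ext6 + C)) \<le> \<tau>\<^sup>2 * (18 / 1000 * (2 * pi) ^ 6)"
      by (rule mult_left_mono) simp
    have "3 / (2 * pi) * (306 / 1000 * (2 * pi) ^ 7) * \<tau>\<^sup>2 \<le> 3 / (2 * pi) * const_ext6 * \<tau>\<^sup>2"
      using S by (intro mult_right_mono mult_left_mono) auto
    also have "3 / (2 * pi) * (306 / 1000 * (2 * pi) ^ 7) * \<tau>\<^sup>2 = \<tau>\<^sup>2 * (918 / 1000 * (2 * pi) ^ 6)"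
      by (simp add: power_Suc[of "2 * pi" 6, simplified])
    finally have gain: "\<tau>\<^sup>2 * (918 / 1000 * (2 * pi) ^ 6) \<le> 3 / (2 * pi) * const_ext6 * \<tau>\<^sup>2" .
    have "(\<integral>x. (cos_ext (\<lambda>_. 1) x + cos_ext g x) ^ 6 \<partial>lborel) \<le>
        const_ext6 + 9 / 10 * (2 * pi) ^ 6 * \<tau>\<^sup>2 + 42 * \<tau> ^ 3 * (const_ext6 + C)"
      using second_variation[OF g \<tau> \<tau>1] unfolding const_ext6_def C_def .
    also have "\<dots> = const_ext6 + \<tau>\<^sup>2 * (9 / 10 * (2 * pi) ^ 6) + \<tau>\<^sup>2 * (42 * \<tau> * (const_ext6 + C))"
      by (simp add: power2_eq_square power3_eq_cube algebra_simps)
    also have "\<dots> \<le> const_ext6 + \<tau>\<^sup>2 * (918 / 1000 * (2 * pi) ^ 6)"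
      using rem by (simp add: algebra_simps)
    also have "\<dots> \<le> const_ext6 * (1 + 3 * (\<tau>\<^sup>2 / (2 * pi)))"
      using gain by (simp add: algebra_simps)
    also have "\<dots> \<le> const_ext6 * (1 + \<tau>\<^sup>2 / (2 * pi)) ^ 3"
    proof (rule mult_left_mono)
      \<comment> \<open>Bernoulli's inequality returns from the linearized gain to the full
        cube.\<close>
      have "-1 \<le> \<tau>\<^sup>2 / (2 * pi)" by (rule order_trans[of _ 0]) auto
      from Bernoulli_inequality[OF this, of 3]
      show "1 + 3 * (\<tau>\<^sup>2 / (2 * pi)) \<le> (1 + \<tau>\<^sup>2 / (2 * pi)) ^ 3" by simp
    qed (use \<open>0 < const_ext6\<close> in simp)
    finally show ?thesis unfolding \<tau>(1) .
  qed
  show thesis by (rule that[OF \<tau>\<^sub>0 main])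
qed

section \<open>Reduction to a perturbation of mean zero\<close>

text \<open>The quadratic mean dominates the arithmetic mean, which bounds the cross term from
  below; then | |z| - 1 | \<le> |z - 1|. Symmetrization thus does not move F away from the
  constants.\<close>

lemma sharp_near_1:
  "(sharp F t - 1)\<^sup>2 \<le> ((norm (F t - 1))\<^sup>2 + (norm (F (t + pi) - 1))\<^sup>2) / 2"
proof -
  define p q where "p = norm (F t)" and "q = norm (F (t + pi))"
  have sq: "(sharp F t)\<^sup>2 = (p\<^sup>2 + q\<^sup>2) / 2" by (simp add: sharp_square p_def q_def)
  have "(p + q) / 2 \<le> sharp F t"
  proof (rule power2_le_imp_le[OF _ sharp_nonneg])
    have "0 \<le> (p - q)\<^sup>2" by simp
    then show "((p + q) / 2)\<^sup>2 \<le> (sharp F t)\<^sup>2" unfolding sq by (simp add: power2_eq_square field_simps)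
  qed
  then have "(sharp F t - 1)\<^sup>2 \<le> (p\<^sup>2 + q\<^sup>2) / 2 - (p + q) + 1"
    using sq by (simp only: power2_diff) (simp add: field_simps)
  also have "\<dots> = ((p - 1)\<^sup>2 + (q - 1)\<^sup>2) / 2" by (simp add: power2_eq_square field_simps)
  also have "\<dots> \<le> ((norm (F t - 1))\<^sup>2 + (norm (F (t + pi) - 1))\<^sup>2) / 2"
  proof -
    have "\<bar>norm z - 1\<bar> \<le> norm (z - 1)" for z :: complex using norm_triangle_ineq3[of z 1] by simp
    then have "(norm z - 1)\<^sup>2 \<le> (norm (z - 1))\<^sup>2" for z :: complex
      by (metis abs_ge_zero power2_abs power_mono)
    then show ?thesis unfolding p_def q_def by (intro divide_right_mono add_mono) auto
  qed
  finally show ?thesis .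
qed

text \<open>The symmetrized function is h = c (1 + g) with c its mean. The factor c^6 that leaves
  the sixth power integral is matched by the cube of the squared L2 norm, so only the perturbation
  bound for 1 + g is needed.\<close>

lemma constants_local_max:
  obtains \<delta> :: real where "0 < \<delta>" "\<And>F. \<lbrakk>circle_L2 F; (\<integral>t. (norm (F t - 1))\<^sup>2 \<partial>T) \<le> \<delta>\<^sup>2\<rbrakk> \<Longrightarrow>
    0 < (\<integral>t. (norm (F t))\<^sup>2 \<partial>T) \<and> ext6 F \<le> ennreal (const_ext6 * ((\<integral>t. (norm (F t))\<^sup>2 \<partial>T) / (2 * pi)) ^ 3)"
proof -
  obtain \<tau>\<^sub>0 :: real where \<tau>\<^sub>0: "0 < \<tau>\<^sub>0" and pert: "\<And>g. \<lbrakk>g \<in> borel_measurable borel; \<And>t. g (t + pi) = g t; integrable T (\<lambda>t. (g t)\<^sup>2);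
      (\<integral>t. g t \<partial>T) = 0; (\<integral>t. (g t)\<^sup>2 \<partial>T) \<le> \<tau>\<^sub>0\<^sup>2\<rbrakk> \<Longrightarrow>
      (\<integral>x. (cos_ext (\<lambda>_. 1) x + cos_ext g x) ^ 6 \<partial>lborel) \<le> const_ext6 * (1 + (\<integral>t. (g t)\<^sup>2 \<partial>T) / (2 * pi)) ^ 3"
    by (rule perturbation_bound) blast
  \<comment> \<open>The bound 1/2 forces c \<ge> 1/2; the bound \<open>\<tau>\<^sub>0 / 2\<close>
    then compensates the division of g by c.\<close>
  define \<delta> where "\<delta> = min (1 / 2) (\<tau>\<^sub>0 / 2)"
  have \<delta>: "0 < \<delta>" "\<delta> \<le> 1 / 2" "\<delta> \<le> \<tau>\<^sub>0 / 2" using \<tau>\<^sub>0 by (auto simp: \<delta>_def)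
  have main: "0 < (\<integral>t. (norm (F t))\<^sup>2 \<partial>T) \<and> ext6 F \<le> ennreal (const_ext6 * ((\<integral>t. (norm (F t))\<^sup>2 \<partial>T) / (2 * pi)) ^ 3)"
    if F: "circle_L2 F" and near: "(\<integral>t. (norm (F t - 1))\<^sup>2 \<partial>T) \<le> \<delta>\<^sup>2" for F
  proof -
    note [measurable] = circle_L2_measurable[OF F]
    define h where "h = sharp F"
    have [measurable]: "h \<in> borel_measurable borel" unfolding h_def by measurable
    have h_anti: "h (t + pi) = h t" for t unfolding h_def by (rule sharp_antipodal[OF circle_L2_periodic[OF F]])
    have h2: "integrable T (\<lambda>t. (h t)\<^sup>2)"
      using circle_L2_integrable_sq[OF sharp_L2(1)[OF F]] by (simp add: h_def)
    have h1: "integrable T h" by (rule integrable_T_of_square) (simp_all add: h2)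
    define D where "D = (\<integral>t. (h t - 1)\<^sup>2 \<partial>T)"
    have hm2: "integrable T (\<lambda>t. (h t - 1)\<^sup>2)"
    proof -
      have "integrable T (\<lambda>t. (h t)\<^sup>2 + ((- 2) * h t + 1))" using h1 h2 by simp
      then show ?thesis by (simp add: power2_diff algebra_simps)
    qed
    have D: "D \<le> \<delta>\<^sup>2"
    proof -
      have per: "periodic (\<lambda>t. (norm (F t - 1))\<^sup>2)" using circle_L2_periodic[OF F] by (simp add: periodic_def)
      have i1: "integrable T (\<lambda>t. (norm (F t - 1))\<^sup>2)"
      proof (rule Bochner_Integration.integrable_bound)
        show "integrable T (\<lambda>t. 2 * (norm (F t))\<^sup>2 + 2)" using circle_L2_integrable_sq[OF F] by simp
        have "(norm (F t - 1))\<^sup>2 \<le> 2 * (norm (F t))\<^sup>2 + 2" for t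
        proof -
          have "(norm (F t - 1))\<^sup>2 \<le> (norm (F t) + 1)\<^sup>2"
            using norm_triangle_ineq4[of "F t" 1] by (intro power_mono) auto
          also have "\<dots> \<le> 2 * (norm (F t))\<^sup>2 + 2"
            using sum_squares_bound[of "norm (F t)" 1] by (simp add: power2_sum)
          finally show ?thesis .
        qed
        then show "AE t in T. norm ((norm (F t - 1))\<^sup>2) \<le> norm (2 * (norm (F t))\<^sup>2 + 2)" by (intro AE_I2) simp
        show "(\<lambda>t. (norm (F t - 1))\<^sup>2) \<in> borel_measurable T" by (rule measurable_T) measurable
      qed
      have meas: "(\<lambda>t. (norm (F t - 1))\<^sup>2) \<in> borel_measurable borel" by measurable
      note i2 = integrable_T_shift[OF meas per i1, of pi] and s = integral_T_shift[OF meas per, of pi]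
      have "D \<le> (\<integral>t. ((norm (F t - 1))\<^sup>2 + (norm (F (t + pi) - 1))\<^sup>2) / 2 \<partial>T)"
        unfolding D_def h_def
        by (rule integral_mono) (use hm2 i1 i2 sharp_near_1 in \<open>auto simp: h_def\<close>)
      also have "\<dots> = (\<integral>t. (norm (F t - 1))\<^sup>2 \<partial>T)" using i1 i2 s by simp
      finally show ?thesis using near by linarith
    qed
    define c where "c = (\<integral>t. h t \<partial>T) / (2 * pi)"
    have c1: "(\<integral>t. h t - 1 \<partial>T) = 2 * pi * (c - 1)"
    proof -
      have "(\<integral>t. h t - 1 \<partial>T) = (\<integral>t. h t \<partial>T) - (\<integral>t. 1 \<partial>T)"
        by (rule Bochner_Integration.integral_diff) (simp_all add: h1)
      then show ?thesis by (simp add: c_def right_diff_distrib)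
    qed
    have "(2 * pi * (c - 1))\<^sup>2 \<le> 2 * pi * D"
      using integral_T_square_le[of "\<lambda>t. h t - 1"] h1 hm2 unfolding c1 D_def by simp
    then have cD: "2 * pi * (c - 1)\<^sup>2 \<le> D"
      by (simp add: power_mult_distrib power2_eq_square)
    have "2 * (c - 1)\<^sup>2 \<le> 2 * pi * (c - 1)\<^sup>2"
      using pi_ge_two by (intro mult_right_mono) auto
    then have "(c - 1)\<^sup>2 \<le> \<delta>\<^sup>2" using cD D zero_le_power2[of "c - 1"] by linarith
    then have "\<bar>c - 1\<bar> \<le> \<delta>" using \<delta> by (simp add: abs_le_square_iff[symmetric])
    then have c: "1 / 2 \<le> c" using \<delta> by linarith
    define g where "g t = h t / c + (- 1)" for t
    have [measurable]: "g \<in> borel_measurable borel" unfolding g_def[abs_def] by measurable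
    have g_anti: "g (t + pi) = g t" for t by (simp add: g_def h_anti)
    have g1: "integrable T g" unfolding g_def[abs_def] using h1 by simp
    have g0: "(\<integral>t. g t \<partial>T) = 0" 
    proof -
      have "(\<integral>t. g t \<partial>T) = (\<integral>t. h t / c \<partial>T) + (\<integral>t. -1 \<partial>T)"
        unfolding g_def by (rule Bochner_Integration.integral_add) (simp_all add: h1)
      also have "(\<integral>t. h t / c \<partial>T) = (2 * pi * c) / c" by (simp add: c_def)
      finally show ?thesis using c by simp
    qed
    have gsq: "(g t)\<^sup>2 = (1 / c\<^sup>2) * (h t)\<^sup>2 + ((- 2 / c) * h t + 1)" for t
      using c by (simp add: g_def power2_eq_square field_simps)
    have g2: "integrable T (\<lambda>t. (g t)\<^sup>2)" unfolding gsq using h1 h2 by simp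
    have hg: "h t = c * (1 + g t)" for t using c by (simp add: g_def field_simps)
    have Nh: "(\<integral>t. (h t)\<^sup>2 \<partial>T) = c\<^sup>2 * (2 * pi + (\<integral>t. (g t)\<^sup>2 \<partial>T))"
    proof -
      have "(h t)\<^sup>2 = c\<^sup>2 * (1 + (2 * g t + (g t)\<^sup>2))" for t
        by (simp add: hg power2_eq_square algebra_simps)
      then show ?thesis using g0 g1 g2 by simp
    qed
    \<comment> \<open>Pythagoras for h - 1 = (c - 1) + c g, whose two parts are orthogonal.\<close>
    have "(\<integral>t. (c * g t)\<^sup>2 \<partial>T) = D - 2 * pi * (c - 1)\<^sup>2"
    proof -
      have "(c * g t)\<^sup>2 = (h t - 1)\<^sup>2 + ((- 2 * (c - 1)) * (h t - 1) + (c - 1)\<^sup>2)" for t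
        by (simp add: hg power2_eq_square algebra_simps)
      then have "(\<integral>t. (c * g t)\<^sup>2 \<partial>T) = D + ((- 2 * (c - 1)) * (2 * pi * (c - 1)) + 2 * pi * (c - 1)\<^sup>2)"
        using hm2 h1 c1 by (simp add: D_def)
      then show ?thesis by (simp add: power2_eq_square algebra_simps)
    qed
    then have "c\<^sup>2 * (\<integral>t. (g t)\<^sup>2 \<partial>T) = D - 2 * pi * (c - 1)\<^sup>2" by (simp add: power_mult_distrib)
    moreover have "0 \<le> 2 * pi * (c - 1)\<^sup>2" by simp
    ultimately have "c\<^sup>2 * (\<integral>t. (g t)\<^sup>2 \<partial>T) \<le> \<delta>\<^sup>2" using D by linarith
    moreover have "(1 / 2)\<^sup>2 * (\<integral>t. (g t)\<^sup>2 \<partial>T) \<le> c\<^sup>2 * (\<integral>t. (g t)\<^sup>2 \<partial>T)"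
      using c by (intro mult_right_mono power_mono Bochner_Integration.integral_nonneg) auto
    moreover have "\<delta>\<^sup>2 \<le> (\<tau>\<^sub>0 / 2)\<^sup>2" using \<delta> by (intro power_mono) auto
    ultimately have small: "(\<integral>t. (g t)\<^sup>2 \<partial>T) \<le> \<tau>\<^sub>0\<^sup>2" by (simp add: power_divide)
    have "0 \<le> (\<integral>t. (g t)\<^sup>2 \<partial>T)" by (rule Bochner_Integration.integral_nonneg) simp
    then have pos: "0 < (\<integral>t. (h t)\<^sup>2 \<partial>T)" unfolding Nh using c by (intro mult_pos_pos add_pos_nonneg) auto
    have N: "(\<integral>t. (norm (F t))\<^sup>2 \<partial>T) = (\<integral>t. (h t)\<^sup>2 \<partial>T)"
      unfolding h_def by (rule sharp_L2(2)[OF F, symmetric])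
    have ext: "cos_ext h x = c * (cos_ext (\<lambda>_. 1) x + cos_ext g x)" for x
    proof -
      have "h = (\<lambda>t. c * (1 + g t))" using hg by auto
      then have "cos_ext h x = cos_ext (\<lambda>t. c * (1 + g t)) x" by simp
      also have "\<dots> = c * cos_ext (\<lambda>t. 1 + g t) x" by (rule cos_ext_cmult)
      also have "cos_ext (\<lambda>t. 1 + g t) x = cos_ext (\<lambda>_. 1) x + cos_ext g x"
        by (rule cos_ext_linear) (use g1 in auto)
      finally show ?thesis .
    qed
    have "ext6 F \<le> ext6 (\<lambda>t. complex_of_real (h t))"
      unfolding h_def by (rule symmetrization[OF F])
    also have "\<dots> = ennreal (\<integral>x. cos_ext h x ^ 6 \<partial>lborel)"
      by (rule cos_ext_sixth_power(3)) (simp_all add: h_anti h2)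
    also have "(\<integral>x. cos_ext h x ^ 6 \<partial>lborel) = c ^ 6 * (\<integral>x. (cos_ext (\<lambda>_. 1) x + cos_ext g x) ^ 6 \<partial>lborel)"
      unfolding ext power_mult_distrib by (rule integral_mult_right_zero)
    also have "\<dots> \<le> c ^ 6 * (const_ext6 * (1 + (\<integral>t. (g t)\<^sup>2 \<partial>T) / (2 * pi)) ^ 3)"
      using c by (intro mult_left_mono pert g_anti g2 g0 small) auto
    also have "\<dots> = const_ext6 * ((\<integral>t. (norm (F t))\<^sup>2 \<partial>T) / (2 * pi)) ^ 3"
    proof -
      have "(\<integral>t. (norm (F t))\<^sup>2 \<partial>T) / (2 * pi) = c\<^sup>2 * (1 + (\<integral>t. (g t)\<^sup>2 \<partial>T) / (2 * pi))"
        unfolding N Nh by (simp add: field_simps)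
      then show ?thesis by (simp add: power_mult_distrib flip: power_mult)
    qed
    finally have "ext6 F \<le> ennreal (const_ext6 * ((\<integral>t. (norm (F t))\<^sup>2 \<partial>T) / (2 * pi)) ^ 3)"
      by (simp add: ennreal_leI)
    then show ?thesis using pos N by simp
  qed
  show thesis by (rule that[OF \<delta>(1) main])
qed


section \<open>Transfer to the arc length measure\<close>

lemma nn_integral_arc:
  assumes [measurable]: "\<phi> \<in> borel_measurable arc_measure"
  shows "(\<integral>\<^sup>+\<omega>. \<phi> \<omega> \<partial>arc_measure) = (\<integral>\<^sup>+t. \<phi> (circ t) \<partial>T)"
proof -
  have "\<phi> \<in> borel_measurable (restrict_space borel unit_circle)"
    using assms by (simp add: measurable_cong_sets[OF sets_arc_measure refl])
  then show ?thesis
    unfolding arc_measure_def circ_def by (intro nn_integral_distr measurable_circle_param) simp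
qed

lemma fourier_ext_eq:
  assumes "f \<in> borel_measurable arc_measure"
  shows "fourier_ext f x = circle_ext (\<lambda>t. f (circ t)) x"
proof -
  have f: "f \<in> borel_measurable (restrict_space borel unit_circle)"
    using assms by (simp add: measurable_cong_sets[OF sets_arc_measure refl])
  have "(\<lambda>\<omega>. exp (- \<i> * complex_of_real (x \<bullet> \<omega>))) \<in> borel_measurable borel" by measurable
  then have "(\<lambda>\<omega>. f \<omega> * exp (- \<i> * complex_of_real (x \<bullet> \<omega>))) \<in> borel_measurable (restrict_space borel unit_circle)"
    by (intro borel_measurable_times f measurable_restrict_space1)
  from integral_distr[OF measurable_circle_param this] show ?thesis
    unfolding fourier_ext_def arc_measure_def ext_def circ_def .
qed

lemma borel_measurable_circ:
  assumes "f \<in> borel_measurable arc_measure"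
  shows "(\<lambda>t. f (circ t)) \<in> borel_measurable borel"
proof -
  have "f \<in> borel_measurable (restrict_space borel unit_circle)"
    using assms by (simp add: measurable_cong_sets[OF sets_arc_measure refl])
  moreover have "circ \<in> borel \<rightarrow>\<^sub>M restrict_space borel unit_circle"
    by (rule measurable_restrict_space2) auto
  ultimately show ?thesis by (rule measurable_compose[rotated])
qed

lemma powr_numeral_norm: "norm z powr numeral k = norm z ^ numeral k" for z :: complex
  by (cases "z = 0") (simp_all add: powr_numeral)

text \<open>Finiteness excludes the infinite branch of \<open>Lp_norm\<close> and makes the Bochner
  integral genuine instead of a default 0.\<close>

lemma Lp_norm_2_arc:
  assumes f: "f \<in> borel_measurable arc_measure" and "Lp_norm 2 arc_measure f < \<infinity>"
  shows "integrable T (\<lambda>t. (norm (f (circ t)))\<^sup>2)"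
    and "Lp_norm 2 arc_measure f = ennreal ((\<integral>t. (norm (f (circ t)))\<^sup>2 \<partial>T) powr (1 / 2))"
proof -
  note [measurable] = f borel_measurable_circ[OF f]
  have I: "(\<integral>\<^sup>+\<omega>. ennreal (norm (f \<omega>) powr 2) \<partial>arc_measure) = (\<integral>\<^sup>+t. ennreal ((norm (f (circ t)))\<^sup>2) \<partial>T)"
    unfolding powr_numeral_norm by (rule nn_integral_arc) measurable
  have "(\<integral>\<^sup>+t. ennreal ((norm (f (circ t)))\<^sup>2) \<partial>T) < \<infinity>"
    using assms(2) unfolding Lp_norm_def I by (auto simp: Let_def top.not_eq_extremum split: if_splits)
  then show int: "integrable T (\<lambda>t. (norm (f (circ t)))\<^sup>2)"
    by (intro integrableI_nonneg) (auto intro: measurable_T)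
  have "(\<integral>\<^sup>+t. ennreal ((norm (f (circ t)))\<^sup>2) \<partial>T) = ennreal (\<integral>t. (norm (f (circ t)))\<^sup>2 \<partial>T)"
    by (rule nn_integral_eq_integral[OF int]) simp
  moreover have "0 \<le> (\<integral>t. (norm (f (circ t)))\<^sup>2 \<partial>T)" by (rule Bochner_Integration.integral_nonneg) simp
  ultimately show "Lp_norm 2 arc_measure f = ennreal ((\<integral>t. (norm (f (circ t)))\<^sup>2 \<partial>T) powr (1 / 2))"
    unfolding Lp_norm_def I by (simp add: Let_def)
qed

lemma Lp_norm_6_fourier_ext:
  assumes f: "f \<in> borel_measurable arc_measure" and fin: "ext6 (\<lambda>t. f (circ t)) \<noteq> \<infinity>"
  shows "Lp_norm 6 lborel (fourier_ext f) = ennreal (enn2real (ext6 (\<lambda>t. f (circ t))) powr (1 / 6))"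
  using fin unfolding Lp_norm_def powr_numeral_norm fourier_ext_eq[OF f] ext6_def[symmetric] by simp

theorem theorem1:
  "\<exists>\<delta>::real. \<delta> > 0 \<and>
     (\<forall>f \<in> L2_circle. Lp_norm 2 arc_measure (\<lambda>\<omega>. f \<omega> - 1) < ennreal \<delta>
        \<longrightarrow> Phi f \<le> Phi (\<lambda>_. 1))"
proof -
  obtain \<delta> :: real where \<delta>: "0 < \<delta>" and max: "\<And>F. \<lbrakk>circle_L2 F; (\<integral>t. (norm (F t - 1))\<^sup>2 \<partial>T) \<le> \<delta>\<^sup>2\<rbrakk> \<Longrightarrow>
    0 < (\<integral>t. (norm (F t))\<^sup>2 \<partial>T) \<and> ext6 F \<le> ennreal (const_ext6 * ((\<integral>t. (norm (F t))\<^sup>2 \<partial>T) / (2 * pi)) ^ 3)"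
    by (rule constants_local_max) blast
  have S: "0 \<le> const_ext6" unfolding const_ext6_def by (rule Bochner_Integration.integral_nonneg) simp
  have one: "ext6 (\<lambda>_. 1) = ennreal const_ext6"
    using cos_ext_sixth_power(3)[of "\<lambda>_. 1"] unfolding const_ext6_def by simp
  have "Lp_norm 2 arc_measure (\<lambda>_. 1) < \<infinity>"
    by (simp add: Lp_norm_def emeasure_arc_measure)
  from Lp_norm_2_arc(2)[OF _ this] have "Lp_norm 2 arc_measure (\<lambda>_. 1) = ennreal ((2 * pi) powr (1 / 2))"
    by simp
  moreover have "Lp_norm 6 lborel (fourier_ext (\<lambda>_. 1)) = ennreal (const_ext6 powr (1 / 6))"
    using Lp_norm_6_fourier_ext[of "\<lambda>_. 1"] one S by simp
  ultimately have Phi1: "Phi (\<lambda>_. 1) = ennreal (const_ext6 powr (1 / 6) / (2 * pi) powr (1 / 2))"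
    unfolding Phi_def by (simp add: divide_ennreal)
  have "Phi f \<le> Phi (\<lambda>_. 1)" if f: "f \<in> L2_circle" and near: "Lp_norm 2 arc_measure (\<lambda>\<omega>. f \<omega> - 1) < ennreal \<delta>" for f
  proof -
    define F where "F t = f (circ t)" for t
    have f_meas: "f \<in> borel_measurable arc_measure" and fin: "Lp_norm 2 arc_measure f < \<infinity>"
      using f by (auto simp: L2_circle_def)
    define N where "N = (\<integral>t. (norm (F t))\<^sup>2 \<partial>T)"
    have F: "circle_L2 F"
      using borel_measurable_circ[OF f_meas] Lp_norm_2_arc(1)[OF f_meas fin]
      by (simp add: circle_L2_def F_def[abs_def] periodic_def)
    have "(\<integral>t. (norm (F t - 1))\<^sup>2 \<partial>T) \<le> \<delta>\<^sup>2"
    proof -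
      let ?d = "\<integral>t. (norm (F t - 1))\<^sup>2 \<partial>T"
      have d: "0 \<le> ?d" by (rule Bochner_Integration.integral_nonneg) simp
      have "(\<lambda>\<omega>. f \<omega> - 1) \<in> borel_measurable arc_measure" using f_meas by measurable
      from Lp_norm_2_arc(2)[OF this] near
      have "ennreal (?d powr (1 / 2)) < ennreal \<delta>" by (simp add: F_def order.strict_trans)
      then have "sqrt ?d \<le> \<delta>" using \<delta> d by (simp add: ennreal_less_iff powr_half_sqrt)
      then show ?thesis using \<delta> d by (metis real_sqrt_le_iff real_sqrt_unique less_imp_le)
    qed
    \<comment> \<open>N > 0 keeps the quotient in \<open>Phi\<close> away from 0 / 0, and the bound
      makes \<open>ext6 F\<close> finite, as \<open>Lp_norm_6_fourier_ext\<close> requires.\<close>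
    from max[OF F this] have N: "0 < N" and le: "ext6 F \<le> ennreal (const_ext6 * (N / (2 * pi)) ^ 3)"
      by (auto simp: N_def)
    define A where "A = enn2real (ext6 F)"
    have fin6: "ext6 F \<noteq> \<infinity>" using le by (auto simp: top_unique)
    have A: "0 \<le> A" "A \<le> const_ext6 * (N / (2 * pi)) ^ 3"
      using enn2real_mono[OF le] S N by (simp_all add: A_def)
    \<comment> \<open>Under the sixth root the cube of N / (2 pi) becomes a square root, the ratio
      of the L2 norms of f and of 1.\<close>
    have "A powr (1 / 6) \<le> (const_ext6 * (N / (2 * pi)) ^ 3) powr (1 / 6)"
      using A by (intro powr_mono2) auto
    also have "\<dots> = const_ext6 powr (1 / 6) * ((N / (2 * pi)) powr 3) powr (1 / 6)"
      using S N by (subst powr_mult) (simp_all add: powr_numeral del: power_divide power_mult_distrib)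
    also have "\<dots> = const_ext6 powr (1 / 6) * (N powr (1 / 2) / (2 * pi) powr (1 / 2))"
      using N by (simp only: powr_powr) (simp add: powr_divide)
    finally have "A powr (1 / 6) / N powr (1 / 2) \<le> const_ext6 powr (1 / 6) / (2 * pi) powr (1 / 2)"
      using N by (simp add: field_simps)
    moreover have "Phi f = ennreal (A powr (1 / 6) / N powr (1 / 2))"
      using Lp_norm_6_fourier_ext[OF f_meas] Lp_norm_2_arc(2)[OF f_meas fin] fin6 N
      unfolding Phi_def by (simp add: divide_ennreal A_def N_def F_def[abs_def])
    ultimately show ?thesis unfolding Phi1 by (simp add: ennreal_leI)
  qed
  then show ?thesis using \<delta> by blast
qed

end
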